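(* Let $K$ be a field, $E$ a directed graph, $c$ an exclusive cycle of $E$, $v\in c^0$, $\mathbf N_c=\mathbf N_c^v$ and $H=E^0-R(c^0)$. Then the following hold. (1) $\operatorname{ann}(\mathbf N_c)=I(H,B_H)$. (2) $\mathbf N_c$ is graded simple and not simple. (3) If $c$ has more than one vertex and $w\neq v$ is a vertex of $c$, then $\mathbf N_c^v$ and $\mathbf N_c^w(n)$ are graded isomorphic, where $n$ is the length of the path from $v$ to $w$ in $c$. (4) If $d$ is an exclusive cycle and $w\in d^0$, the modules $\mathbf N_c^v$ and $\mathbf N_d^w$ are graded isomorphic if and only if $c=d$ and $v=w$. The modules $\mathbf N_c^v$ and $\mathbf N_d^w$ are isomorphic if and only if $c=d$. (5) The module $\mathbf N_c$ is not isomorphic to any of the Chen modules. Moreover, the annihilator of $\mathbf N_c$ is different from the annihilator of any of the Chen modules.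
   Context: Graphs. A directed graph $E$ has vertex set $E^0$, edge set $E^1$ and source and range maps $\mathbf s,\mathbf r:E^1\to E^0$ (arbitrary cardinalities). A sink emits no edges; an infinite emitter emits infinitely many edges; a vertex is regular if it is neither. A path is a vertex (length $0$) or a finite sequence $e_1\cdots e_n$ of edges with $\mathbf r(e_i)=\mathbf s(e_{i+1})$; $|p|$ is the length; $p^0$ is the set of vertices on $p$. A cycle is a path of positive length with equal source and range such that different edges in it have different sources; cycles differing only by the choice of the starting vertex are identified. A cycle $c$ is exclusive if no vertex of $c$ is on a cycle distinct from $c$. "The path from $v$ to $w$ in $c$" for distinct $v,w\in c^0$ is the shortest path from $v$ to $w$ along $c$. Write $u\ge v$ if there is a path from $u$ to $v$; $R(V)=\{u\in E^0\mid u\ge v\text{ for some }v\in V\}$. An infinite path is a sequence $\alpha=e_1e_2\cdots$ of edges with $\mathbf r(e_n)=\mathbf s(e_{n+1})$. Two infinite paths are tail equivalent if they become equal after removing finite prefixes (possibly of different lengths). An infinite path is rational if it is tail equivalent to $ddd\cdots$ for a cycle $d$, and irrational otherwise. Leavitt path algebra. $L_K(E)$ is the $K$-algebra generated by $E^0\cup E^1\cup\{e^*\mid e\in E^1\}$ with relations: $vw=\delta_{v,w}v$; $\mathbf s(e)e=e\mathbf r(e)=e$; $\mathbf r(e)e^*=e^*\mathbf s(e)=e^*$; $e^*f=\delta_{e,f}\mathbf r(e)$; $v=\sum_{e\in\mathbf s^{-1}(v)}ee^*$ for each regular $v$. It is $\mathbb Z$-graded, the $n$-component being the span of $pq^*$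 for paths $p,q$ with $|p|-|q|=n$. Modules are left modules; simple (graded simple) means $RM\ne0$ and no proper nontrivial (graded) submodules; $\operatorname{ann}(M)$ is the annihilator. For a $\mathbb Z$-graded module $M$, $M(n)$ is $M$ with grading $M(n)_m=M_{m+n}$. A graded isomorphism is a module isomorphism preserving degrees. Ideals. $H\subseteq E^0$ is hereditary if $u\in H$, $u\ge v$ imply $v\in H$, and saturated if $v\in H$ for every regular $v$ with $\mathbf r(\mathbf s^{-1}(v))\subseteq H$ (sets $E^0-R(V)$ are such). For such $H$, $B_H$ is the set of infinite emitters $v\in E^0-H$ such that $\mathbf s^{-1}(v)\cap\mathbf r^{-1}(E^0-H)$ is nonempty and finite; for $v\in B_H$, $v^H=v-\sum ee^*$ with the sum over $e\in\mathbf s^{-1}(v)\cap\mathbf r^{-1}(E^0-H)$. For $S\subseteq B_H$, $I(H,S)$ is the ideal generated by $H\cup\{v^H\mid v\in S\}$. Branching systems. A branching system of $E$ is a set $X$ with subsets $X_v$ ($v\in E^0$), $X_e$ ($e\in E^1$) and bijections $\sigma_e:X_{\mathbf r(e)}\to X_e$ such that the $X_v$ are mutually disjoint, the $X_e$ are mutually disjoint, $X_e\subseteq X_{\mathbf s(e)}$, and $X_v=\bigcup_{e\in\mathbf s^{-1}(v)}X_e$ for each regular $v$. $M(X)$ is the $K$-vector space with basis $X$ and $L_K(E)$-action: for $x\in X$, $v\cdot x=x$ if $x\in X_v$ and $0$ otherwise; $e\cdot x=\sigma_e(x)$ if $x\in X_{\mathbf r(e)}$ and $0$ otherwise; $e^*\cdot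 x=\sigma_e^{-1}(x)$ if $x\in X_e$ and $0$ otherwise. The module $\mathbf N_c^v$. For an exclusive cycle $c$ and $v\in c^0$, let $Y^v$ be the set of formal words $pq^*$ (paths in the extended graph, obtained from $E$ by adding reversed edges $e^*$) where $p,q$ are paths of $E$ with $\mathbf r(p)=\mathbf r(q)\in c^0$ and $\mathbf s(q)=v$. A word $pq^*\in Y^v$ is not reduced if $p$ and $q$ have positive length and end with the same edge, and reduced otherwise; $\operatorname{red}(pq^* )$ is the reduced word obtained by repeatedly replacing $(p'e)(q'e)^*$ by $p'q'^*$. Let $X^v$ be the set of reduced elements of $Y^v$, $X^v_w=\{pq^*\in X^v\mid\mathbf s(p)=w\}$, $X^v_e=\{\operatorname{red}(ers^* )\mid ers^*\in Y^v\}$, $\sigma_e(pq^* )=\operatorname{red}(epq^* )$ and $\deg(pq^* )=|p|-|q|$. This is a branching system and $\mathbf N_c^v=M(X^v)$, graded so that its $n$-component is the span of $x\in X^v$ with $\deg(x)=n$. Chen modules are the following simple modules. (i) $\mathbf V_{[\alpha]}=M(X)$ for an infinite path $\alpha$, where $X$ is the set of infinite paths tail equivalent to $\alpha$, $X_v$ consists of those with source $v$, $X_e$ of those with first edge $e$, $\sigma_e(\beta)=e\beta$. (ii) $\mathbf V^f_{[\alpha]}$ for a rational infinite path $\alpha$, tail equivalent to $ddd\cdots$ for a cycle $d=e_1\cdots e_m$, and an irreducible $f\in K[x,x^{-1}]$: let $K'=K[x,x^{-1}]/(f)$ and $\bar x$ the class of $x$; $\mathbf V^f_{[\alpha]}$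 is the $K'$-vector space with basis the infinite paths tail equivalent to $\alpha$ with $K'$-linear action given by the formulas for $\mathbf V_{[\alpha]}$ except that $e_1\cdot\beta=\bar x\,e_1\beta$ if $\mathbf s(\beta)=\mathbf r(e_1)$ and $e_1^*\cdot(e_1\beta)=\bar x^{-1}\beta$, regarded as an $L_K(E)$-module. (iii) $\mathbf N_v=M(X)$ for a sink $v$, where $X$ is the set of all paths ending at $v$, $X_w$ consists of those with source $w$, $X_e$ of those with first edge $e$, $\sigma_e(p)=ep$. (iv) $\mathbf N_v=M(X)$ for an infinite emitter $v$, with $X,X_w,X_e,\sigma_e$ as in (iii). *)

theory Defs
  imports
    "Graph_Theory.Arc_Walk"
    "HOL-Library.Poly_Mapping"
    "HOL-Algebra.QuotRing"
    "HOL-Algebra.Module"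
    "HOL-Algebra.Algebraic_Closure_Type"
begin

section \<open>Directed graphs\<close>

text \<open>
  A graph is a \<^locale>\<open>wf_digraph\<close>: loops and parallel edges are allowed and there is no
  restriction on cardinalities.  The source of an edge is its tail and the range is its head.
  A path is encoded by its source together with its list of edges, so that the vertex \<open>u\<close> is
  \<open>(u, [])\<close>; \<open>pre_digraph.awalk G u p w\<close> says that \<open>(u, p)\<close> is a path of \<open>G\<close> with range \<open>w\<close>.
\<close>

type_synonym ('v, 'e) path = "'v \<times> 'e list"

definition sink :: "('v, 'e) pre_digraph \<Rightarrow> 'v \<Rightarrow> bool" where
  "sink G v \<longleftrightarrow> v \<in> verts G \<and> out_arcs G v = {}"

definition infinite_emitter :: "('v, 'e) pre_digraph \<Rightarrow> 'v \<Rightarrow> bool" where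
  "infinite_emitter G v \<longleftrightarrow> v \<in> verts G \<and> infinite (out_arcs G v)"

definition regular :: "('v, 'e) pre_digraph \<Rightarrow> 'v \<Rightarrow> bool" where
  "regular G v \<longleftrightarrow> v \<in> verts G \<and> \<not> sink G v \<and> \<not> infinite_emitter G v"

text \<open>
  Cycles are \<open>pre_digraph.cycle\<close>, i.e. edge lists with a chosen starting vertex.  Cycles that
  differ only by the starting vertex are identified by \<open>same_cycle\<close>.  Since a cycle is closed,
  the vertices on it are the sources of its edges.
\<close>

definition same_cycle :: "'e list \<Rightarrow> 'e list \<Rightarrow> bool" where
  "same_cycle c d \<longleftrightarrow> (\<exists>k. d = rotate k c)"

definition cycle_verts :: "('v, 'e) pre_digraph \<Rightarrow> 'e list \<Rightarrow> 'v set" where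
  "cycle_verts G c = tail G ` set c"

definition exclusive_cycle :: "('v, 'e) pre_digraph \<Rightarrow> 'e list \<Rightarrow> bool" where
  "exclusive_cycle G c \<longleftrightarrow> pre_digraph.cycle G c \<and>
     (\<forall>d. pre_digraph.cycle G d \<and> cycle_verts G d \<inter> cycle_verts G c \<noteq> {} \<longrightarrow> same_cycle c d)"

definition path_in_cycle :: "('v, 'e) pre_digraph \<Rightarrow> 'e list \<Rightarrow> 'v \<Rightarrow> 'v \<Rightarrow> 'e list" where
  "path_in_cycle G c v w = (ARG_MIN length p. pre_digraph.awalk G v p w \<and> set p \<subseteq> set c)"

definition root_set :: "('v, 'e) pre_digraph \<Rightarrow> 'v set \<Rightarrow> 'v set" where
  "root_set G V = {u \<in> verts G. \<exists>v\<in>V. \<exists>p. pre_digraph.awalk G u p v}"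

definition breaking_vertices :: "('v, 'e) pre_digraph \<Rightarrow> 'v set \<Rightarrow> 'v set" where
  "breaking_vertices G H =
     {v \<in> verts G - H. infinite_emitter G v \<and>
        {e \<in> out_arcs G v. head G e \<in> verts G - H} \<noteq> {} \<and>
        finite {e \<in> out_arcs G v. head G e \<in> verts G - H}}"

definition infinite_path :: "('v, 'e) pre_digraph \<Rightarrow> (nat \<Rightarrow> 'e) \<Rightarrow> bool" where
  "infinite_path G \<alpha> \<longleftrightarrow> (\<forall>n. \<alpha> n \<in> arcs G \<and> head G (\<alpha> n) = tail G (\<alpha> (Suc n)))"

definition tail_equivalent :: "(nat \<Rightarrow> 'e) \<Rightarrow> (nat \<Rightarrow> 'e) \<Rightarrow> bool" where
  "tail_equivalent \<alpha> \<beta> \<longleftrightarrow> (\<exists>m n. \<forall>k. \<alpha> (m + k) = \<beta> (n + k))"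

definition repeat_path :: "'e list \<Rightarrow> nat \<Rightarrow> 'e" where
  "repeat_path d = (\<lambda>n. d ! (n mod length d))"

section \<open>Left modules over rings that need not have an identity\<close>

text \<open>
  A ring without identity is a \<^typ>\<open>'a ring\<close> whose \<^const>\<open>one\<close> is never used (and
  need not lie in the carrier).  A left module over it is a \<^typ>\<open>('a, 'm) module\<close>, of which
  only \<^const>\<open>carrier\<close>, \<^const>\<open>zero\<close>, \<^const>\<open>add\<close> and \<^const>\<open>module.smult\<close> are used.
\<close>

definition nonunital_ideal :: "'a set \<Rightarrow> 'a ring \<Rightarrow> bool" where
  "nonunital_ideal I R \<longleftrightarrow> additive_subgroup I R \<and>
     (\<forall>a\<in>I. \<forall>r\<in>carrier R. r \<otimes>\<^bsub>R\<^esub> a \<in> I \<and> a \<otimes>\<^bsub>R\<^esub> r \<in> I)"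

definition generated_ideal :: "'a ring \<Rightarrow> 'a set \<Rightarrow> 'a set" where
  "generated_ideal R S = \<Inter>{I. nonunital_ideal I R \<and> S \<subseteq> I}"

definition left_module :: "'a ring \<Rightarrow> ('a, 'm) module \<Rightarrow> bool" where
  "left_module R M \<longleftrightarrow> abelian_group M \<and>
     (\<forall>a\<in>carrier R. \<forall>x\<in>carrier M. a \<odot>\<^bsub>M\<^esub> x \<in> carrier M) \<and>
     (\<forall>a\<in>carrier R. \<forall>b\<in>carrier R. \<forall>x\<in>carrier M.
        (a \<oplus>\<^bsub>R\<^esub> b) \<odot>\<^bsub>M\<^esub> x = a \<odot>\<^bsub>M\<^esub> x \<oplus>\<^bsub>M\<^esub> b \<odot>\<^bsub>M\<^esub> x \<and>
        (a \<otimes>\<^bsub>R\<^esub> b) \<odot>\<^bsub>M\<^esub> x = a \<odot>\<^bsub>M\<^esub> (b \<odot>\<^bsub>M\<^esub> x)) \<and>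
     (\<forall>a\<in>carrier R. \<forall>x\<in>carrier M. \<forall>y\<in>carrier M.
        a \<odot>\<^bsub>M\<^esub> (x \<oplus>\<^bsub>M\<^esub> y) = a \<odot>\<^bsub>M\<^esub> x \<oplus>\<^bsub>M\<^esub> a \<odot>\<^bsub>M\<^esub> y)"

definition nontrivial_action :: "'a ring \<Rightarrow> ('a, 'm) module \<Rightarrow> bool" where
  "nontrivial_action R M \<longleftrightarrow> (\<exists>a\<in>carrier R. \<exists>x\<in>carrier M. a \<odot>\<^bsub>M\<^esub> x \<noteq> \<zero>\<^bsub>M\<^esub>)"

definition simple_module :: "'a ring \<Rightarrow> ('a, 'm) module \<Rightarrow> bool" where
  "simple_module R M \<longleftrightarrow> left_module R M \<and> nontrivial_action R M \<and>
     (\<forall>N. submodule N R M \<longrightarrow> N = {\<zero>\<^bsub>M\<^esub>} \<or> N = carrier M)"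

definition annihilator :: "'a ring \<Rightarrow> ('a, 'm) module \<Rightarrow> 'a set" where
  "annihilator R M = {a \<in> carrier R. \<forall>x\<in>carrier M. a \<odot>\<^bsub>M\<^esub> x = \<zero>\<^bsub>M\<^esub>}"

definition module_iso ::
  "'a ring \<Rightarrow> ('a, 'm) module \<Rightarrow> ('a, 'n) module \<Rightarrow> ('m \<Rightarrow> 'n) \<Rightarrow> bool" where
  "module_iso R M N h \<longleftrightarrow> bij_betw h (carrier M) (carrier N) \<and>
     (\<forall>x\<in>carrier M. \<forall>y\<in>carrier M. h (x \<oplus>\<^bsub>M\<^esub> y) = h x \<oplus>\<^bsub>N\<^esub> h y) \<and>
     (\<forall>a\<in>carrier R. \<forall>x\<in>carrier M. h (a \<odot>\<^bsub>M\<^esub> x) = a \<odot>\<^bsub>N\<^esub> h x)"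

definition isomorphic :: "'a ring \<Rightarrow> ('a, 'm) module \<Rightarrow> ('a, 'n) module \<Rightarrow> bool" where
  "isomorphic R M N \<longleftrightarrow> (\<exists>h. module_iso R M N h)"

text \<open>A grading is the family of homogeneous components, indexed by their degree.\<close>

type_synonym 'm grading = "int \<Rightarrow> 'm set"

definition homogeneous_decomposition ::
  "('a, 'm) module \<Rightarrow> 'm grading \<Rightarrow> 'm \<Rightarrow> (int \<Rightarrow> 'm) \<Rightarrow> bool" where
  "homogeneous_decomposition M Mg x y \<longleftrightarrow>
     (\<forall>n. y n \<in> Mg n) \<and> finite {n. y n \<noteq> \<zero>\<^bsub>M\<^esub>} \<and> x = (\<Oplus>\<^bsub>M\<^esub>n\<in>{n. y n \<noteq> \<zero>\<^bsub>M\<^esub>}. y n)"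

definition graded_module ::
  "'a ring \<Rightarrow> 'a grading \<Rightarrow> ('a, 'm) module \<Rightarrow> 'm grading \<Rightarrow> bool" where
  "graded_module R Rg M Mg \<longleftrightarrow> left_module R M \<and>
     (\<forall>n. additive_subgroup (Mg n) M) \<and>
     (\<forall>x\<in>carrier M. \<exists>!y. homogeneous_decomposition M Mg x y) \<and>
     (\<forall>m n. \<forall>a\<in>Rg m. \<forall>x\<in>Mg n. a \<odot>\<^bsub>M\<^esub> x \<in> Mg (m + n))"

definition graded_submodule ::
  "'m set \<Rightarrow> 'a ring \<Rightarrow> ('a, 'm) module \<Rightarrow> 'm grading \<Rightarrow> bool" where
  "graded_submodule N R M Mg \<longleftrightarrow> submodule N R M \<and>
     (\<forall>x\<in>N. \<exists>y. homogeneous_decomposition M (\<lambda>n. N \<inter> Mg n) x y)"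

definition graded_simple_module ::
  "'a ring \<Rightarrow> 'a grading \<Rightarrow> ('a, 'm) module \<Rightarrow> 'm grading \<Rightarrow> bool" where
  "graded_simple_module R Rg M Mg \<longleftrightarrow> graded_module R Rg M Mg \<and> nontrivial_action R M \<and>
     (\<forall>N. graded_submodule N R M Mg \<longrightarrow> N = {\<zero>\<^bsub>M\<^esub>} \<or> N = carrier M)"

definition graded_isomorphic ::
  "'a ring \<Rightarrow> ('a, 'm) module \<Rightarrow> 'm grading \<Rightarrow> ('a, 'n) module \<Rightarrow> 'n grading \<Rightarrow> bool" where
  "graded_isomorphic R M Mg N Ng \<longleftrightarrow> (\<exists>h. module_iso R M N h \<and> (\<forall>n. h ` Mg n \<subseteq> Ng n))"

definition shift_grading :: "int \<Rightarrow> 'm grading \<Rightarrow> 'm grading" where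
  "shift_grading n Mg = (\<lambda>m. Mg (m + n))"

section \<open>Leavitt path algebras\<close>

text \<open>
  Words form an additive monoid under concatenation.  With this instance, finitely supported
  functions from words to a field (\<^theory>\<open>HOL-Library.Poly_Mapping\<close>) carry the multiplication
  of the free unital algebra of noncommutative polynomials.
\<close>

datatype 'g nc_word = NC_Word (letters: "'g list")

instantiation nc_word :: (type) monoid_add
begin

definition "0 = NC_Word []"

definition "x + y = NC_Word (letters x @ letters y)"

instance
  by standard (simp_all add: zero_nc_word_def plus_nc_word_def)

end

datatype ('v, 'e) gen = Vert 'v | Edge 'e | Ghost 'e

type_synonym ('v, 'e, 'k) free_elem = "('v, 'e) gen nc_word \<Rightarrow>\<^sub>0 'k"

type_synonym ('v, 'e, 'k) lpa_elem = "('v, 'e, 'k) free_elem set"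

definition gens :: "('v, 'e) pre_digraph \<Rightarrow> ('v, 'e) gen set" where
  "gens G = Vert ` verts G \<union> Edge ` arcs G \<union> Ghost ` arcs G"

text \<open>The argument \<open>K\<close> below only serves to name the field of coefficients.\<close>

definition free_algebra ::
  "'k::field itself \<Rightarrow> ('v, 'e) pre_digraph \<Rightarrow> ('v, 'e, 'k) free_elem ring" where
  "free_algebra K G =
     ring_of_type_algebra\<lparr>carrier := {a. \<forall>w\<in>Poly_Mapping.keys a. set (letters w) \<subseteq> gens G}\<rparr>"

definition gn :: "('v, 'e) gen \<Rightarrow> ('v, 'e, 'k::field) free_elem" where
  "gn g = Poly_Mapping.single (NC_Word [g]) 1"

definition lpa_relations ::
  "'k::field itself \<Rightarrow> ('v, 'e) pre_digraph \<Rightarrow> ('v, 'e, 'k) free_elem set" where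
  "lpa_relations K G =
     {gn (Vert v) * gn (Vert w) - (if v = w then gn (Vert v) else 0) | v w.
        v \<in> verts G \<and> w \<in> verts G} \<union>
     {gn (Vert (tail G e)) * gn (Edge e) - gn (Edge e) | e. e \<in> arcs G} \<union>
     {gn (Edge e) * gn (Vert (head G e)) - gn (Edge e) | e. e \<in> arcs G} \<union>
     {gn (Vert (head G e)) * gn (Ghost e) - gn (Ghost e) | e. e \<in> arcs G} \<union>
     {gn (Ghost e) * gn (Vert (tail G e)) - gn (Ghost e) | e. e \<in> arcs G} \<union>
     {gn (Ghost e) * gn (Edge f) - (if e = f then gn (Vert (head G e)) else 0) | e f.
        e \<in> arcs G \<and> f \<in> arcs G} \<union>
     {gn (Vert v) - (\<Sum>e\<in>out_arcs G v. gn (Edge e) * gn (Ghost e)) | v. regular G v}"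

definition lpa_relation_ideal ::
  "'k::field itself \<Rightarrow> ('v, 'e) pre_digraph \<Rightarrow> ('v, 'e, 'k) free_elem set" where
  "lpa_relation_ideal K G = Idl\<^bsub>free_algebra K G\<^esub> (lpa_relations K G)"

definition lpa_class :: "'k::field itself \<Rightarrow> ('v, 'e) pre_digraph \<Rightarrow>
    ('v, 'e, 'k) free_elem \<Rightarrow> ('v, 'e, 'k) lpa_elem" where
  "lpa_class K G a = lpa_relation_ideal K G +>\<^bsub>free_algebra K G\<^esub> a"

text \<open>
  The Leavitt path algebra is generated by the given generators as an algebra that need not have
  an identity: only classes of noncommutative polynomials with zero constant term are admitted.
  (All relations have zero constant term, so the ideal generated by them in the free unital
  algebra is also the algebra ideal generated by them in the free nonunital algebra.)
\<close>

definition leavitt ::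
  "'k::field itself \<Rightarrow> ('v, 'e) pre_digraph \<Rightarrow> ('v, 'e, 'k) lpa_elem ring" where
  "leavitt K G = (free_algebra K G Quot lpa_relation_ideal K G)
     \<lparr>carrier := lpa_class K G ` {a \<in> carrier (free_algebra K G). Poly_Mapping.lookup a 0 = 0}\<rparr>"

fun path_word :: "('v, 'e) path \<Rightarrow> ('v, 'e) gen list" where
  "path_word (u, p) = (if p = [] then [Vert u] else map Edge p)"

fun ghost_word :: "('v, 'e) path \<Rightarrow> ('v, 'e) gen list" where
  "ghost_word (u, q) = (if q = [] then [Vert u] else map Ghost (rev q))"

definition leavitt_grading ::
  "'k::field itself \<Rightarrow> ('v, 'e) pre_digraph \<Rightarrow> ('v, 'e, 'k) lpa_elem grading" where
  "leavitt_grading K G n = lpa_class K G `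
     {a. Poly_Mapping.keys a \<subseteq>
           {NC_Word (path_word (u, p) @ ghost_word (w, q)) | u p w q.
              (\<exists>x. pre_digraph.awalk G u p x) \<and> (\<exists>y. pre_digraph.awalk G w q y) \<and>
              int (length p) - int (length q) = n}}"

definition breaking_element :: "'k::field itself \<Rightarrow> ('v, 'e) pre_digraph \<Rightarrow> 'v set \<Rightarrow> 'v \<Rightarrow>
    ('v, 'e, 'k) lpa_elem" where
  "breaking_element K G H v = lpa_class K G
     (gn (Vert v) -
      (\<Sum>e\<in>{e \<in> out_arcs G v. head G e \<in> verts G - H}. gn (Edge e) * gn (Ghost e)))"

definition admissible_ideal :: "'k::field itself \<Rightarrow> ('v, 'e) pre_digraph \<Rightarrow> 'v set \<Rightarrow> 'v set \<Rightarrow>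
    ('v, 'e, 'k) lpa_elem set" where
  "admissible_ideal K G H S = generated_ideal (leavitt K G)
     ((\<lambda>v. lpa_class K G (gn (Vert v))) ` H \<union> breaking_element K G H ` S)"

section \<open>Modules from branching systems\<close>

text \<open>
  The underlying module is free with basis \<open>B\<close> over a ring \<open>C\<close>, into which the field is mapped
  by \<open>\<iota>\<close>: for most modules below \<open>C\<close> is the field itself, but for the twisted Chen modules it is
  a quotient of the Laurent polynomials.  Elements are functions to \<open>C\<close> with finite support
  contained in \<open>B\<close>.
\<close>

definition basis_vec :: "'c ring \<Rightarrow> 'x \<Rightarrow> 'x \<Rightarrow> 'c" where
  "basis_vec C x = (\<lambda>y. if y = x then \<one>\<^bsub>C\<^esub> else \<zero>\<^bsub>C\<^esub>)"

definition zero_vec :: "'c ring \<Rightarrow> 'x \<Rightarrow> 'c" where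
  "zero_vec C = (\<lambda>y. \<zero>\<^bsub>C\<^esub>)"

definition scale_vec :: "'c ring \<Rightarrow> 'c \<Rightarrow> ('x \<Rightarrow> 'c) \<Rightarrow> 'x \<Rightarrow> 'c" where
  "scale_vec C a m = (\<lambda>y. a \<otimes>\<^bsub>C\<^esub> m y)"

definition free_carrier :: "'c ring \<Rightarrow> 'x set \<Rightarrow> ('x \<Rightarrow> 'c) set" where
  "free_carrier C B = {m. (\<forall>x. m x \<in> carrier C) \<and> finite {x. m x \<noteq> \<zero>\<^bsub>C\<^esub>} \<and>
     (\<forall>x. m x \<noteq> \<zero>\<^bsub>C\<^esub> \<longrightarrow> x \<in> B)}"

definition linear_extension :: "'c ring \<Rightarrow> ('x \<Rightarrow> 'x \<Rightarrow> 'c) \<Rightarrow> ('x \<Rightarrow> 'c) \<Rightarrow> 'x \<Rightarrow> 'c" where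
  "linear_extension C \<phi> m = (\<lambda>y. \<Oplus>\<^bsub>C\<^esub>x\<in>{x. m x \<noteq> \<zero>\<^bsub>C\<^esub>}. m x \<otimes>\<^bsub>C\<^esub> \<phi> x y)"

text \<open>In the following, \<open>\<phi> g x\<close> is the result of the action of a generator \<open>g\<close> on a basis element \<open>x\<close>.\<close>

definition word_action ::
  "'c ring \<Rightarrow> ('g \<Rightarrow> 'x \<Rightarrow> 'x \<Rightarrow> 'c) \<Rightarrow> 'g nc_word \<Rightarrow> ('x \<Rightarrow> 'c) \<Rightarrow> 'x \<Rightarrow> 'c" where
  "word_action C \<phi> w = foldr (\<lambda>g. linear_extension C (\<phi> g)) (letters w)"

definition free_action :: "'c ring \<Rightarrow> ('k::field \<Rightarrow> 'c) \<Rightarrow> ('g \<Rightarrow> 'x \<Rightarrow> 'x \<Rightarrow> 'c) \<Rightarrow>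
    ('g nc_word \<Rightarrow>\<^sub>0 'k) \<Rightarrow> ('x \<Rightarrow> 'c) \<Rightarrow> 'x \<Rightarrow> 'c" where
  "free_action C \<iota> \<phi> a m =
     (\<lambda>y. \<Oplus>\<^bsub>C\<^esub>w\<in>Poly_Mapping.keys a. \<iota> (Poly_Mapping.lookup a w) \<otimes>\<^bsub>C\<^esub> word_action C \<phi> w m y)"

text \<open>
  An element of the Leavitt path algebra is a coset; it acts as any of its representatives does.
  This is independent of the representative whenever \<open>\<phi>\<close> respects the defining relations.
\<close>

definition lpa_module :: "'c ring \<Rightarrow> ('k::field \<Rightarrow> 'c) \<Rightarrow> 'x set \<Rightarrow>
    (('v, 'e) gen \<Rightarrow> 'x \<Rightarrow> 'x \<Rightarrow> 'c) \<Rightarrow> (('v, 'e, 'k) lpa_elem, 'x \<Rightarrow> 'c) module" where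
  "lpa_module C \<iota> B \<phi> =
     \<lparr>carrier = free_carrier C B, monoid.mult = undefined, one = undefined,
      zero = zero_vec C, add = (\<lambda>m n x. m x \<oplus>\<^bsub>C\<^esub> n x),
      module.smult = (\<lambda>A m. the_elem ((\<lambda>a. free_action C \<iota> \<phi> a m) ` A))\<rparr>"

record ('v, 'e, 'x) branching =
  points :: "'x set"
  vert_part :: "'v \<Rightarrow> 'x set"
  edge_part :: "'e \<Rightarrow> 'x set"
  edge_map :: "'e \<Rightarrow> 'x \<Rightarrow> 'x"

fun branching_action :: "('v, 'e) pre_digraph \<Rightarrow> ('v, 'e, 'x) branching \<Rightarrow> 'c ring \<Rightarrow>
    ('v, 'e) gen \<Rightarrow> 'x \<Rightarrow> 'x \<Rightarrow> 'c" where
  "branching_action G B C (Vert v) x =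
     (if x \<in> vert_part B v then basis_vec C x else zero_vec C)"
| "branching_action G B C (Edge e) x =
     (if x \<in> vert_part B (head G e) then basis_vec C (edge_map B e x) else zero_vec C)"
| "branching_action G B C (Ghost e) x =
     (if x \<in> edge_part B e
      then basis_vec C (inv_into (vert_part B (head G e)) (edge_map B e) x) else zero_vec C)"

definition branching_module :: "'k::field itself \<Rightarrow> ('v, 'e) pre_digraph \<Rightarrow>
    ('v, 'e, 'x) branching \<Rightarrow> (('v, 'e, 'k) lpa_elem, 'x \<Rightarrow> 'k) module" where
  "branching_module K G B =
     lpa_module ring_of_type_algebra (\<lambda>k. k) (points B) (branching_action G B ring_of_type_algebra)"

section \<open>The module of an exclusive cycle\<close>

text \<open>
  The formal word \<open>pq\<^sup>*\<close> is encoded as the pair of the paths \<open>p\<close> and \<open>q\<close>.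
\<close>

definition cycle_words :: "('v, 'e) pre_digraph \<Rightarrow> 'e list \<Rightarrow> 'v \<Rightarrow>
    (('v, 'e) path \<times> ('v, 'e) path) set" where
  "cycle_words G c v = {((w, p), (v, q)) | w p q.
     \<exists>u\<in>cycle_verts G c. pre_digraph.awalk G w p u \<and> pre_digraph.awalk G v q u}"

fun reduced :: "('v, 'e) path \<times> ('v, 'e) path \<Rightarrow> bool" where
  "reduced ((w, p), (v, q)) \<longleftrightarrow> \<not> (p \<noteq> [] \<and> q \<noteq> [] \<and> last p = last q)"

function red :: "('v, 'e) path \<times> ('v, 'e) path \<Rightarrow> ('v, 'e) path \<times> ('v, 'e) path" where
  "red ((w, p), (v, q)) =
     (if p \<noteq> [] \<and> q \<noteq> [] \<and> last p = last q then red ((w, butlast p), (v, butlast q))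
      else ((w, p), (v, q)))"
  by pat_completeness auto
termination
  by (relation "measure (\<lambda>((w, p), (v, q)). length p)") auto

declare red.simps [simp del]

definition cycle_branching :: "('v, 'e) pre_digraph \<Rightarrow> 'e list \<Rightarrow> 'v \<Rightarrow>
    ('v, 'e, ('v, 'e) path \<times> ('v, 'e) path) branching" where
  "cycle_branching G c v =
     \<lparr>points = {x \<in> cycle_words G c v. reduced x},
      vert_part = (\<lambda>w. {x \<in> cycle_words G c v. reduced x \<and> fst (fst x) = w}),
      edge_part = (\<lambda>e. {red ((tail G e, e # r), s) | r s.
                          ((tail G e, e # r), s) \<in> cycle_words G c v}),
      edge_map = (\<lambda>e ((w, p), q). red ((tail G e, e # p), q))\<rparr>"

definition cycle_module :: "'k::field itself \<Rightarrow> ('v, 'e) pre_digraph \<Rightarrow> 'e list \<Rightarrow> 'v \<Rightarrow>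
    (('v, 'e, 'k) lpa_elem, ('v, 'e) path \<times> ('v, 'e) path \<Rightarrow> 'k) module" where
  "cycle_module K G c v = branching_module K G (cycle_branching G c v)"

fun word_degree :: "('v, 'e) path \<times> ('v, 'e) path \<Rightarrow> int" where
  "word_degree ((w, p), (v, q)) = int (length p) - int (length q)"

definition cycle_grading :: "'k::field itself \<Rightarrow> ('v, 'e) pre_digraph \<Rightarrow> 'e list \<Rightarrow> 'v \<Rightarrow>
    (('v, 'e) path \<times> ('v, 'e) path \<Rightarrow> 'k) grading" where
  "cycle_grading K G c v n =
     {m \<in> carrier (cycle_module K G c v). \<forall>x. m x \<noteq> 0 \<longrightarrow> word_degree x = n}"

section \<open>Chen modules\<close>

definition infinite_path_branching ::
  "('v, 'e) pre_digraph \<Rightarrow> (nat \<Rightarrow> 'e) \<Rightarrow> ('v, 'e, nat \<Rightarrow> 'e) branching" where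
  "infinite_path_branching G \<alpha> =
     \<lparr>points = {\<beta>. infinite_path G \<beta> \<and> tail_equivalent \<beta> \<alpha>},
      vert_part = (\<lambda>v. {\<beta>. infinite_path G \<beta> \<and> tail_equivalent \<beta> \<alpha> \<and> tail G (\<beta> 0) = v}),
      edge_part = (\<lambda>e. {\<beta>. infinite_path G \<beta> \<and> tail_equivalent \<beta> \<alpha> \<and> \<beta> 0 = e}),
      edge_map = (\<lambda>e \<beta>. case_nat e \<beta>)\<rparr>"

definition chen_module :: "'k::field itself \<Rightarrow> ('v, 'e) pre_digraph \<Rightarrow> (nat \<Rightarrow> 'e) \<Rightarrow>
    (('v, 'e, 'k) lpa_elem, (nat \<Rightarrow> 'e) \<Rightarrow> 'k) module" where
  "chen_module K G \<alpha> = branching_module K G (infinite_path_branching G \<alpha>)"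

text \<open>\<^typ>\<open>int \<Rightarrow>\<^sub>0 'k\<close>, the group algebra of the integers, is the ring of Laurent polynomials.\<close>

type_synonym 'k laurent = "int \<Rightarrow>\<^sub>0 'k"

definition laurent_class :: "'k::field laurent \<Rightarrow> 'k laurent \<Rightarrow> 'k laurent set" where
  "laurent_class f a = PIdl\<^bsub>ring_of_type_algebra\<^esub> f +>\<^bsub>ring_of_type_algebra\<^esub> a"

definition laurent_quotient :: "'k::field laurent \<Rightarrow> 'k laurent set ring" where
  "laurent_quotient f = ring_of_type_algebra Quot (PIdl\<^bsub>ring_of_type_algebra\<^esub> f)"

definition twisted_action :: "('v, 'e) pre_digraph \<Rightarrow> (nat \<Rightarrow> 'e) \<Rightarrow> 'e list \<Rightarrow> 'k::field laurent \<Rightarrow>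
    ('v, 'e) gen \<Rightarrow> (nat \<Rightarrow> 'e) \<Rightarrow> (nat \<Rightarrow> 'e) \<Rightarrow> 'k laurent set" where
  "twisted_action G \<alpha> d f g \<beta> =
     (let C = laurent_quotient f;
          m = branching_action G (infinite_path_branching G \<alpha>) C g \<beta>
      in if g = Edge (hd d) then scale_vec C (laurent_class f (Poly_Mapping.single 1 1)) m
         else if g = Ghost (hd d) then scale_vec C (laurent_class f (Poly_Mapping.single (-1) 1)) m
         else m)"

definition twisted_chen_module :: "('v, 'e) pre_digraph \<Rightarrow> (nat \<Rightarrow> 'e) \<Rightarrow> 'e list \<Rightarrow>
    'k::field laurent \<Rightarrow> (('v, 'e, 'k) lpa_elem, (nat \<Rightarrow> 'e) \<Rightarrow> 'k laurent set) module" where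
  "twisted_chen_module G \<alpha> d f =
     lpa_module (laurent_quotient f) (\<lambda>k. laurent_class f (Poly_Mapping.single 0 k))
       (points (infinite_path_branching G \<alpha>)) (twisted_action G \<alpha> d f)"

definition finite_path_branching ::
  "('v, 'e) pre_digraph \<Rightarrow> 'v \<Rightarrow> ('v, 'e, ('v, 'e) path) branching" where
  "finite_path_branching G v =
     \<lparr>points = {(u, p). pre_digraph.awalk G u p v},
      vert_part = (\<lambda>w. {(u, p). pre_digraph.awalk G u p v \<and> u = w}),
      edge_part = (\<lambda>e. {(u, p). pre_digraph.awalk G u p v \<and> p \<noteq> [] \<and> hd p = e}),
      edge_map = (\<lambda>e (u, p). (tail G e, e # p))\<rparr>"

definition finite_path_module :: "'k::field itself \<Rightarrow> ('v, 'e) pre_digraph \<Rightarrow> 'v \<Rightarrow>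
    (('v, 'e, 'k) lpa_elem, ('v, 'e) path \<Rightarrow> 'k) module" where
  "finite_path_module K G v = branching_module K G (finite_path_branching G v)"

end

theory Submission
  imports Defs
begin

text \<open>
  A reduced word \<open>pq\<^sup>*\<close> is determined by its degree and by the infinite path that follows \<open>p\<close> and then
  runs around \<open>c\<close> forever. On a homogeneous element a long ghost path therefore separates basis
  elements, whence graded simplicity, while moving a word once around \<open>c\<close> is an automorphism \<open>\<tau>\<close>
  and the range of \<open>1 - \<tau>\<close> is a proper submodule. A change of the base vertex only shifts the degree.

  For the annihilator, every element is, modulo \<open>I(H, B\<^sub>H)\<close>, a combination of words \<open>pq\<^sup>*\<close> with range
  \<open>x \<in> R(c\<^sup>0)\<close> in which \<open>q\<close> either has a prescribed length or is shorter and \<open>x\<close> emits infinitely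
  many edges into \<open>R(c\<^sup>0)\<close>; distinct such words act linearly independently.

  A Chen module with the same annihilator would have support \<open>R(c\<^sup>0)\<close>. If it comes from a sink or an
  infinite emitter \<open>u\<close>, this puts \<open>u\<close> on \<open>c\<close>, and \<open>u - ee\<^sup>*\<close> for the edge \<open>e\<close> of \<open>c\<close> at \<open>u\<close> kills only
  one of the two modules. If it comes from an infinite path \<open>\<alpha>\<close>, this forces \<open>\<alpha>\<close> to end on \<open>c\<close>, and then
  \<open>f(c)\<close> (with \<open>f = 1 - x\<close> in the untwisted case) annihilates the Chen module but not \<open>\<^bold>N\<^sub>c\<close>.
\<close>

section \<open>Representatives in the free algebra\<close>

text \<open>Reduced words are awkward to multiply, because cancellation can reach arbitrarily far
  into a word. Infinite path and degree avoid this: an edge prepends itself to the path and raises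
  the degree by one, its ghost undoes this, and no reduction has to be tracked. Exclusivity makes
  these coordinates faithful, since a walk between vertices of \<open>c\<close> has no choice. All
  modules of the statement are handled as branching systems with weights: a word sends a basis
  vector to zero or to a scalar times a basis vector, and the scalars are trivial except for the
  twisted Chen modules. Elements of the algebra are cosets, so calculations use noncommutative
  polynomials without constant term. The vertices that do not annihilate a module form its support,
  which for \<open>N\<^sub>c\<close> is \<open>R\<close>. Comparing supports turns an isomorphism or
  an equality of annihilators into reachability between cycles and paths. Once the supports agree,
  degrees decide: a turn around \<open>c\<close> fixes the path that runs around \<open>c\<close>
  forever in a Chen module up to a scalar, but moves a point of \<open>N\<^sub>c\<close> to a new
  degree.\<close>

lemma ring_of_type_algebra_simps [simp]:
  "carrier (ring_of_type_algebra :: 'a::ring_1 ring) = UNIV"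
  "x \<oplus>\<^bsub>ring_of_type_algebra\<^esub> y = x + (y :: 'a)"
  "x \<otimes>\<^bsub>ring_of_type_algebra\<^esub> y = x * (y :: 'a)"
  "\<zero>\<^bsub>ring_of_type_algebra\<^esub> = (0 :: 'a)"
  "\<one>\<^bsub>ring_of_type_algebra\<^esub> = (1 :: 'a)"
  by (simp_all add: ring_of_type_algebra_def)

lemma finsum_ring_of_type_algebra [simp]:
  fixes f :: "'b \<Rightarrow> 'a::comm_ring_1"
  shows "finsum ring_of_type_algebra f A = sum f A"
proof -
  interpret cring "ring_of_type_algebra :: 'a ring" by (rule cring_from_type_algebra)
  show ?thesis by (induction A rule: infinite_finite_induct) auto
qed

lemma free_algebra_simps [simp]:
  "x \<oplus>\<^bsub>free_algebra K G\<^esub> y = x + y"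
  "x \<otimes>\<^bsub>free_algebra K G\<^esub> y = x * y"
  "\<zero>\<^bsub>free_algebra K G\<^esub> = 0"
  "\<one>\<^bsub>free_algebra K G\<^esub> = 1"
  by (simp_all add: free_algebra_def ring_of_type_algebra_def)

lemma carrier_free_algebra:
  "a \<in> carrier (free_algebra K G) \<longleftrightarrow> (\<forall>w\<in>Poly_Mapping.keys a. set (letters w) \<subseteq> gens G)"
  by (simp add: free_algebra_def)

lemma carrier_free_algebra_closed [intro, simp]:
  assumes "a \<in> carrier (free_algebra K G)" "b \<in> carrier (free_algebra K G)"
  shows "a + b \<in> carrier (free_algebra K G)" "a * b \<in> carrier (free_algebra K G)"
    "- a \<in> carrier (free_algebra K G)" "a - b \<in> carrier (free_algebra K G)"
proof -
  have add: "x + y \<in> carrier (free_algebra K G)"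
    if "x \<in> carrier (free_algebra K G)" "y \<in> carrier (free_algebra K G)" for x y
    using that Poly_Mapping.keys_add[of x y] unfolding carrier_free_algebra by blast
  have keys_uminus: "Poly_Mapping.keys (- x) = Poly_Mapping.keys x" for x :: "('a, 'b, 'c) free_elem"
    by (auto simp: in_keys_iff)
  show neg: "- a \<in> carrier (free_algebra K G)"
    using assms(1) unfolding carrier_free_algebra keys_uminus .
  show "a + b \<in> carrier (free_algebra K G)"
    using add assms by blast
  have "- b \<in> carrier (free_algebra K G)"
    using assms(2) unfolding carrier_free_algebra keys_uminus .
  from add[OF assms(1) this] show "a - b \<in> carrier (free_algebra K G)"
    by simp
  show "a * b \<in> carrier (free_algebra K G)"
    unfolding carrier_free_algebra
  proof
    fix w assume "w \<in> Poly_Mapping.keys (a * b)"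
    then obtain x y where "w = x + y" "x \<in> Poly_Mapping.keys a" "y \<in> Poly_Mapping.keys b"
      using keys_mult[of a b] by auto
    then show "set (letters w) \<subseteq> gens G"
      using assms by (auto simp: carrier_free_algebra plus_nc_word_def)
  qed
qed

lemma carrier_free_algebra_0_1 [intro, simp]:
  "0 \<in> carrier (free_algebra K G)" "1 \<in> carrier (free_algebra K G)"
  by (auto simp: carrier_free_algebra zero_nc_word_def)

lemma carrier_free_algebra_sum [intro]:
  "(\<And>i. i \<in> I \<Longrightarrow> f i \<in> carrier (free_algebra K G)) \<Longrightarrow> sum f I \<in> carrier (free_algebra K G)"
  by (induction I rule: infinite_finite_induct) auto

lemma carrier_free_algebra_single [intro]:
  "set (letters w) \<subseteq> gens G \<Longrightarrow> Poly_Mapping.single w k \<in> carrier (free_algebra K G)"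
  by (auto simp: carrier_free_algebra)

lemma carrier_free_algebra_gn [intro]: "g \<in> gens G \<Longrightarrow> gn g \<in> carrier (free_algebra K G)"
  unfolding gn_def by (rule carrier_free_algebra_single) auto

lemma ring_free_algebra: "ring (free_algebra K G)"
proof (rule ringI)
  show "abelian_group (free_algebra K G)"
  proof (rule abelian_groupI)
    fix x assume "x \<in> carrier (free_algebra K G)"
    then show "\<exists>y\<in>carrier (free_algebra K G). y \<oplus>\<^bsub>free_algebra K G\<^esub> x = \<zero>\<^bsub>free_algebra K G\<^esub>"
      by (intro bexI[of _ "- x"]) auto
  qed (auto simp: add_ac)
  show "Group.monoid (free_algebra K G)"
    by (rule monoidI) (auto simp: mult.assoc)
qed (auto simp: algebra_simps)

lemma free_algebra_a_inv [simp]: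
  assumes "a \<in> carrier (free_algebra K G)"
  shows "\<ominus>\<^bsub>free_algebra K G\<^esub> a = - a"
proof -
  interpret ring "free_algebra K G" by (rule ring_free_algebra)
  show ?thesis by (rule minus_equality) (use assms in auto)
qed

lemma gens_iff [simp]:
  "Vert v \<in> gens G \<longleftrightarrow> v \<in> verts G"
  "Edge e \<in> gens G \<longleftrightarrow> e \<in> arcs G"
  "Ghost e \<in> gens G \<longleftrightarrow> e \<in> arcs G"
  by (auto simp: gens_def)

section \<open>Classes modulo the relation ideal\<close>

context wf_digraph begin

lemma lpa_relations_subset: "lpa_relations K G \<subseteq> carrier (free_algebra K G)"
proof -
  have gn: "g \<in> gens G \<Longrightarrow> gn g \<in> carrier (free_algebra K G)" for g
    by blast
  show ?thesis
    unfolding lpa_relations_def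
    by (auto intro!: gn carrier_free_algebra_closed carrier_free_algebra_sum
        simp: regular_def split: if_splits)
qed

lemma ideal_lpa_relation_ideal: "ideal (lpa_relation_ideal K G) (free_algebra K G)"
proof -
  interpret ring "free_algebra K G" by (rule ring_free_algebra)
  show ?thesis
    unfolding lpa_relation_ideal_def by (rule genideal_ideal[OF lpa_relations_subset])
qed

lemma lpa_relation_ideal_minimal:
  assumes "ideal Z (free_algebra K G)" "lpa_relations K G \<subseteq> Z"
  shows "lpa_relation_ideal K G \<subseteq> Z"
proof -
  interpret ring "free_algebra K G" by (rule ring_free_algebra)
  show ?thesis
    unfolding lpa_relation_ideal_def by (rule genideal_minimal[OF assms])
qed

lemma lpa_relations_in_ideal: "r \<in> lpa_relations K G \<Longrightarrow> r \<in> lpa_relation_ideal K G"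
proof -
  interpret ring "free_algebra K G" by (rule ring_free_algebra)
  show "r \<in> lpa_relations K G \<Longrightarrow> r \<in> lpa_relation_ideal K G"
    unfolding lpa_relation_ideal_def using genideal_self[OF lpa_relations_subset] by blast
qed

lemma lpa_relation_ideal_closed:
  assumes "a \<in> lpa_relation_ideal K G"
  shows "b \<in> lpa_relation_ideal K G \<Longrightarrow> a + b \<in> lpa_relation_ideal K G"
    "- a \<in> lpa_relation_ideal K G"
    "b \<in> lpa_relation_ideal K G \<Longrightarrow> a - b \<in> lpa_relation_ideal K G"
    "a \<in> carrier (free_algebra K G)"
    "r \<in> carrier (free_algebra K G) \<Longrightarrow> r * a \<in> lpa_relation_ideal K G"
    "r \<in> carrier (free_algebra K G) \<Longrightarrow> a * r \<in> lpa_relation_ideal K G"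
proof -
  interpret ideal "lpa_relation_ideal K G" "free_algebra K G" by (rule ideal_lpa_relation_ideal)
  show carr: "a \<in> carrier (free_algebra K G)" using a_Hcarr[OF assms] .
  show "b \<in> lpa_relation_ideal K G \<Longrightarrow> a + b \<in> lpa_relation_ideal K G"
    using additive_subgroup.a_closed[OF is_additive_subgroup assms] by simp
  have neg: "- x \<in> lpa_relation_ideal K G" if "x \<in> lpa_relation_ideal K G" for x
    using additive_subgroup.a_inv_closed[OF is_additive_subgroup that] that a_Hcarr[OF that] by simp
  show "- a \<in> lpa_relation_ideal K G" using neg[OF assms] .
  show "a - b \<in> lpa_relation_ideal K G" if "b \<in> lpa_relation_ideal K G"
    using additive_subgroup.a_closed[OF is_additive_subgroup assms neg[OF that]] by simp
  show "r \<in> carrier (free_algebra K G) \<Longrightarrow> r * a \<in> lpa_relation_ideal K G"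
    using I_l_closed[OF assms] by simp
  show "r \<in> carrier (free_algebra K G) \<Longrightarrow> a * r \<in> lpa_relation_ideal K G"
    using I_r_closed[OF assms] by simp
qed

lemma lpa_relation_ideal_0 [simp]: "0 \<in> lpa_relation_ideal K G"
proof -
  interpret ideal "lpa_relation_ideal K G" "free_algebra K G" by (rule ideal_lpa_relation_ideal)
  show ?thesis using additive_subgroup.zero_closed[OF is_additive_subgroup] unfolding free_algebra_simps .
qed

lemma lpa_class_conv: "lpa_class K G a = {h + a |h. h \<in> lpa_relation_ideal K G}"
  by (auto simp: lpa_class_def a_r_coset_def r_coset_def)

lemma lpa_class_eq_iff:
  assumes "a \<in> carrier (free_algebra K G)" "b \<in> carrier (free_algebra K G)"
  shows "lpa_class K G a = lpa_class K G b \<longleftrightarrow> a - b \<in> lpa_relation_ideal K G"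
proof
  assume "lpa_class K G a = lpa_class K G b"
  moreover have "a \<in> lpa_class K G a"
    unfolding lpa_class_conv by force
  ultimately obtain h where "h \<in> lpa_relation_ideal K G" "a = h + b"
    unfolding lpa_class_conv by blast
  then show "a - b \<in> lpa_relation_ideal K G" by simp
next
  assume ab: "a - b \<in> lpa_relation_ideal K G"
  have "\<exists>h'. h + a = h' + b \<and> h' \<in> lpa_relation_ideal K G" if "h \<in> lpa_relation_ideal K G" for h
    using lpa_relation_ideal_closed(1)[OF that ab] by (intro exI[of _ "h + (a - b)"]) auto
  moreover have "\<exists>h'. h + b = h' + a \<and> h' \<in> lpa_relation_ideal K G"
    if "h \<in> lpa_relation_ideal K G" for h
    using lpa_relation_ideal_closed(3)[OF that ab] by (intro exI[of _ "h - (a - b)"]) auto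
  ultimately show "lpa_class K G a = lpa_class K G b"
    unfolding lpa_class_conv by blast
qed

lemma leavitt_ops:
  assumes "a \<in> carrier (free_algebra K G)" "b \<in> carrier (free_algebra K G)"
  shows "lpa_class K G a \<oplus>\<^bsub>leavitt K G\<^esub> lpa_class K G b = lpa_class K G (a + b)"
    "lpa_class K G a \<otimes>\<^bsub>leavitt K G\<^esub> lpa_class K G b = lpa_class K G (a * b)"
proof -
  interpret ideal "lpa_relation_ideal K G" "free_algebra K G" by (rule ideal_lpa_relation_ideal)
  show "lpa_class K G a \<oplus>\<^bsub>leavitt K G\<^esub> lpa_class K G b = lpa_class K G (a + b)"
    using a_rcos_sum[OF assms] by (simp add: leavitt_def lpa_class_def FactRing_def)
  show "lpa_class K G a \<otimes>\<^bsub>leavitt K G\<^esub> lpa_class K G b = lpa_class K G (a * b)"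
    using rcoset_mult_add[OF assms] by (simp add: leavitt_def lpa_class_def FactRing_def)
qed

lemma leavitt_zero: "\<zero>\<^bsub>leavitt K G\<^esub> = lpa_class K G 0"
  by (simp add: leavitt_def FactRing_def lpa_class_conv)

end

text \<open>The zero constant term is what makes the algebra nonunital. These polynomials form a
  two-sided ideal of the free unital algebra, so multiplication by scalars, that is by multiples of
  the empty word, stays within them.\<close>

definition lpa_reps :: "'k::field itself \<Rightarrow> ('v, 'e) pre_digraph \<Rightarrow> ('v, 'e, 'k) free_elem set" where
  "lpa_reps K G = {a \<in> carrier (free_algebra K G). Poly_Mapping.lookup a 0 = 0}"

lemma carrier_leavitt: "carrier (leavitt K G) = lpa_class K G ` lpa_reps K G"
  by (simp add: leavitt_def lpa_reps_def)

lemma nc_word_add_eq_0_iff [simp]: "x + y = (0::'g nc_word) \<longleftrightarrow> x = 0 \<and> y = 0"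
  by (cases x; cases y) (auto simp: plus_nc_word_def zero_nc_word_def)

text \<open>The empty word is a concatenation of two words only if both are empty.\<close>

lemma lookup_mult_0:
  fixes a b :: "'g nc_word \<Rightarrow>\<^sub>0 'k::comm_ring_1"
  assumes "Poly_Mapping.lookup a 0 = 0 \<or> Poly_Mapping.lookup b 0 = 0"
  shows "Poly_Mapping.lookup (a * b) 0 = 0"
proof (rule ccontr)
  assume "Poly_Mapping.lookup (a * b) 0 \<noteq> 0"
  then have "0 \<in> Poly_Mapping.keys (a * b)" by (simp add: in_keys_iff)
  then obtain x y where "0 = x + y" "x \<in> Poly_Mapping.keys a" "y \<in> Poly_Mapping.keys b"
    using keys_mult[of a b] by auto
  then show False using assms by (metis in_keys_iff nc_word_add_eq_0_iff)
qed

lemma lpa_reps_closed [intro]: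
  assumes "a \<in> lpa_reps K G"
  shows "b \<in> lpa_reps K G \<Longrightarrow> a + b \<in> lpa_reps K G" "- a \<in> lpa_reps K G"
    "b \<in> lpa_reps K G \<Longrightarrow> a - b \<in> lpa_reps K G"
    "r \<in> carrier (free_algebra K G) \<Longrightarrow> r * a \<in> lpa_reps K G"
    "r \<in> carrier (free_algebra K G) \<Longrightarrow> a * r \<in> lpa_reps K G"
  using assms by (auto simp: lpa_reps_def lookup_add lookup_minus lookup_mult_0)

lemma lpa_reps_carrier: "a \<in> lpa_reps K G \<Longrightarrow> a \<in> carrier (free_algebra K G)"
  by (simp add: lpa_reps_def)

lemma lpa_reps_0 [simp, intro]: "0 \<in> lpa_reps K G"
  by (simp add: lpa_reps_def)

lemma lpa_reps_sum [intro]: "(\<And>i. i \<in> I \<Longrightarrow> f i \<in> lpa_reps K G) \<Longrightarrow> sum f I \<in> lpa_reps K G"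
  by (induction I rule: infinite_finite_induct) auto

lemma lpa_reps_single [intro]:
  "set (letters w) \<subseteq> gens G \<Longrightarrow> letters w \<noteq> [] \<Longrightarrow> Poly_Mapping.single w k \<in> lpa_reps K G"
  by (auto simp: lpa_reps_def lookup_single when_def zero_nc_word_def)

lemma lpa_reps_gn [intro]: "g \<in> gens G \<Longrightarrow> gn g \<in> lpa_reps K G"
  unfolding gn_def by (rule lpa_reps_single) auto

lemma (in wf_digraph) abelian_group_leavitt: "abelian_group (leavitt K G)"
proof (rule abelian_groupI)
  fix x assume "x \<in> carrier (leavitt K G)"
  then obtain a where a: "a \<in> lpa_reps K G" "x = lpa_class K G a"
    by (auto simp: carrier_leavitt)
  then show "\<exists>y\<in>carrier (leavitt K G). y \<oplus>\<^bsub>leavitt K G\<^esub> x = \<zero>\<^bsub>leavitt K G\<^esub>"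
    by (intro bexI[of _ "lpa_class K G (- a)"])
       (auto simp: carrier_leavitt leavitt_zero leavitt_ops lpa_reps_carrier lpa_reps_closed)
qed (auto simp: carrier_leavitt leavitt_zero leavitt_ops lpa_reps_carrier add_ac)

lemma (in wf_digraph) leavitt_a_inv:
  assumes "a \<in> lpa_reps K G"
  shows "\<ominus>\<^bsub>leavitt K G\<^esub> lpa_class K G a = lpa_class K G (- a)"
proof -
  interpret L: abelian_group "leavitt K G" by (rule abelian_group_leavitt)
  show ?thesis
    using assms by (intro L.minus_equality)
      (auto simp: carrier_leavitt leavitt_zero leavitt_ops lpa_reps_carrier lpa_reps_closed)
qed

section \<open>Free modules and words acting on them\<close>

text \<open>\<open>C\<close> is a commutative \<open>K\<close>-algebra with structure map
  \<open>\<iota>\<close> and not just the field, because the twisted Chen modules are free over a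
  quotient of the Laurent polynomials.\<close>

locale coefficient_ring = cring C for C (structure) +
  fixes \<iota> :: "'k::field \<Rightarrow> 'c"
  constrains C :: "'c ring"
  assumes \<iota>_closed [intro, simp]: "\<iota> a \<in> carrier C"
    and \<iota>_0: "\<iota> 0 = \<zero>"
    and \<iota>_1: "\<iota> 1 = \<one>"
    and \<iota>_add: "\<iota> (a + b) = \<iota> a \<oplus> \<iota> b"
    and \<iota>_mult: "\<iota> (a * b) = \<iota> a \<otimes> \<iota> b"
begin

definition add_vec :: "('x \<Rightarrow> 'c) \<Rightarrow> ('x \<Rightarrow> 'c) \<Rightarrow> 'x \<Rightarrow> 'c" where
  "add_vec m n = (\<lambda>x. m x \<oplus> n x)"

lemma free_carrierD:
  assumes "m \<in> free_carrier C B"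
  shows "m x \<in> carrier C" "finite {x. m x \<noteq> \<zero>}" "{x. m x \<noteq> \<zero>} \<subseteq> B"
  using assms by (auto simp: free_carrier_def)

lemma zero_vec_closed [intro, simp]: "zero_vec C \<in> free_carrier C B"
  by (auto simp: free_carrier_def zero_vec_def)

lemma basis_vec_closed [intro, simp]: "x \<in> B \<Longrightarrow> basis_vec C x \<in> free_carrier C B"
  by (auto simp: free_carrier_def basis_vec_def intro: rev_finite_subset[of "{x}"])

lemma add_vec_closed [intro, simp]:
  assumes "m \<in> free_carrier C B" "n \<in> free_carrier C B"
  shows "add_vec m n \<in> free_carrier C B"
proof -
  have sub: "{x. m x \<oplus> n x \<noteq> \<zero>} \<subseteq> {x. m x \<noteq> \<zero>} \<union> {x. n x \<noteq> \<zero>}"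
    by auto
  then have "finite {x. m x \<oplus> n x \<noteq> \<zero>}"
    by (rule finite_subset) (simp add: free_carrierD[OF assms(1)] free_carrierD[OF assms(2)])
  with sub show ?thesis
    using assms by (auto simp: free_carrier_def add_vec_def)
qed

lemma scale_vec_closed [intro, simp]:
  assumes "m \<in> free_carrier C B" "a \<in> carrier C"
  shows "scale_vec C a m \<in> free_carrier C B"
proof -
  have sub: "{x. a \<otimes> m x \<noteq> \<zero>} \<subseteq> {x. m x \<noteq> \<zero>}"
    using assms(2) by auto
  then have "finite {x. a \<otimes> m x \<noteq> \<zero>}"
    by (rule finite_subset) (simp add: free_carrierD[OF assms(1)])
  with sub show ?thesis
    using assms by (auto simp: free_carrier_def scale_vec_def)
qed

lemma scale_vec_simps [simp]:
  assumes "m \<in> free_carrier C B"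
  shows "scale_vec C \<one> m = m" "scale_vec C \<zero> m = zero_vec C"
    "\<lbrakk>a \<in> carrier C; b \<in> carrier C\<rbrakk> \<Longrightarrow> scale_vec C a (scale_vec C b m) = scale_vec C (a \<otimes> b) m"
  using free_carrierD(1)[OF assms] by (auto simp: scale_vec_def zero_vec_def m_assoc)

lemma scale_zero_vec [simp]: "a \<in> carrier C \<Longrightarrow> scale_vec C a (zero_vec C) = zero_vec C"
  by (auto simp: scale_vec_def zero_vec_def)

lemma add_vec_zero [simp]:
  assumes "m \<in> free_carrier C B"
  shows "add_vec m (zero_vec C) = m" "add_vec (zero_vec C) m = m"
  using free_carrierD(1)[OF assms] by (auto simp: add_vec_def zero_vec_def)

text \<open>The conditions speak only of finitely supported vectors over the two bases; the values
  of maps such as \<open>free_action\<close> elsewhere are not controlled.\<close>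

definition lin_map :: "'x set \<Rightarrow> (('x \<Rightarrow> 'c) \<Rightarrow> ('y \<Rightarrow> 'c)) \<Rightarrow> 'y set \<Rightarrow> bool" where
  "lin_map B T B' \<longleftrightarrow> (\<forall>m\<in>free_carrier C B. T m \<in> free_carrier C B') \<and>
     (\<forall>m\<in>free_carrier C B. \<forall>n\<in>free_carrier C B. T (add_vec m n) = add_vec (T m) (T n)) \<and>
     (\<forall>a\<in>carrier C. \<forall>m\<in>free_carrier C B. T (scale_vec C a m) = scale_vec C a (T m))"

lemma lin_mapD:
  assumes "lin_map B T B'" "m \<in> free_carrier C B"
  shows "T m \<in> free_carrier C B'"
    "n \<in> free_carrier C B \<Longrightarrow> T (add_vec m n) = add_vec (T m) (T n)"
    "a \<in> carrier C \<Longrightarrow> T (scale_vec C a m) = scale_vec C a (T m)"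
  using assms by (auto simp: lin_map_def)

lemma lin_map_zero:
  assumes "lin_map B T B'"
  shows "T (zero_vec C) = zero_vec C"
proof -
  have "T (zero_vec C) = T (scale_vec C \<zero> (zero_vec C))"
    by simp
  also have "\<dots> = scale_vec C \<zero> (T (zero_vec C))"
    by (rule lin_mapD(3)[OF assms]) auto
  also have "\<dots> = zero_vec C"
    using lin_mapD(1)[OF assms zero_vec_closed] by simp
  finally show ?thesis .
qed

lemma free_carrier_induct [consumes 1, case_names zero add]:
  assumes "m \<in> free_carrier C B"
    and zero: "P (zero_vec C)"
    and add: "\<And>x a m. \<lbrakk>x \<in> B; a \<in> carrier C; m \<in> free_carrier C B; P m\<rbrakk>
      \<Longrightarrow> P (add_vec (scale_vec C a (basis_vec C x)) m)"
  shows "P m"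
proof -
  have "finite {x. m x \<noteq> \<zero>}" using assms(1) by (rule free_carrierD)
  then show ?thesis using assms(1)
  proof (induction "{x. m x \<noteq> \<zero>}" arbitrary: m rule: finite_induct)
    case empty
    then have "m = zero_vec C" by (auto simp: zero_vec_def)
    then show ?case using zero by simp
  next
    case (insert x F)
    define n where "n = m(x := \<zero>)"
    have F: "{y. n y \<noteq> \<zero>} = F"
      using insert by (auto simp: n_def)
    have n: "n \<in> free_carrier C B"
      using insert.prems insert.hyps F by (auto simp: free_carrier_def n_def)
    have "x \<in> B" using insert.hyps(4) free_carrierD(3)[OF insert.prems] by blast
    have "m = add_vec (scale_vec C (m x) (basis_vec C x)) n"
      using free_carrierD(1)[OF insert.prems]
      by (auto simp: add_vec_def scale_vec_def basis_vec_def n_def)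
    moreover have "P (add_vec (scale_vec C (m x) (basis_vec C x)) n)"
      by (rule add[OF \<open>x \<in> B\<close> _ n insert.hyps(3)[OF F[symmetric] n]])
        (rule free_carrierD(1)[OF insert.prems])
    ultimately show ?case by simp
  qed
qed

lemma lin_map_eqI:
  assumes "lin_map B T B'" "lin_map B S B'" "m \<in> free_carrier C B"
    and "\<And>x. x \<in> B \<Longrightarrow> T (basis_vec C x) = S (basis_vec C x)"
  shows "T m = S m"
  using assms(3)
proof (induction rule: free_carrier_induct)
  case zero
  then show ?case using assms(1,2) by (simp add: lin_map_zero)
next
  case (add x a m)
  then show ?case using assms(1,2,4) by (simp add: lin_mapD)
qed

lemma lin_map_cong:
  assumes "lin_map B T B'" "\<And>m. m \<in> free_carrier C B \<Longrightarrow> S m = T m"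
  shows "lin_map B S B'"
  unfolding lin_map_def
  by (simp add: assms(2) lin_mapD[OF assms(1)])

lemma lin_map_comp: "lin_map B T B' \<Longrightarrow> lin_map B' S B'' \<Longrightarrow> lin_map B (\<lambda>m. S (T m)) B''"
  by (auto simp: lin_map_def)

lemma lin_map_id: "lin_map B (\<lambda>m. m) B"
  by (auto simp: lin_map_def)

lemma lin_map_zero_map: "lin_map B (\<lambda>m. zero_vec C) B'"
  by (auto simp: lin_map_def)

lemma lin_map_scale:
  assumes "lin_map B T B'" "a \<in> carrier C"
  shows "lin_map B (\<lambda>m. scale_vec C a (T m)) B'"
proof -
  have "scale_vec C a (add_vec m n) = add_vec (scale_vec C a m) (scale_vec C a n)"
    if "m \<in> free_carrier C B'" "n \<in> free_carrier C B'" for m n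
    using that[THEN free_carrierD(1)] assms(2) by (auto simp: scale_vec_def add_vec_def r_distr)
  moreover have "scale_vec C a (scale_vec C b m) = scale_vec C b (scale_vec C a m)"
    if "m \<in> free_carrier C B'" "b \<in> carrier C" for m b
    using that assms(2) by (simp add: m_comm)
  ultimately show ?thesis
    using assms by (auto simp: lin_map_def)
qed

lemma lin_map_add:
  assumes "lin_map B T B'" "lin_map B S B'"
  shows "lin_map B (\<lambda>m. add_vec (T m) (S m)) B'"
proof -
  have "add_vec (add_vec p q) (add_vec r s) = add_vec (add_vec p r) (add_vec q s)"
    if "p \<in> free_carrier C B'" "q \<in> free_carrier C B'" "r \<in> free_carrier C B'" "s \<in> free_carrier C B'"
    for p q r s
    using that[THEN free_carrierD(1)] by (auto simp: add_vec_def a_ac)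
  moreover have "scale_vec C a (add_vec m n) = add_vec (scale_vec C a m) (scale_vec C a n)"
    if "m \<in> free_carrier C B'" "n \<in> free_carrier C B'" "a \<in> carrier C" for a m n
    using that(1,2)[THEN free_carrierD(1)] that(3) by (auto simp: scale_vec_def add_vec_def r_distr)
  ultimately show ?thesis
    using assms by (auto simp: lin_map_def)
qed

text \<open>The definition sums over the support of \<open>m\<close>, which changes under addition.
  Passing to a finite superset gives sums a common index set, as the additivity proof
  requires.\<close>

lemma linear_extension_superset:
  assumes "\<And>x. x \<in> B \<Longrightarrow> \<phi> x \<in> free_carrier C B'" "m \<in> free_carrier C B"
    and "finite A" "{x. m x \<noteq> \<zero>} \<subseteq> A" "A \<subseteq> B"
  shows "linear_extension C \<phi> m y = (\<Oplus>x\<in>A. m x \<otimes> \<phi> x y)"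
  unfolding linear_extension_def
proof (rule add.finprod_mono_neutral_cong_left)
  show "m i \<otimes> \<phi> i y = \<zero>" if i: "i \<in> A - {x. m x \<noteq> \<zero>}" for i
  proof -
    have "\<phi> i y \<in> carrier C" using i assms(1,5) by (intro free_carrierD(1)) auto
    with i show ?thesis by simp
  qed
  show "(\<lambda>x. m x \<otimes> \<phi> x y) \<in> A \<rightarrow> carrier C"
  proof
    fix i assume "i \<in> A"
    then have "\<phi> i y \<in> carrier C" using assms(1,5) by (intro free_carrierD(1)) auto
    then show "m i \<otimes> \<phi> i y \<in> carrier C" using free_carrierD(1)[OF assms(2)] by simp
  qed
qed (use assms in auto)

lemma lin_map_linear_extension:
  assumes \<phi>: "\<And>x. x \<in> B \<Longrightarrow> \<phi> x \<in> free_carrier C B'"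
  shows "lin_map B (linear_extension C \<phi>) B'"
proof -
  have \<phi>_carr: "\<phi> x y \<in> carrier C" if "x \<in> B" for x y
    using \<phi>[OF that] by (rule free_carrierD)
  have closed: "linear_extension C \<phi> m \<in> free_carrier C B'" if m: "m \<in> free_carrier C B" for m
  proof -
    have supp: "{x. m x \<noteq> \<zero>} \<subseteq> B" by (rule free_carrierD[OF m])
    have "linear_extension C \<phi> m y \<in> carrier C" for y
      unfolding linear_extension_def using supp \<phi>_carr free_carrierD(1)[OF m]
      by (intro finsum_closed) auto
    moreover have sub: "{y. linear_extension C \<phi> m y \<noteq> \<zero>} \<subseteq> (\<Union>x\<in>{x. m x \<noteq> \<zero>}. {y. \<phi> x y \<noteq> \<zero>})"
    proof (rule subsetI, rule ccontr)
      fix y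
      assume y: "y \<in> {y. linear_extension C \<phi> m y \<noteq> \<zero>}"
        "y \<notin> (\<Union>x\<in>{x. m x \<noteq> \<zero>}. {y. \<phi> x y \<noteq> \<zero>})"
      have "linear_extension C \<phi> m y = (\<Oplus>x\<in>{x. m x \<noteq> \<zero>}. \<zero>)"
        unfolding linear_extension_def using y(2) free_carrierD(1)[OF m]
        by (intro finsum_cong') auto
      with y(1) show False by simp
    qed
    moreover have "finite {y. linear_extension C \<phi> m y \<noteq> \<zero>}"
    proof (rule finite_subset[OF sub], rule finite_UN_I[OF free_carrierD(2)[OF m]])
      fix x assume "x \<in> {x. m x \<noteq> \<zero>}"
      then have "x \<in> B" using supp by blast
      then show "finite {y. \<phi> x y \<noteq> \<zero>}" by (rule free_carrierD(2)[OF \<phi>])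
    qed
    moreover have "(\<Union>x\<in>{x. m x \<noteq> \<zero>}. {y. \<phi> x y \<noteq> \<zero>}) \<subseteq> B'"
      using supp free_carrierD(3)[OF \<phi>] by blast
    ultimately show ?thesis
      unfolding free_carrier_def by blast
  qed
  moreover have "linear_extension C \<phi> (add_vec m n) =
      add_vec (linear_extension C \<phi> m) (linear_extension C \<phi> n)"
    if m: "m \<in> free_carrier C B" and n: "n \<in> free_carrier C B" for m n
  proof
    fix y
    let ?A = "{x. m x \<noteq> \<zero>} \<union> {x. n x \<noteq> \<zero>}"
    have A: "finite ?A" "?A \<subseteq> B"
      using free_carrierD(2,3)[OF m] free_carrierD(2,3)[OF n] by auto
    have "linear_extension C \<phi> (add_vec m n) y = (\<Oplus>x\<in>?A. add_vec m n x \<otimes> \<phi> x y)"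
    proof (rule linear_extension_superset[OF \<phi> add_vec_closed[OF m n] A(1) _ A(2)])
      show "{x. add_vec m n x \<noteq> \<zero>} \<subseteq> ?A" by (auto simp: add_vec_def)
    qed
    also have "\<dots> = (\<Oplus>x\<in>?A. m x \<otimes> \<phi> x y \<oplus> n x \<otimes> \<phi> x y)"
      using A(2) \<phi>_carr free_carrierD(1)[OF m] free_carrierD(1)[OF n]
      by (intro finsum_cong') (auto simp: add_vec_def l_distr)
    also have "\<dots> = (\<Oplus>x\<in>?A. m x \<otimes> \<phi> x y) \<oplus> (\<Oplus>x\<in>?A. n x \<otimes> \<phi> x y)"
      using A(2) \<phi>_carr free_carrierD(1)[OF m] free_carrierD(1)[OF n]
      by (intro finsum_addf) auto
    also have "(\<Oplus>x\<in>?A. m x \<otimes> \<phi> x y) = linear_extension C \<phi> m y"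
      by (rule linear_extension_superset[OF \<phi> m A(1) _ A(2), symmetric]) auto
    also have "(\<Oplus>x\<in>?A. n x \<otimes> \<phi> x y) = linear_extension C \<phi> n y"
      by (rule linear_extension_superset[OF \<phi> n A(1) _ A(2), symmetric]) auto
    finally show "linear_extension C \<phi> (add_vec m n) y =
        add_vec (linear_extension C \<phi> m) (linear_extension C \<phi> n) y"
      by (simp add: add_vec_def)
  qed
  moreover have "linear_extension C \<phi> (scale_vec C a m) = scale_vec C a (linear_extension C \<phi> m)"
    if a: "a \<in> carrier C" and m: "m \<in> free_carrier C B" for a m
  proof
    fix y
    let ?A = "{x. m x \<noteq> \<zero>}"
    have A: "finite ?A" "?A \<subseteq> B"
      using free_carrierD(2,3)[OF m] by auto
    have "linear_extension C \<phi> (scale_vec C a m) y = (\<Oplus>x\<in>?A. scale_vec C a m x \<otimes> \<phi> x y)"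
    proof (rule linear_extension_superset[OF \<phi> scale_vec_closed[OF m a] A(1) _ A(2)])
      show "{x. scale_vec C a m x \<noteq> \<zero>} \<subseteq> ?A" using a by (auto simp: scale_vec_def)
    qed
    also have "\<dots> = (\<Oplus>x\<in>?A. a \<otimes> (m x \<otimes> \<phi> x y))"
      using A(2) \<phi>_carr free_carrierD(1)[OF m] a
      by (intro finsum_cong') (auto simp: scale_vec_def m_assoc)
    also have "\<dots> = a \<otimes> (\<Oplus>x\<in>?A. m x \<otimes> \<phi> x y)"
      using A \<phi>_carr free_carrierD(1)[OF m] a
      by (intro finsum_rdistr[symmetric]) auto
    finally show "linear_extension C \<phi> (scale_vec C a m) y = scale_vec C a (linear_extension C \<phi> m) y"
      by (simp add: linear_extension_def scale_vec_def)
  qed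
  ultimately show ?thesis
    unfolding lin_map_def by blast
qed

lemma linear_extension_basis:
  assumes "\<And>x. x \<in> B \<Longrightarrow> \<phi> x \<in> free_carrier C B'" "x \<in> B"
  shows "linear_extension C \<phi> (basis_vec C x) = \<phi> x"
proof
  fix y
  have "\<phi> x y \<in> carrier C" using assms by (blast intro: free_carrierD)
  moreover have "linear_extension C \<phi> (basis_vec C x) y = (\<Oplus>z\<in>{x}. basis_vec C x z \<otimes> \<phi> z y)"
    by (rule linear_extension_superset[OF assms(1) basis_vec_closed[OF assms(2)]])
      (use assms(2) in \<open>auto simp: basis_vec_def\<close>)
  ultimately show "linear_extension C \<phi> (basis_vec C x) y = \<phi> x y"
    by (simp add: basis_vec_def)
qed

end

section \<open>Noncommutative polynomials acting on a free module\<close>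

lemma poly_mapping_single_induct [case_names single add]:
  fixes a :: "'w \<Rightarrow>\<^sub>0 'k::comm_monoid_add"
  assumes single: "\<And>w k. P (Poly_Mapping.single w k)"
    and add: "\<And>a b. P a \<Longrightarrow> P b \<Longrightarrow> P (a + b)"
  shows "P a"
proof -
  have "P (\<Sum>w\<in>A. Poly_Mapping.single w (Poly_Mapping.lookup a w))" if "finite A" for A
    \<comment> \<open>The empty sum is the monomial with coefficient 0 at an arbitrary word, so no
      separate case for zero is required.\<close>
    using that by induction (use single[of undefined 0] single add in auto)
  from this[OF finite_keys[of a]] have "P (\<Sum>w\<in>Poly_Mapping.keys a. Poly_Mapping.single w (Poly_Mapping.lookup a w))" .
  moreover have "(\<Sum>w\<in>Poly_Mapping.keys a. Poly_Mapping.single w (Poly_Mapping.lookup a w)) = a"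
    by (rule poly_mapping_eqI) (simp add: lookup_sum lookup_single when_def in_keys_iff)
  ultimately show ?thesis by simp
qed

locale generator_action = coefficient_ring C \<iota> for C :: "'c ring" (structure) and \<iota> :: "'k::field \<Rightarrow> 'c" +
  fixes B :: "'x set" and \<phi> :: "'g \<Rightarrow> 'x \<Rightarrow> 'x \<Rightarrow> 'c"
  assumes \<phi>_closed: "x \<in> B \<Longrightarrow> \<phi> g x \<in> free_carrier C B"
begin

lemma lin_map_word_action: "lin_map B (word_action C \<phi> w) B"
proof -
  have "lin_map B (foldr (\<lambda>g. linear_extension C (\<phi> g)) gs) B" for gs
  proof (induction gs)
    case Nil
    then show ?case by (simp add: lin_map_id id_def)
  next
    case (Cons g gs)
    then show ?case
      using lin_map_comp[OF Cons lin_map_linear_extension[of B "\<phi> g" B]] \<phi>_closed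
      by (simp add: comp_def)
  qed
  then show ?thesis by (simp add: word_action_def)
qed

lemma word_action_carrier: "m \<in> free_carrier C B \<Longrightarrow> word_action C \<phi> w m y \<in> carrier C"
  using lin_mapD(1)[OF lin_map_word_action] by (blast intro: free_carrierD)

lemma word_action_add: "word_action C \<phi> (w + w') m = word_action C \<phi> w (word_action C \<phi> w' m)"
  by (simp add: word_action_def plus_nc_word_def)

lemma free_action_superset:
  assumes "m \<in> free_carrier C B" "finite A" "Poly_Mapping.keys a \<subseteq> A"
  shows "free_action C \<iota> \<phi> a m y = (\<Oplus>w\<in>A. \<iota> (Poly_Mapping.lookup a w) \<otimes> word_action C \<phi> w m y)"
  unfolding free_action_def
  using assms word_action_carrier[OF assms(1)]
  by (intro add.finprod_mono_neutral_cong_left) (auto simp: in_keys_iff \<iota>_0)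

lemma free_action_single:
  assumes "m \<in> free_carrier C B"
  shows "free_action C \<iota> \<phi> (Poly_Mapping.single w k) m = scale_vec C (\<iota> k) (word_action C \<phi> w m)"
proof
  fix y
  have "free_action C \<iota> \<phi> (Poly_Mapping.single w k) m y =
      (\<Oplus>v\<in>{w}. \<iota> (Poly_Mapping.lookup (Poly_Mapping.single w k) v) \<otimes> word_action C \<phi> v m y)"
    using assms by (intro free_action_superset) auto
  then show "free_action C \<iota> \<phi> (Poly_Mapping.single w k) m y = scale_vec C (\<iota> k) (word_action C \<phi> w m) y"
    using word_action_carrier[OF assms] by (simp add: scale_vec_def)
qed

lemma free_action_add:
  assumes "m \<in> free_carrier C B"
  shows "free_action C \<iota> \<phi> (a + b) m = add_vec (free_action C \<iota> \<phi> a m) (free_action C \<iota> \<phi> b m)"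
proof
  fix y
  let ?A = "Poly_Mapping.keys a \<union> Poly_Mapping.keys b"
  note carr = word_action_carrier[OF assms]
  have "free_action C \<iota> \<phi> (a + b) m y =
      (\<Oplus>w\<in>?A. \<iota> (Poly_Mapping.lookup (a + b) w) \<otimes> word_action C \<phi> w m y)"
    using keys_add[of a b] by (intro free_action_superset[OF assms]) auto
  also have "\<dots> = (\<Oplus>w\<in>?A. \<iota> (Poly_Mapping.lookup a w) \<otimes> word_action C \<phi> w m y \<oplus>
      \<iota> (Poly_Mapping.lookup b w) \<otimes> word_action C \<phi> w m y)"
    using carr by (intro finsum_cong') (auto simp: lookup_add \<iota>_add l_distr)
  also have "\<dots> = (\<Oplus>w\<in>?A. \<iota> (Poly_Mapping.lookup a w) \<otimes> word_action C \<phi> w m y) \<oplus>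
      (\<Oplus>w\<in>?A. \<iota> (Poly_Mapping.lookup b w) \<otimes> word_action C \<phi> w m y)"
    using carr by (intro finsum_addf) auto
  also have "(\<Oplus>w\<in>?A. \<iota> (Poly_Mapping.lookup a w) \<otimes> word_action C \<phi> w m y) = free_action C \<iota> \<phi> a m y"
    by (rule free_action_superset[OF assms, symmetric]) auto
  also have "(\<Oplus>w\<in>?A. \<iota> (Poly_Mapping.lookup b w) \<otimes> word_action C \<phi> w m y) = free_action C \<iota> \<phi> b m y"
    by (rule free_action_superset[OF assms, symmetric]) auto
  finally show "free_action C \<iota> \<phi> (a + b) m y =
      add_vec (free_action C \<iota> \<phi> a m) (free_action C \<iota> \<phi> b m) y"
    by (simp add: add_vec_def)
qed

lemma lin_map_free_action: "lin_map B (free_action C \<iota> \<phi> a) B"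
proof (induction a rule: poly_mapping_single_induct)
  case (single w k)
  have "lin_map B (\<lambda>m. scale_vec C (\<iota> k) (word_action C \<phi> w m)) B"
    by (rule lin_map_scale[OF lin_map_word_action \<iota>_closed])
  then show ?case
    by (rule lin_map_cong) (rule free_action_single)
next
  case (add a b)
  have "lin_map B (\<lambda>m. add_vec (free_action C \<iota> \<phi> a m) (free_action C \<iota> \<phi> b m)) B"
    by (rule lin_map_add[OF add])
  then show ?case
    by (rule lin_map_cong) (rule free_action_add)
qed

lemmas free_action_closed [intro, simp] = lin_mapD(1)[OF lin_map_free_action]

text \<open>Both factors are split into monomials. For two monomials the words concatenate, and the
  scalar of the right one passes through the action of the left word by linearity.\<close>

lemma free_action_mult:
  assumes "m \<in> free_carrier C B"
  shows "free_action C \<iota> \<phi> (a * b) m = free_action C \<iota> \<phi> a (free_action C \<iota> \<phi> b m)"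
proof (induction a rule: poly_mapping_single_induct)
  case (single w k)
  show ?case
  proof (induction b rule: poly_mapping_single_induct)
    case (single w' k')
    have "word_action C \<phi> w' m \<in> free_carrier C B"
      using lin_mapD(1)[OF lin_map_word_action assms] .
    then show ?case
      using lin_mapD(1)[OF lin_map_word_action, of "word_action C \<phi> w' m" w]
      by (simp add: free_action_single[OF assms] free_action_single[OF scale_vec_closed] mult_single
          word_action_add \<iota>_mult lin_mapD(3)[OF lin_map_word_action] scale_vec_simps(3))
  next
    case (add a b)
    then show ?case
      by (simp add: distrib_left free_action_add[OF assms] lin_mapD[OF lin_map_free_action]
          assms lin_mapD(1)[OF lin_map_free_action assms])
  qed
next
  case (add a b)
  then show ?case
    using assms by (simp add: distrib_right free_action_add)
qed

lemma free_action_zero [simp]: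
  assumes "m \<in> free_carrier C B"
  shows "free_action C \<iota> \<phi> 0 m = zero_vec C"
  using free_action_single[OF assms, of 0 0] scale_vec_simps(2)[OF lin_mapD(1)[OF lin_map_word_action assms]]
  by (simp add: \<iota>_0)

end

section \<open>Modules of branching systems\<close>

locale branching_system = wf_digraph G for G :: "('v, 'e) pre_digraph" +
  fixes Y :: "('v, 'e, 'x) branching"
  assumes vert_part_subset: "w \<in> verts G \<Longrightarrow> vert_part Y w \<subseteq> points Y"
    and vert_part_disjoint: "\<lbrakk>x \<in> vert_part Y v; x \<in> vert_part Y w; v \<in> verts G; w \<in> verts G\<rbrakk> \<Longrightarrow> v = w"
    and edge_part_disjoint: "\<lbrakk>x \<in> edge_part Y e; x \<in> edge_part Y f; e \<in> arcs G; f \<in> arcs G\<rbrakk> \<Longrightarrow> e = f"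
    and edge_part_subset: "e \<in> arcs G \<Longrightarrow> edge_part Y e \<subseteq> vert_part Y (tail G e)"
    and edge_map_bij: "e \<in> arcs G \<Longrightarrow> bij_betw (edge_map Y e) (vert_part Y (head G e)) (edge_part Y e)"
    and regular_vert_part: "regular G v \<Longrightarrow> vert_part Y v \<subseteq> (\<Union>e\<in>out_arcs G v. edge_part Y e)"
begin

text \<open>\<open>None\<close> stands for the zero vector. The membership tests in
  \<open>verts G\<close> and \<open>arcs G\<close> ensure that every defined value is a point, for
  arbitrary generators and arguments.\<close>

fun partial_action :: "('v, 'e) gen \<Rightarrow> 'x \<Rightarrow> 'x option" where
  "partial_action (Vert v) x = (if v \<in> verts G \<and> x \<in> vert_part Y v then Some x else None)"
| "partial_action (Edge e) x =
     (if e \<in> arcs G \<and> x \<in> vert_part Y (head G e) then Some (edge_map Y e x) else None)"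
| "partial_action (Ghost e) x =
     (if e \<in> arcs G \<and> x \<in> edge_part Y e
      then Some (inv_into (vert_part Y (head G e)) (edge_map Y e) x) else None)"

lemma edge_map_in: "\<lbrakk>e \<in> arcs G; x \<in> vert_part Y (head G e)\<rbrakk> \<Longrightarrow> edge_map Y e x \<in> edge_part Y e"
  using edge_map_bij bij_betwE by blast

lemma inv_edge_map_in:
  "\<lbrakk>e \<in> arcs G; x \<in> edge_part Y e\<rbrakk> \<Longrightarrow>
    inv_into (vert_part Y (head G e)) (edge_map Y e) x \<in> vert_part Y (head G e)"
  using edge_map_bij bij_betw_imp_surj_on inv_into_into by metis

lemma edge_map_inv:
  "\<lbrakk>e \<in> arcs G; x \<in> edge_part Y e\<rbrakk> \<Longrightarrow>
    edge_map Y e (inv_into (vert_part Y (head G e)) (edge_map Y e) x) = x"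
  using edge_map_bij bij_betw_inv_into_right by metis

lemma inv_edge_map:
  "\<lbrakk>e \<in> arcs G; x \<in> vert_part Y (head G e)\<rbrakk> \<Longrightarrow>
    inv_into (vert_part Y (head G e)) (edge_map Y e) (edge_map Y e x) = x"
  using edge_map_bij bij_betw_inv_into_left by metis

lemma partial_action_closed: "partial_action g x = Some y \<Longrightarrow> y \<in> points Y"
proof (cases g)
  case (Edge e)
  moreover assume "partial_action g x = Some y"
  ultimately show ?thesis
    using edge_map_in[of e x] edge_part_subset[of e] vert_part_subset[of "tail G e"]
    by (auto split: if_splits)
next
  case (Ghost e)
  moreover assume "partial_action g x = Some y"
  ultimately show ?thesis
    using inv_edge_map_in[of e x] vert_part_subset[of "head G e"]
    by (auto split: if_splits)
qed (use vert_part_subset in \<open>auto split: if_splits\<close>)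

definition word_map :: "('v, 'e) gen list \<Rightarrow> 'x \<Rightarrow> 'x option" where
  "word_map gs x = foldr (\<lambda>g y. Option.bind y (partial_action g)) gs (Some x)"

lemma word_map_simps [simp]:
  "word_map [] x = Some x"
  "word_map (g # gs) x = Option.bind (word_map gs x) (partial_action g)"
  by (simp_all add: word_map_def)

lemma word_map_append: "word_map (gs @ hs) x = Option.bind (word_map hs x) (word_map gs)"
  by (induction gs) (cases "word_map hs x"; simp)+

lemma word_map_closed: "x \<in> points Y \<Longrightarrow> word_map gs x = Some y \<Longrightarrow> y \<in> points Y"
  by (cases gs) (auto split: bind_splits intro: partial_action_closed)

end

text \<open>The weight \<open>\<kappa>\<close> is constantly 1 except for the twist, which puts the
  class of \<open>x\<close> on one edge and its inverse on the ghost of that edge. Since the weights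
  of an edge and its ghost are inverse to each other, the defining relations of the algebra survive
  the rescaling.\<close>

locale weighted_branching = coefficient_ring C \<iota> + branching_system G Y
  for C :: "'c ring" (structure) and \<iota> :: "'k::field \<Rightarrow> 'c"
    and G :: "('v, 'e) pre_digraph" and Y :: "('v, 'e, 'x) branching" +
  fixes \<kappa> :: "('v, 'e) gen \<Rightarrow> 'c" and \<phi> :: "('v, 'e) gen \<Rightarrow> 'x \<Rightarrow> 'x \<Rightarrow> 'c"
  assumes \<kappa>_closed [intro, simp]: "\<kappa> g \<in> carrier C"
    and \<kappa>_Vert: "\<kappa> (Vert v) = \<one>\<^bsub>C\<^esub>"
    and \<kappa>_Edge_Ghost: "e \<in> arcs G \<Longrightarrow> \<kappa> (Edge e) \<otimes>\<^bsub>C\<^esub> \<kappa> (Ghost e) = \<one>\<^bsub>C\<^esub>"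
    and \<phi>_eq: "\<phi> g x = scale_vec C (\<kappa> g) (branching_action G Y C g x)"
begin

fun monomial_vec :: "'c \<Rightarrow> 'x option \<Rightarrow> 'x \<Rightarrow> 'c" where
  "monomial_vec k None = zero_vec C"
| "monomial_vec k (Some y) = scale_vec C k (basis_vec C y)"

text \<open>Agrees with \<open>\<phi>\<close> on the generators of \<open>G\<close> but vanishes on
  all others, so that it maps points into the free module without side conditions on
  \<open>g\<close>. Elements of the free algebra of \<open>G\<close> cannot tell the two
  apart.\<close>

definition act :: "('v, 'e) gen \<Rightarrow> 'x \<Rightarrow> 'x \<Rightarrow> 'c" where
  "act g x = monomial_vec (\<kappa> g) (partial_action g x)"

lemma \<phi>_eq_act: "g \<in> gens G \<Longrightarrow> \<phi> g x = act g x"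
  unfolding \<phi>_eq act_def by (cases g) auto

lemma act_closed [intro, simp]: "act g x \<in> free_carrier C (points Y)"
  unfolding act_def
  by (cases "partial_action g x") (auto intro!: scale_vec_closed dest: partial_action_closed)

sublocale generator_action C \<iota> "points Y" act
  by unfold_locales simp

abbreviation V :: "('x \<Rightarrow> 'c) set" where "V \<equiv> free_carrier C (points Y)"

abbreviation apply_rep :: "('v, 'e, 'k) free_elem \<Rightarrow> ('x \<Rightarrow> 'c) \<Rightarrow> 'x \<Rightarrow> 'c" (infixr "\<bullet>" 70) where
  "a \<bullet> m \<equiv> free_action C \<iota> act a m"

lemma word_action_act:
  assumes "set (letters w) \<subseteq> gens G" "m \<in> V"
  shows "word_action C \<phi> w m = word_action C act w m"
proof -
  have "foldr (\<lambda>g. linear_extension C (\<phi> g)) gs m = foldr (\<lambda>g. linear_extension C (act g)) gs m"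
    if "set gs \<subseteq> gens G" for gs
    using that
  proof (induction gs)
    case (Cons g gs)
    have "\<phi> g = act g" using \<phi>_eq_act Cons.prems by auto
    with Cons show ?case by simp
  qed simp
  then show ?thesis using assms by (simp add: word_action_def)
qed

lemma free_action_act:
  assumes "a \<in> carrier (free_algebra K G)" "m \<in> V"
  shows "free_action C \<iota> \<phi> a m = a \<bullet> m"
proof
  fix y
  show "free_action C \<iota> \<phi> a m y = (a \<bullet> m) y"
    unfolding free_action_def using assms word_action_carrier[OF assms(2)]
    by (intro finsum_cong') (auto simp: carrier_free_algebra word_action_act)
qed

definition word_weight :: "('v, 'e) gen list \<Rightarrow> 'c" where
  "word_weight gs = foldr (\<lambda>g k. \<kappa> g \<otimes> k) gs \<one>"

lemma word_weight_simps [simp]: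
  "word_weight [] = \<one>" "word_weight (g # gs) = \<kappa> g \<otimes> word_weight gs"
  by (simp_all add: word_weight_def)

lemma word_weight_closed [intro, simp]: "word_weight gs \<in> carrier C"
  by (induction gs) auto

lemma word_weight_append: "word_weight (gs @ hs) = word_weight gs \<otimes> word_weight hs"
  by (induction gs) (auto simp: m_assoc)

text \<open>A generator turns a basis vector into a multiple of a basis vector or into zero, so
  along a word the target point and the scalar can be tracked separately.\<close>

lemma word_action_basis:
  assumes "x \<in> points Y"
  shows "word_action C act (NC_Word gs) (basis_vec C x) = monomial_vec (word_weight gs) (word_map gs x)"
proof (induction gs)
  case Nil
  then show ?case
    using assms scale_vec_simps(1)[OF basis_vec_closed[OF assms]] by (simp add: word_action_def)
next
  case (Cons g gs)
  have *: "word_action C act (NC_Word (g # gs)) (basis_vec C x) =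
      linear_extension C (act g) (monomial_vec (word_weight gs) (word_map gs x))"
    using Cons by (simp add: word_action_def)
  have lin: "lin_map (points Y) (linear_extension C (act g)) (points Y)"
    by (rule lin_map_linear_extension) simp
  show ?case
  proof (cases "word_map gs x")
    case None
    then show ?thesis using * lin_map_zero[OF lin] by simp
  next
    case (Some y)
    then have y: "y \<in> points Y" using assms word_map_closed by blast
    then have "linear_extension C (act g) (scale_vec C (word_weight gs) (basis_vec C y)) =
        scale_vec C (word_weight gs) (act g y)"
      by (simp add: lin_mapD(3)[OF lin] linear_extension_basis[of "points Y" "act g" "points Y"])
    also have "\<dots> = monomial_vec (\<kappa> g \<otimes> word_weight gs) (partial_action g y)"
    proof (cases "partial_action g y")
      case None
      then show ?thesis by (simp add: act_def)
    next
      case (Some z)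
      then have "z \<in> points Y" by (rule partial_action_closed)
      then show ?thesis
        using Some by (simp add: act_def m_comm scale_vec_simps(3)[OF basis_vec_closed])
    qed
    finally show ?thesis using * Some by simp
  qed
qed

lemma single_apply_basis:
  assumes "x \<in> points Y"
  shows "Poly_Mapping.single (NC_Word gs) k \<bullet> basis_vec C x =
    monomial_vec (\<iota> k \<otimes> word_weight gs) (word_map gs x)"
proof (cases "word_map gs x")
  case (Some y)
  then have "y \<in> points Y" using assms word_map_closed by blast
  then show ?thesis
    using assms Some by (simp add: free_action_single word_action_basis
        scale_vec_simps(3)[OF basis_vec_closed])
qed (use assms in \<open>simp add: free_action_single word_action_basis\<close>)

lemma gn_apply_basis:
  assumes "x \<in> points Y"
  shows "gn g \<bullet> basis_vec C x = monomial_vec (\<kappa> g) (partial_action g x)"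
  using single_apply_basis[OF assms, of "[g]" 1] by (simp add: gn_def \<iota>_1)

lemma gn_mult_apply_basis:
  assumes "x \<in> points Y"
  shows "(gn g * gn h) \<bullet> basis_vec C x =
    monomial_vec (\<kappa> g \<otimes> \<kappa> h) (Option.bind (partial_action h x) (partial_action g))"
  using single_apply_basis[OF assms, of "[g, h]" 1]
  by (simp add: gn_def mult_single plus_nc_word_def \<iota>_1)

text \<open>Vectors over \<open>C\<close> are equipped with addition only, so a difference of
  polynomials is handled through \<open>a = (a - b) + b\<close>.\<close>

lemma free_action_diff_eq_zero_iff:
  assumes "m \<in> V"
  shows "(a - b) \<bullet> m = zero_vec C \<longleftrightarrow> a \<bullet> m = b \<bullet> m"
proof -
  have eq: "a \<bullet> m = add_vec ((a - b) \<bullet> m) (b \<bullet> m)"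
    using free_action_add[OF assms, of "a - b" b] by simp
  have carr: "(c \<bullet> m) y \<in> carrier C" for c y
    by (rule free_carrierD[OF free_action_closed[OF assms]])
  show ?thesis
  proof
    assume "(a - b) \<bullet> m = zero_vec C"
    with eq show "a \<bullet> m = b \<bullet> m" using add_vec_zero(2)[OF free_action_closed[OF assms]] by simp
  next
    assume ab: "a \<bullet> m = b \<bullet> m"
    show "(a - b) \<bullet> m = zero_vec C"
    proof
      fix y
      have "((a - b) \<bullet> m) y \<oplus> (b \<bullet> m) y = (b \<bullet> m) y"
        using eq ab by (metis add_vec_def)
      then show "((a - b) \<bullet> m) y = zero_vec C y"
        using carr[of "a - b" y] carr[of b y] by (simp add: zero_vec_def)
    qed
  qed
qed

lemma free_action_sum_zero:
  assumes "m \<in> V" "\<And>i. i \<in> I \<Longrightarrow> f i \<bullet> m = zero_vec C"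
  shows "sum f I \<bullet> m = zero_vec C"
  using assms(2)
  by (induction I rule: infinite_finite_induct)
    (auto simp: assms(1) free_action_add add_vec_zero[OF zero_vec_closed])

lemma free_action_sum_single:
  assumes "m \<in> V" "finite I" "i \<in> I" "\<And>j. \<lbrakk>j \<in> I; j \<noteq> i\<rbrakk> \<Longrightarrow> f j \<bullet> m = zero_vec C"
  shows "sum f I \<bullet> m = f i \<bullet> m"
proof -
  have "sum f I = f i + sum f (I - {i})"
    using assms by (simp add: sum.remove)
  moreover have "sum f (I - {i}) \<bullet> m = zero_vec C"
    by (rule free_action_sum_zero) (use assms in auto)
  ultimately show ?thesis
    using assms(1) by (simp add: free_action_add add_vec_zero[OF free_action_closed])
qed

lemma edge_ghost_apply_basis:
  assumes "x \<in> points Y" "e \<in> arcs G"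
  shows "(gn (Edge e) * gn (Ghost e)) \<bullet> basis_vec C x =
    (if x \<in> edge_part Y e then basis_vec C x else zero_vec C)"
  using assms
  by (simp add: gn_mult_apply_basis inv_edge_map_in edge_map_inv \<kappa>_Edge_Ghost
      scale_vec_simps(1)[OF basis_vec_closed])

text \<open>\<open>ee\<^sup>*\<close> projects onto the points in the part of \<open>e\<close>, and
  these parts are disjoint. Stated for any finite set of edges that covers the points at
  \<open>v\<close>: besides regular vertices this serves breaking vertices, where only edges into
  \<open>R\<close> are summed, and a vertex of \<open>c\<close> with its single edge on
  \<open>c\<close>.\<close>

lemma cuntz_krieger_apply_basis:
  assumes x: "x \<in> points Y" and "v \<in> verts G" "finite F" "F \<subseteq> out_arcs G v"
    and cover: "x \<in> vert_part Y v \<Longrightarrow> \<exists>e\<in>F. x \<in> edge_part Y e"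
  shows "(gn (Vert v) - (\<Sum>e\<in>F. gn (Edge e) * gn (Ghost e))) \<bullet> basis_vec C x = zero_vec C"
proof -
  have F: "e \<in> arcs G" "tail G e = v" if "e \<in> F" for e
    using assms(4) that by auto
  have "gn (Vert v) \<bullet> basis_vec C x = (\<Sum>e\<in>F. gn (Edge e) * gn (Ghost e)) \<bullet> basis_vec C x"
  proof (cases "x \<in> vert_part Y v")
    case True
    then obtain e where e: "e \<in> F" "x \<in> edge_part Y e" using cover by blast
    have "(\<Sum>e\<in>F. gn (Edge e) * gn (Ghost e)) \<bullet> basis_vec C x =
        (gn (Edge e) * gn (Ghost e)) \<bullet> basis_vec C x"
    proof (rule free_action_sum_single)
      fix f assume "f \<in> F" "f \<noteq> e"
      then have "x \<notin> edge_part Y f" using e F edge_part_disjoint by blast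
      then show "(gn (Edge f) * gn (Ghost f)) \<bullet> basis_vec C x = zero_vec C"
        using x F \<open>f \<in> F\<close> by (simp add: edge_ghost_apply_basis)
    qed (use x e assms in auto)
    then show ?thesis
      using x e F True assms(2)
      by (simp add: edge_ghost_apply_basis gn_apply_basis \<kappa>_Vert scale_vec_simps(1)[OF basis_vec_closed])
  next
    case False
    then have "x \<notin> edge_part Y e" if "e \<in> F" for e
      using F[OF that] edge_part_subset by blast
    then have "(\<Sum>e\<in>F. gn (Edge e) * gn (Ghost e)) \<bullet> basis_vec C x = zero_vec C"
      by (intro free_action_sum_zero) (use x F in \<open>auto simp: edge_ghost_apply_basis\<close>)
    then show ?thesis using x False by (simp add: gn_apply_basis)
  qed
  then show ?thesis using x by (simp add: free_action_diff_eq_zero_iff)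
qed

lemma lpa_relation_apply_basis:
  fixes K :: "'k itself"
  assumes r: "r \<in> lpa_relations K G" and x: "x \<in> points Y"
  shows "r \<bullet> basis_vec C x = zero_vec C"
proof -
  have bx: "basis_vec C x \<in> V" using x by simp
  note simps = x gn_mult_apply_basis gn_apply_basis free_action_diff_eq_zero_iff[OF bx] bx
    edge_map_in inv_edge_map_in edge_map_inv inv_edge_map \<kappa>_Edge_Ghost \<kappa>_Vert
  have tail: "e \<in> arcs G \<Longrightarrow> y \<in> edge_part Y e \<Longrightarrow> y \<in> vert_part Y (tail G e)" for e y
    using edge_part_subset by blast
  from r consider
      (1) v w where "r = gn (Vert v) * gn (Vert w) - (if v = w then gn (Vert v) else 0)" "v \<in> verts G" "w \<in> verts G"
    | (2) e where "r = gn (Vert (tail G e)) * gn (Edge e) - gn (Edge e)" "e \<in> arcs G"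
    | (3) e where "r = gn (Edge e) * gn (Vert (head G e)) - gn (Edge e)" "e \<in> arcs G"
    | (4) e where "r = gn (Vert (head G e)) * gn (Ghost e) - gn (Ghost e)" "e \<in> arcs G"
    | (5) e where "r = gn (Ghost e) * gn (Vert (tail G e)) - gn (Ghost e)" "e \<in> arcs G"
    | (6) e f where "r = gn (Ghost e) * gn (Edge f) - (if e = f then gn (Vert (head G e)) else 0)" "e \<in> arcs G" "f \<in> arcs G"
    | (7) v where "r = gn (Vert v) - (\<Sum>e\<in>out_arcs G v. gn (Edge e) * gn (Ghost e))" "regular G v"
    unfolding lpa_relations_def by blast
  then show ?thesis
  proof cases
    case 1
    then show ?thesis using vert_part_disjoint[of x v w] by (auto simp: simps)
  next
    case 2
    then show ?thesis using tail[of e "edge_map Y e x"] by (auto simp: simps)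
  next
    case 3
    then show ?thesis by (auto simp: simps)
  next
    case 4
    then show ?thesis by (auto simp: simps)
  next
    case 5
    then show ?thesis using tail[of e x] by (auto simp: simps)
  next
    case 6
    have "edge_map Y f x \<notin> edge_part Y e" if "x \<in> vert_part Y (head G f)" "e \<noteq> f"
      using that 6 edge_map_in edge_part_disjoint by blast
    moreover have "\<kappa> (Ghost e) \<otimes> \<kappa> (Edge e) = \<one>"
      using 6 \<kappa>_Edge_Ghost[of e] m_comm by simp
    ultimately show ?thesis using 6 by (auto simp: simps)
  next
    case 7
    then show ?thesis
      using x regular_vert_part[OF 7(2)] unfolding 7(1)
      by (intro cuntz_krieger_apply_basis) (auto simp: regular_def sink_def infinite_emitter_def)
  qed
qed

text \<open>The polynomials that act as zero form an ideal, so it suffices to look at the relations.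
  This makes the action of a coset independent of the representative.\<close>

lemma lpa_relation_ideal_apply:
  fixes K :: "'k itself"
  assumes "a \<in> lpa_relation_ideal K G" "m \<in> V"
  shows "a \<bullet> m = zero_vec C"
proof -
  define Z where "Z = {a \<in> carrier (free_algebra K G). \<forall>m\<in>V. a \<bullet> m = zero_vec C}"
  interpret F: ring "free_algebra K G" by (rule ring_free_algebra)
  have zero: "b \<bullet> zero_vec C = zero_vec C" for b
    by (rule lin_map_zero[OF lin_map_free_action])
  have neg: "- b \<bullet> m = zero_vec C" if "m \<in> V" "b \<bullet> m = zero_vec C" for b m
    using free_action_diff_eq_zero_iff[OF that(1), of 0 b] that by simp
  have "ideal Z (free_algebra K G)"
  proof (rule idealI)
    show "subgroup Z (add_monoid (free_algebra K G))"
    proof (rule F.add.subgroupI)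
      show "Z \<noteq> {}" by (auto simp: Z_def intro!: exI[of _ 0])
    qed (auto simp: Z_def free_action_add add_vec_zero[OF zero_vec_closed] neg
        simp flip: a_inv_def)
  qed (auto simp: Z_def ring_free_algebra free_action_mult zero)
  moreover have "lpa_relations K G \<subseteq> Z"
  proof
    fix r assume r: "r \<in> lpa_relations K G"
    have "r \<bullet> m = zero_vec C" if "m \<in> V" for m
      using that lin_map_eqI[OF lin_map_free_action lin_map_zero_map] lpa_relation_apply_basis[OF r]
      by blast
    then show "r \<in> Z" using r lpa_relations_subset unfolding Z_def by blast
  qed
  ultimately show ?thesis
    using lpa_relation_ideal_minimal assms unfolding Z_def by blast
qed

definition the_module :: "(('v, 'e, 'k) lpa_elem, 'x \<Rightarrow> 'c) module" where
  "the_module = lpa_module C \<iota> (points Y) \<phi>"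

lemma the_module_simps [simp]:
  "carrier the_module = V" "\<zero>\<^bsub>the_module\<^esub> = zero_vec C"
  "m \<oplus>\<^bsub>the_module\<^esub> n = add_vec m n"
  by (simp_all add: the_module_def lpa_module_def add_vec_def)

text \<open>All members of the coset send \<open>m\<close> to the same vector, so
  \<open>the_elem\<close> is applied to a singleton.\<close>

lemma lpa_class_smult [simp]:
  assumes "a \<in> carrier (free_algebra K G)" "m \<in> V"
  shows "lpa_class K G a \<odot>\<^bsub>the_module\<^esub> m = a \<bullet> m"
proof -
  have "free_action C \<iota> \<phi> b m = a \<bullet> m" if "b \<in> lpa_class K G a" for b
  proof -
    from that obtain h where h: "h \<in> lpa_relation_ideal K G" "b = h + a"
      unfolding lpa_class_conv by blast
    then have "h + a \<in> carrier (free_algebra K G)"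
      using assms lpa_relation_ideal_closed(4) by blast
    then show ?thesis
      using h assms lpa_relation_ideal_apply[OF h(1) assms(2)]
      by (simp add: free_action_act free_action_add add_vec_zero[OF free_action_closed])
  qed
  moreover have "a \<in> lpa_class K G a"
    unfolding lpa_class_conv by force
  ultimately have "(\<lambda>b. free_action C \<iota> \<phi> b m) ` lpa_class K G a = {a \<bullet> m}"
    by force
  then show ?thesis by (simp add: the_module_def lpa_module_def)
qed

lemma abelian_group_the_module: "abelian_group the_module"
proof (rule abelian_groupI)
  fix m assume "m \<in> carrier the_module"
  then have m: "m \<in> V" by simp
  have "add_vec (scale_vec C (\<ominus> \<one>) m) m = zero_vec C"
  proof
    fix x
    have "m x \<in> carrier C" by (rule free_carrierD[OF m])
    then show "add_vec (scale_vec C (\<ominus> \<one>) m) m x = zero_vec C x"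
      by (simp add: add_vec_def scale_vec_def zero_vec_def l_minus l_neg)
  qed
  then show "\<exists>n\<in>carrier the_module. n \<oplus>\<^bsub>the_module\<^esub> m = \<zero>\<^bsub>the_module\<^esub>"
    using m by (intro bexI[of _ "scale_vec C (\<ominus> \<one>) m"]) auto
next
  fix m n p assume "m \<in> carrier the_module" "n \<in> carrier the_module" "p \<in> carrier the_module"
  then have carr: "m x \<in> carrier C" "n x \<in> carrier C" "p x \<in> carrier C" for x
    by (auto intro: free_carrierD)
  show "m \<oplus>\<^bsub>the_module\<^esub> n \<oplus>\<^bsub>the_module\<^esub> p = m \<oplus>\<^bsub>the_module\<^esub> (n \<oplus>\<^bsub>the_module\<^esub> p)"
    using carr by (simp add: add_vec_def a_assoc)
  show "m \<oplus>\<^bsub>the_module\<^esub> n = n \<oplus>\<^bsub>the_module\<^esub> m"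
    using carr by (simp add: add_vec_def a_comm)
qed auto

lemma left_module_the_module: "left_module (leavitt K G) the_module"
  unfolding left_module_def
  by (auto simp: abelian_group_the_module carrier_leavitt leavitt_ops lpa_reps_carrier
      free_action_add free_action_mult lin_mapD(2)[OF lin_map_free_action])

lemma lpa_class_in_annihilator_iff:
  assumes "a \<in> lpa_reps K G"
  shows "lpa_class K G a \<in> annihilator (leavitt K G) the_module \<longleftrightarrow>
    (\<forall>x\<in>points Y. a \<bullet> basis_vec C x = zero_vec C)"
proof
  assume "lpa_class K G a \<in> annihilator (leavitt K G) the_module"
  then show "\<forall>x\<in>points Y. a \<bullet> basis_vec C x = zero_vec C"
    using assms by (auto simp: annihilator_def lpa_reps_carrier)
next
  assume "\<forall>x\<in>points Y. a \<bullet> basis_vec C x = zero_vec C"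
  then have "a \<bullet> m = zero_vec C" if "m \<in> V" for m
    using that lin_map_eqI[OF lin_map_free_action lin_map_zero_map] by blast
  then show "lpa_class K G a \<in> annihilator (leavitt K G) the_module"
    using assms by (auto simp: annihilator_def lpa_reps_carrier carrier_leavitt)
qed

text \<open>Lets the support of a module be read off from its annihilator, which is the first step
  in every comparison of annihilators below. Nontriviality of \<open>C\<close> makes basis vectors
  nonzero.\<close>

lemma vertex_in_annihilator_iff:
  assumes "w \<in> verts G" "\<one> \<noteq> \<zero>"
  shows "lpa_class K G (gn (Vert w)) \<in> annihilator (leavitt K G) the_module \<longleftrightarrow> vert_part Y w = {}"
proof -
  have "basis_vec C x = zero_vec C \<longleftrightarrow> False" for x :: 'x
    using assms(2) by (auto simp: basis_vec_def zero_vec_def fun_eq_iff)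
  then have "gn (Vert w) \<bullet> basis_vec C x = zero_vec C \<longleftrightarrow> x \<notin> vert_part Y w" if "x \<in> points Y" for x
    using that assms(1) by (auto simp: gn_apply_basis \<kappa>_Vert scale_vec_simps(1)[OF basis_vec_closed])
  moreover have "gn (Vert w) \<in> lpa_reps K G"
    using assms(1) by (intro lpa_reps_gn) simp
  ultimately show ?thesis
    using vert_part_subset[OF assms(1)] by (auto simp: lpa_class_in_annihilator_iff)
qed

end

section \<open>Exclusive cycles\<close>

fun prepend_path :: "'e list \<Rightarrow> (nat \<Rightarrow> 'e) \<Rightarrow> nat \<Rightarrow> 'e" where
  "prepend_path [] \<beta> = \<beta>"
| "prepend_path (e # p) \<beta> = case_nat e (prepend_path p \<beta>)"

lemma case_nat_eq_iff [simp]: "case_nat e \<beta> = case_nat f \<gamma> \<longleftrightarrow> e = f \<and> \<beta> = \<gamma>"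
proof
  assume "case_nat e \<beta> = case_nat f \<gamma>"
  then have eq: "case_nat e \<beta> n = case_nat f \<gamma> n" for n by simp
  have "e = f" using eq[of 0] by simp
  moreover have "\<beta> = \<gamma>" using eq[of "Suc _"] by (intro ext) simp
  ultimately show "e = f \<and> \<beta> = \<gamma>" by simp
qed simp

lemma prepend_path_append: "prepend_path (p @ q) \<beta> = prepend_path p (prepend_path q \<beta>)"
  by (induction p) auto

lemma prepend_path_inject [simp]: "prepend_path p \<beta> = prepend_path p \<gamma> \<longleftrightarrow> \<beta> = \<gamma>"
  by (induction p) auto

lemma prepend_path_nth: "n < length p \<Longrightarrow> prepend_path p \<beta> n = p ! n"
  by (induction p arbitrary: n) (auto simp: nth_Cons split: nat.split)

lemma prepend_path_nth_add: "prepend_path p \<beta> (length p + n) = \<beta> n"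
  by (induction p) auto

lemma prepend_path_eqD:
  assumes "prepend_path p \<beta> = prepend_path q \<gamma>" "length p \<le> length q"
  shows "\<exists>r. q = p @ r \<and> \<beta> = prepend_path r \<gamma>"
  using assms
proof (induction p arbitrary: q)
  case (Cons e p)
  then show ?case by (cases q) auto
qed simp

locale graph_with_exclusive_cycle = wf_digraph G for G :: "('v, 'e) pre_digraph" +
  fixes c :: "'e list"
  assumes exclusive: "exclusive_cycle G c"
begin

abbreviation cv :: "'v set" where "cv \<equiv> cycle_verts G c"

lemma cycle_c: "cycle c"
  using exclusive by (simp add: exclusive_cycle_def)

text \<open>The definition of \<open>cycle\<close> yields distinct ranges. The sources are the same
  cyclic list of vertices begun one step earlier, because the walk returns to its start.\<close>

lemma cycle_start:
  obtains u where "awalk u c u" "distinct (map (head G) c)" "distinct (map (tail G) c)" "c \<noteq> []"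
proof -
  from cycle_c obtain u where u: "awalk u c u" "distinct (tl (awalk_verts u c))" "c \<noteq> []"
    unfolding cycle_def by blast
  then have cas: "cas u c u" by (simp add: awalk_def)
  obtain e es where c: "c = e # es" using u(3) by (cases c) auto
  have e: "tail G e = u" using cas c by simp
  have "awalk_verts u c = tail G (hd c) # map (head G) c"
    using awalk_verts_conv'[OF cas] u(3) by simp
  then have heads: "distinct (map (head G) c)" using u(2) by simp
  have "awlast u c = u" using u(1) by (rule awlast_of_awalk) (simp add: NOMATCH_def)
  then have "awalk_verts u c = map (tail G) c @ [u]"
    using awalk_verts_conv[of u c] u(3) by (metis last_snoc)
  then have "distinct (map (tail G) es @ [u])" using u(2) c by simp
  then have "distinct (map (tail G) c)" using c e by auto
  with u heads show ?thesis using that by blast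
qed

lemma c_nonempty: "c \<noteq> []" and c_arcs: "set c \<subseteq> arcs G"
  and inj_on_head: "inj_on (head G) (set c)" and inj_on_tail: "inj_on (tail G) (set c)"
proof -
  obtain u where "awalk u c u" "distinct (map (head G) c)" "distinct (map (tail G) c)" "c \<noteq> []"
    by (rule cycle_start)
  then show "c \<noteq> []" "set c \<subseteq> arcs G" "inj_on (head G) (set c)" "inj_on (tail G) (set c)"
    by (simp_all add: distinct_map awalk_def)
qed

text \<open>The walk is nonempty even for \<open>u = w\<close>, where it is a proper turn around the
  cycle; the rotation in \<open>not_simple\<close> depends on this.\<close>

lemma cv_path:
  assumes "u \<in> cv" "w \<in> cv"
  obtains p where "awalk u p w" "set p \<subseteq> set c" "p \<noteq> []"
proof -
  obtain u0 where u0: "awalk u0 c u0" by (rule cycle_start)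
  have through: "\<exists>p q. awalk u0 p x \<and> awalk x q u0 \<and> q \<noteq> [] \<and> set p \<subseteq> set c \<and> set q \<subseteq> set c"
    if "x \<in> cv" for x
  proof -
    from that obtain e where e: "e \<in> set c" "tail G e = x"
      by (auto simp: cycle_verts_def)
    then obtain p q where c: "c = p @ e # q" by (meson split_list)
    with u0 e have "awalk u0 p x" "awalk x (e # q) u0" by (auto simp: awalk_Cons_iff)
    with c show ?thesis by (intro exI[of _ p] exI[of _ "e # q"]) auto
  qed
  from through[OF assms(1)] obtain q where q: "awalk u q u0" "q \<noteq> []" "set q \<subseteq> set c"
    by blast
  from through[OF assms(2)] obtain p where p: "awalk u0 p w" "set p \<subseteq> set c"
    by blast
  have "awalk u (q @ p) w" using q(1) p(1) by (rule awalk_appendI)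
  then show ?thesis by (rule that) (use p q in auto)
qed

lemma cv_verts: "cv \<subseteq> verts G"
  using c_arcs by (auto simp: cycle_verts_def)

lemma head_in_cv: "e \<in> set c \<Longrightarrow> head G e \<in> cv"
proof -
  assume e: "e \<in> set c"
  obtain u0 where u0: "awalk u0 c u0" by (rule cycle_start)
  from e obtain p q where c: "c = p @ e # q" by (meson split_list)
  with u0 have q: "awalk (head G e) q u0" by (auto simp: awalk_Cons_iff)
  show ?thesis
  proof (cases q)
    case Nil
    then have "head G e = u0" using q by (simp add: awalk_Nil_iff)
    moreover have "u0 = tail G (hd c)" using u0 c_nonempty by (cases c) (auto simp: awalk_Cons_iff)
    ultimately show ?thesis using c_nonempty by (auto simp: cycle_verts_def)
  next
    case (Cons f fs)
    then have "head G e = tail G f" using q by (auto simp: awalk_Cons_iff)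
    then show ?thesis using Cons c by (auto simp: cycle_verts_def)
  qed
qed

lemma tail_in_cv: "e \<in> set c \<Longrightarrow> tail G e \<in> cv"
  by (auto simp: cycle_verts_def)

text \<open>An edge that starts on \<open>c\<close> and from whose range \<open>c\<close> can be reached closes up to a cycle
  that meets \<open>c\<close>, so exclusivity puts it on \<open>c\<close>.\<close>

lemma path_in_cycle_edges:
  assumes "awalk u p w" "u \<in> cv" "w \<in> cv"
  shows "set p \<subseteq> set c"
  using assms
proof (induction p arbitrary: u)
  case (Cons e p)
  then have e: "e \<in> arcs G" "u = tail G e" "awalk (head G e) p w"
    by (auto simp: awalk_Cons_iff)
  obtain q where "awalk w q u" using cv_path Cons.prems by metis
  with e have "awalk (head G e) (p @ q) u" by (blast intro: awalk_appendI)
  \<comment> \<open>Removing repeated vertices from the return walk makes \<open>e # r\<close> a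
    cycle in the strict sense, to which exclusivity applies.\<close>
  then obtain r where r: "apath (head G e) r u" using apath_awalk_to_apath by blast
  then have "awalk u (e # r) u" "distinct (tl (awalk_verts u (e # r)))"
    using e by (auto simp: apath_def awalk_Cons_iff)
  then have "cycle (e # r)" unfolding cycle_def by blast
  moreover have "cycle_verts G (e # r) \<inter> cv \<noteq> {}"
    using e(2) Cons.prems(2) by (auto simp: cycle_verts_def)
  ultimately have "same_cycle c (e # r)"
    using exclusive by (simp add: exclusive_cycle_def)
  then have "e \<in> set c" unfolding same_cycle_def by (metis list.set_intros(1) set_rotate)
  then show ?case using Cons.IH[OF e(3) head_in_cv] Cons.prems(3) by simp
qed simp

text \<open>A walk from \<open>c\<close> through \<open>x\<close> back to \<open>c\<close> uses only
  edges of \<open>c\<close>. This is the form in which exclusivity is used later: whatever lies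
  between two vertices of \<open>c\<close> lies on \<open>c\<close>.\<close>

lemma path_verts_in_cv:
  assumes "awalk u p x" "awalk x q w" "u \<in> cv" "w \<in> cv"
  shows "x \<in> cv"
proof -
  have "awalk u (p @ q) w" using assms by (blast intro: awalk_appendI)
  then have *: "set (p @ q) \<subseteq> set c" using path_in_cycle_edges assms by blast
  show ?thesis
  proof (cases q)
    case Nil
    then show ?thesis using assms by (auto simp: awalk_Nil_iff)
  next
    case (Cons f fs)
    then have "x = tail G f" using assms by (auto simp: awalk_Cons_iff)
    then show ?thesis using * Cons tail_in_cv by simp
  qed
qed

abbreviation R :: "'v set" where "R \<equiv> root_set G cv"

lemma in_R_iff: "u \<in> R \<longleftrightarrow> (\<exists>w\<in>cv. \<exists>p. awalk u p w)"
  by (auto simp: root_set_def)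

lemma cv_subset_R: "cv \<subseteq> R"
proof
  fix u assume "u \<in> cv"
  then have "awalk u [] u" using cv_verts by (auto simp: awalk_Nil_iff)
  with \<open>u \<in> cv\<close> show "u \<in> R" unfolding in_R_iff by blast
qed

lemma R_verts: "R \<subseteq> verts G"
  by (auto simp: root_set_def)

definition next_edge :: "'v \<Rightarrow> 'e" where
  "next_edge u = (THE e. e \<in> set c \<and> tail G e = u)"

lemma next_edge_tail [simp]: "e \<in> set c \<Longrightarrow> next_edge (tail G e) = e"
  unfolding next_edge_def using inj_on_tail by (intro the_equality) (auto dest: inj_onD)

lemma next_edge:
  assumes "u \<in> cv"
  shows "next_edge u \<in> set c" "tail G (next_edge u) = u" "head G (next_edge u) \<in> cv"
    "next_edge u \<in> arcs G"
proof -
  obtain e where "e \<in> set c" "u = tail G e" using assms by (auto simp: cycle_verts_def)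
  then show "next_edge u \<in> set c" "tail G (next_edge u) = u" "head G (next_edge u) \<in> cv"
    "next_edge u \<in> arcs G"
    using head_in_cv c_arcs by auto
qed

text \<open>The infinite path around \<open>c\<close> that starts at \<open>u\<close>. Iterating the
  successor map on vertices, rather than indexing into \<open>c\<close>, avoids any reference to the
  position of \<open>u\<close> in the list.\<close>

definition cycle_path :: "'v \<Rightarrow> nat \<Rightarrow> 'e" where
  "cycle_path u n = next_edge (((\<lambda>u. head G (next_edge u)) ^^ n) u)"

lemma cycle_path_unfold: "cycle_path u = case_nat (next_edge u) (cycle_path (head G (next_edge u)))"
  by (rule ext) (auto simp: cycle_path_def funpow_Suc_right simp del: funpow.simps split: nat.split)

lemma cycle_path_edge: "e \<in> set c \<Longrightarrow> case_nat e (cycle_path (head G e)) = cycle_path (tail G e)"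
  by (subst cycle_path_unfold[of "tail G e"]) simp

lemma cycle_path_0 [simp]: "cycle_path u 0 = next_edge u"
  by (simp add: cycle_path_def)

lemma prepend_cycle_path:
  assumes "awalk u p w" "u \<in> cv" "w \<in> cv"
  shows "prepend_path p (cycle_path w) = cycle_path u"
  using assms
proof (induction p arbitrary: u)
  case Nil
  then show ?case by (simp add: awalk_Nil_iff)
next
  case (Cons e p)
  then have "e \<in> set c" "u = tail G e" "awalk (head G e) p w"
    using path_in_cycle_edges[OF Cons.prems] by (auto simp: awalk_Cons_iff)
  then show ?case using Cons.IH[OF _ head_in_cv] Cons.prems(3) by (simp add: cycle_path_edge)
qed

end

section \<open>The branching system of reduced words\<close>

text \<open>The second component of the word is ignored and so is its base vertex; this allows words
  over different base vertices to be compared.\<close>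

fun word_path :: "('v, 'e) pre_digraph \<Rightarrow> 'e list \<Rightarrow> ('v, 'e) path \<times> ('v, 'e) path \<Rightarrow> nat \<Rightarrow> 'e" where
  "word_path G c ((w, p), y) =
     prepend_path p (graph_with_exclusive_cycle.cycle_path G c (pre_digraph.awlast G w p))"

locale cycle_word_system = graph_with_exclusive_cycle +
  fixes v assumes v_in_cv: "v \<in> cv"
begin

abbreviation N :: "('a, 'b, ('a, 'b) path \<times> ('a, 'b) path) branching" where
  "N \<equiv> cycle_branching G c v"

abbreviation infp where "infp \<equiv> word_path G c"

lemma cycle_words_iff:
  "((w, p), (v', q)) \<in> cycle_words G c v \<longleftrightarrow> v' = v \<and> (\<exists>u\<in>cv. awalk w p u \<and> awalk v q u)"
  by (auto simp: cycle_words_def)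

lemma cycle_wordsE:
  assumes "x \<in> cycle_words G c v"
  obtains w p q u where "x = ((w, p), (v, q))" "u \<in> cv" "awalk w p u" "awalk v q u"
  using assms unfolding cycle_words_def by blast

lemma points_N: "points N = {x \<in> cycle_words G c v. reduced x}"
  by (simp add: cycle_branching_def)

lemma vert_part_N: "x \<in> vert_part N w \<longleftrightarrow> x \<in> points N \<and> fst (fst x) = w"
  by (simp add: cycle_branching_def)

lemma edge_map_N: "edge_map N e ((w, p), q) = red ((tail G e, e # p), q)"
  by (simp add: cycle_branching_def)

lemma red_reduced: "reduced x \<Longrightarrow> red x = x"
  by (cases x rule: reduced.cases) (simp only: reduced.simps, subst red.simps, auto)

text \<open>The cancelled edge is the last one of a walk between vertices of \<open>c\<close>, so it
  lies on \<open>c\<close>. Hence the shorter pair ends on \<open>c\<close> again, and the edge lost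
  from \<open>p\<close> returns as the first edge of the path around \<open>c\<close>.\<close>

lemma red_props:
  assumes "x \<in> cycle_words G c v"
  shows "red x \<in> points N \<and> infp (red x) = infp x \<and> word_degree (red x) = word_degree x \<and>
    fst (fst (red x)) = fst (fst x)"
  using assms
proof (induction x rule: red.induct)
  case (1 w p v' q)
  show ?case
  proof (cases "p \<noteq> [] \<and> q \<noteq> [] \<and> last p = last q")
    case False
    then show ?thesis using 1(2) by (simp add: points_N red_reduced)
  next
    case True
    then obtain p' q' e where pq: "p = p' @ [e]" "q = q' @ [e]"
      by (metis append_butlast_last_id)
    from 1(2) obtain u where u: "v' = v" "u \<in> cv" "awalk w (p' @ [e]) u" "awalk v (q' @ [e]) u"
      unfolding pq cycle_words_iff by blast
    then have e: "awalk w p' (tail G e)" "awalk v q' (tail G e)" "head G e = u" "e \<in> arcs G"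
      by (auto simp: awalk_simps)
    have ec: "e \<in> set c" using path_in_cycle_edges[OF u(4) v_in_cv u(2)] by simp
    then have "((w, p'), (v, q')) \<in> cycle_words G c v"
      using e tail_in_cv by (auto simp: cycle_words_iff)
    then have "red ((w, p'), (v, q')) \<in> points N \<and> infp (red ((w, p'), (v, q'))) = infp ((w, p'), (v, q')) \<and>
        word_degree (red ((w, p'), (v, q'))) = word_degree ((w, p'), (v, q')) \<and>
        fst (fst (red ((w, p'), (v, q')))) = w"
      using 1(1)[OF True] pq u by simp
    moreover have "red ((w, p), (v', q)) = red ((w, p'), (v, q'))"
      using pq u(1) by (subst red.simps) simp
    moreover have "infp ((w, p), (v', q)) = infp ((w, p'), (v, q'))"
    proof -
      have "awlast w p = u" "awlast w p' = tail G e"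
        using u e unfolding pq by auto
      then show ?thesis
        using cycle_path_edge[OF ec] e(3) by (simp add: pq prepend_path_append)
    qed
    ultimately show ?thesis using pq u(1) by simp
  qed
qed

lemma red_in_points: "x \<in> cycle_words G c v \<Longrightarrow> red x \<in> points N"
  and infp_red: "x \<in> cycle_words G c v \<Longrightarrow> infp (red x) = infp x"
  and degree_red: "x \<in> cycle_words G c v \<Longrightarrow> word_degree (red x) = word_degree x"
  and source_red: "x \<in> cycle_words G c v \<Longrightarrow> fst (fst (red x)) = fst (fst x)"
  by (simp_all add: red_props)

lemma pointsE:
  assumes "x \<in> points N"
  obtains w p q u where "x = ((w, p), (v, q))" "u \<in> cv" "awalk w p u" "awalk v q u"
    "\<not> (p \<noteq> [] \<and> q \<noteq> [] \<and> last p = last q)" "infp x = prepend_path p (cycle_path u)"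
proof -
  from assms have "x \<in> cycle_words G c v" unfolding points_N by simp
  then obtain w p q u where x: "x = ((w, p), (v, q))" "u \<in> cv" "awalk w p u" "awalk v q u"
    by (rule cycle_wordsE)
  moreover from assms have "\<not> (p \<noteq> [] \<and> q \<noteq> [] \<and> last p = last q)"
    unfolding x points_N by simp
  moreover have "infp x = prepend_path p (cycle_path u)"
    using x by auto
  ultimately show ?thesis using that by blast
qed

lemma infp_0:
  assumes "x \<in> points N"
  shows "infp x 0 \<in> arcs G" "tail G (infp x 0) = fst (fst x)"
proof -
  from assms obtain w p q u where x: "x = ((w, p), (v, q))" "u \<in> cv" "awalk w p u" "awalk v q u"
    "infp x = prepend_path p (cycle_path u)"
    by (rule pointsE)
  then have "infp x 0 \<in> arcs G \<and> tail G (infp x 0) = fst (fst x)"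
    by (cases p) (auto simp: awalk_simps next_edge simp del: word_path.simps)
  then show "infp x 0 \<in> arcs G" "tail G (infp x 0) = fst (fst x)" by auto
qed

lemma vert_part_iff: "x \<in> points N \<Longrightarrow> x \<in> vert_part N w \<longleftrightarrow> tail G (infp x 0) = w"
  using infp_0 by (simp add: vert_part_N)

text \<open>Along an exclusive cycle \<open>q\<close> is determined by its length, and for fixed degree a common
  suffix of two choices of \<open>p\<close> and \<open>q\<close> would have been cancelled by reduction.\<close>

lemma infp_degree_inject:
  assumes "x \<in> points N" "y \<in> points N" "infp x = infp y" "word_degree x = word_degree y"
  shows "x = y"
proof -
  have le: "x = y" if xy: "x \<in> points N" "y \<in> points N" "infp x = infp y" "word_degree x = word_degree y"
    "length (snd (fst x)) \<le> length (snd (fst y))" for x y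
  proof -
    from xy(1) obtain w p q u where x: "x = ((w, p), (v, q))" "u \<in> cv" "awalk w p u" "awalk v q u"
        "infp x = prepend_path p (cycle_path u)"
      by (rule pointsE)
    from xy(2) obtain w' p' q' u' where y: "y = ((w', p'), (v, q'))" "u' \<in> cv" "awalk w' p' u'" "awalk v q' u'"
        "infp y = prepend_path p' (cycle_path u')" "\<not> (p' \<noteq> [] \<and> q' \<noteq> [] \<and> last p' = last q')"
      by (rule pointsE)
    have "length p \<le> length p'" using xy(5) x(1) y(1) by simp
    then obtain r where r: "p' = p @ r" "cycle_path u = prepend_path r (cycle_path u')"
      using xy(3) x(5) y(5) prepend_path_eqD[of p "cycle_path u" p' "cycle_path u'"] by auto
    have lq: "length q' = length q + length r"
      using xy(4) r(1) by (simp add: x(1) y(1))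
    \<comment> \<open>Both \<open>q\<close> and \<open>q'\<close> are initial pieces of the one
      infinite path around \<open>c\<close> from \<open>v\<close>, so the longer one extends the
      shorter.\<close>
    have "prepend_path q (cycle_path u) = prepend_path q' (cycle_path u')"
      using prepend_cycle_path[OF x(4) v_in_cv x(2)] prepend_cycle_path[OF y(4) v_in_cv y(2)] by simp
    then obtain r' where r': "q' = q @ r'" "cycle_path u = prepend_path r' (cycle_path u')"
      using lq prepend_path_eqD[of q "cycle_path u" q' "cycle_path u'"] by auto
    have "length r = length r'" using lq r' by simp
    moreover have "prepend_path r (cycle_path u') = prepend_path r' (cycle_path u')"
      using r r' by simp
    ultimately have "r = r'" using prepend_path_eqD by fastforce
    have "r = []"
    proof (rule ccontr)
      assume "r \<noteq> []"
      then have "p' \<noteq> []" "q' \<noteq> []" "last p' = last q'"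
        using \<open>r = r'\<close> r(1) r'(1) by simp_all
      then show False using y(6) by simp
    qed
    moreover have "w = w'"
      using infp_0(2)[OF xy(1)] infp_0(2)[OF xy(2)] xy(3) x(1) y(1) by simp
    ultimately show ?thesis using \<open>r = r'\<close> r r' x(1) y(1) by simp
  qed
  show ?thesis
    using le[of x y] le[of y x] assms by (cases "length (snd (fst x)) \<le> length (snd (fst y))") auto
qed

lemma Cons_in_cycle_words:
  assumes "e \<in> arcs G" "((head G e, p), y) \<in> cycle_words G c v"
  shows "((tail G e, e # p), y) \<in> cycle_words G c v"
  using assms by (cases y) (auto simp: cycle_words_iff awalk_Cons_iff)

lemma infp_Cons:
  "infp ((tail G e, e # p), y) = case_nat e (infp ((head G e, p), y))"
  by simp

lemma edge_map_props:
  assumes "e \<in> arcs G" "x \<in> vert_part N (head G e)"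
  shows "edge_map N e x \<in> points N" "infp (edge_map N e x) = case_nat e (infp x)"
    "word_degree (edge_map N e x) = word_degree x + 1" "edge_map N e x \<in> edge_part N e"
proof -
  from assms(2) have xw: "x \<in> cycle_words G c v" "fst (fst x) = head G e"
    unfolding vert_part_N points_N by auto
  from xw(1) obtain w' p q u where x': "x = ((w', p), (v, q))" by (rule cycle_wordsE)
  then have x: "x = ((head G e, p), (v, q))" "x \<in> cycle_words G c v"
    using xw by simp_all
  have w: "((tail G e, e # p), (v, q)) \<in> cycle_words G c v"
    using x assms(1) Cons_in_cycle_words by blast
  have eq: "edge_map N e x = red ((tail G e, e # p), (v, q))"
    by (simp add: x edge_map_N)
  show "edge_map N e x \<in> points N" "infp (edge_map N e x) = case_nat e (infp x)"
    "word_degree (edge_map N e x) = word_degree x + 1"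
    unfolding eq using red_in_points[OF w] infp_red[OF w] degree_red[OF w]
    by (simp_all add: x(1) del: word_path.simps add: infp_Cons)
  show "edge_map N e x \<in> edge_part N e"
    unfolding eq using w by (auto simp: cycle_branching_def)
qed

lemma edge_part_iff:
  assumes "e \<in> arcs G"
  shows "x \<in> edge_part N e \<longleftrightarrow> x \<in> points N \<and> infp x 0 = e"
proof
  assume "x \<in> edge_part N e"
  then obtain r s where "x = red ((tail G e, e # r), s)" "((tail G e, e # r), s) \<in> cycle_words G c v"
    by (auto simp: cycle_branching_def)
  then show "x \<in> points N \<and> infp x 0 = e"
    using red_in_points infp_red by (cases s) simp
next
  assume x: "x \<in> points N \<and> infp x 0 = e"
  then have "x \<in> points N" by simp
  then obtain w p q u where xpq: "x = ((w, p), (v, q))" "u \<in> cv" "awalk w p u" "awalk v q u"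
      "infp x = prepend_path p (cycle_path u)"
    by (rule pointsE)
  show "x \<in> edge_part N e"
  proof (cases p)
    case (Cons f p')
    then have "f = e" using x xpq(5) by simp
    then have "w = tail G e" using xpq(3) Cons by (simp add: awalk_Cons_iff)
    have "x \<in> cycle_words G c v" "reduced x"
      using \<open>x \<in> points N\<close> unfolding points_N by simp_all
    moreover from this(2) have "red x = x" by (rule red_reduced)
    ultimately have "((tail G e, e # p'), (v, q)) \<in> cycle_words G c v"
        "x = red ((tail G e, e # p'), (v, q))"
      using xpq(1) Cons \<open>f = e\<close> \<open>w = tail G e\<close> by simp_all
    then show ?thesis
      by (auto simp: cycle_branching_def simp del: red.simps)
  next
    \<comment> \<open>For empty \<open>p\<close> no edge of the word is visible, but the word has
      the unreduced form \<open>e(qe)\<^sup>*\<close> with \<open>e\<close> the edge of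
      \<open>c\<close> at its source.\<close>
    case Nil
    then have u: "w = u" "e = next_edge u" using xpq x by (auto simp: awalk_Nil_iff)
    then have e: "tail G e = u" "head G e \<in> cv" "e \<in> arcs G" using next_edge[OF xpq(2)] by auto
    then have "awalk u [e] (head G e)" "awalk v (q @ [e]) (head G e)"
      using xpq(4) by (auto simp: awalk_simps intro!: awalk_appendI[OF xpq(4)])
    then have "((u, [e]), (v, q @ [e])) \<in> cycle_words G c v"
      using e by (auto simp: cycle_words_iff)
    moreover have "red ((u, [e]), (v, q @ [e])) = x"
      using xpq(1) Nil u by (simp add: red.simps)
    ultimately show ?thesis using e(1) by (auto simp: cycle_branching_def)
  qed
qed

text \<open>The preimage of the reduction of \<open>er\<close> and \<open>s\<close> is the reduction
  of \<open>r\<close> and \<open>s\<close>. That its image is \<open>y\<close> follows from equal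
  path and degree, so the two reductions are never compared step by step.\<close>

lemma edge_map_surj:
  assumes "e \<in> arcs G" "y \<in> edge_part N e"
  shows "\<exists>x\<in>vert_part N (head G e). edge_map N e x = y"
proof -
  from assms(2) obtain r s where y: "y = red ((tail G e, e # r), s)" "((tail G e, e # r), s) \<in> cycle_words G c v"
    by (auto simp: cycle_branching_def)
  then have w: "((head G e, r), s) \<in> cycle_words G c v"
    by (cases s) (auto simp: cycle_words_iff awalk_Cons_iff)
  let ?x = "red ((head G e, r), s)"
  have x: "?x \<in> vert_part N (head G e)"
    using red_in_points[OF w] source_red[OF w] by (simp add: vert_part_N)
  have "edge_map N e ?x = y"
  proof (rule infp_degree_inject)
    show "edge_map N e ?x \<in> points N" by (rule edge_map_props[OF assms(1) x])
    show "y \<in> points N" unfolding y(1) by (rule red_in_points[OF y(2)])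
    show "infp (edge_map N e ?x) = infp y"
      unfolding edge_map_props(2)[OF assms(1) x] infp_red[OF w] y(1) infp_red[OF y(2)]
      by (simp only: infp_Cons)
    show "word_degree (edge_map N e ?x) = word_degree y"
      unfolding edge_map_props(3)[OF assms(1) x] degree_red[OF w] y(1) degree_red[OF y(2)]
      by (cases s) simp
  qed
  with x show ?thesis by blast
qed

sublocale branching_system G N
proof
  show "vert_part N w \<subseteq> points N" for w
    by (auto simp: vert_part_N)
  show "v = w" if "x \<in> vert_part N v" "x \<in> vert_part N w" for x v w
    using that by (simp add: vert_part_N)
  show "e = f" if "x \<in> edge_part N e" "x \<in> edge_part N f" "e \<in> arcs G" "f \<in> arcs G" for x e f
    using that by (simp add: edge_part_iff)
  show "edge_part N e \<subseteq> vert_part N (tail G e)" if "e \<in> arcs G" for e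
    using that by (auto simp: edge_part_iff vert_part_iff)
  show "bij_betw (edge_map N e) (vert_part N (head G e)) (edge_part N e)" if e: "e \<in> arcs G" for e
  proof (rule bij_betwI')
    fix x y assume xy: "x \<in> vert_part N (head G e)" "y \<in> vert_part N (head G e)"
    show "edge_map N e x = edge_map N e y \<longleftrightarrow> x = y"
    proof
      assume eq: "edge_map N e x = edge_map N e y"
      show "x = y"
      proof (rule infp_degree_inject)
        show "infp x = infp y"
          using eq edge_map_props(2)[OF e xy(1)] edge_map_props(2)[OF e xy(2)] by simp
        show "word_degree x = word_degree y"
          using eq edge_map_props(3)[OF e xy(1)] edge_map_props(3)[OF e xy(2)] by simp
      qed (use xy in \<open>simp_all add: vert_part_N\<close>)
    qed simp
  next
    show "edge_map N e x \<in> edge_part N e" if "x \<in> vert_part N (head G e)" for x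
      using edge_map_props(4)[OF e that] .
    show "\<exists>x\<in>vert_part N (head G e). y = edge_map N e x" if "y \<in> edge_part N e" for y
      using edge_map_surj[OF e that] by metis
  qed
  \<comment> \<open>This holds at every vertex, regular or not, since the infinite path of a point
    always has a first edge.\<close>
  show "vert_part N u \<subseteq> (\<Union>e\<in>out_arcs G u. edge_part N e)" for u
  proof
    fix x assume "x \<in> vert_part N u"
    then have "x \<in> points N" "fst (fst x) = u" by (auto simp: vert_part_N)
    then show "x \<in> (\<Union>e\<in>out_arcs G u. edge_part N e)"
      using infp_0[of x] by (auto simp: edge_part_iff intro!: bexI[of _ "infp x 0"])
  qed
qed

definition base_word :: "('a, 'b) path \<times> ('a, 'b) path" where
  "base_word = ((v, []), (v, []))"

lemma base_word: "base_word \<in> points N" "infp base_word = cycle_path v" "word_degree base_word = 0"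
  "base_word \<in> vert_part N v"
proof -
  have "v \<in> verts G" using v_in_cv cv_verts by blast
  then have "base_word \<in> cycle_words G c v"
    unfolding base_word_def cycle_words_iff using v_in_cv by (simp add: awalk_Nil_iff)
  then show "base_word \<in> points N" "base_word \<in> vert_part N v"
    by (simp_all add: vert_part_N points_N base_word_def)
qed (simp_all add: base_word_def)

text \<open>Every reduced word is reached from the trivial one by first lengthening \<open>q\<close>
  and then \<open>p\<close>. Lengthening \<open>q\<close> by \<open>e\<close> is inverse to
  \<open>edge_map N e\<close>, because \<open>e(qe)\<^sup>*\<close> reduces to
  \<open>q\<^sup>*\<close>; so the induction also has to run backwards along edges.\<close>

lemma points_induct [consumes 1, case_names base edge inverse_edge]:
  assumes x: "x \<in> points N"
    and base: "P base_word"
    and edge: "\<And>e x. \<lbrakk>e \<in> arcs G; x \<in> vert_part N (head G e); P x\<rbrakk> \<Longrightarrow> P (edge_map N e x)"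
    and inverse: "\<And>e x. \<lbrakk>e \<in> arcs G; x \<in> vert_part N (head G e); P (edge_map N e x)\<rbrakk> \<Longrightarrow> P x"
  shows "P x"
proof -
  have ghost: "P ((u, []), (v, q))" if "awalk v q u" "u \<in> cv" for q u
    using that
  proof (induction q arbitrary: u rule: rev_induct)
    case Nil
    then have "u = v" by (simp add: awalk_Nil_iff)
    then show ?case using base by (simp add: base_word_def)
  next
    case (snoc e q)
    then have e: "awalk v q (tail G e)" "head G e = u" "e \<in> arcs G"
      by (auto simp: awalk_simps)
    have "e \<in> set c" using path_in_cycle_edges[OF snoc.prems(1) v_in_cv snoc.prems(2)] by simp
    then have IH: "P ((tail G e, []), (v, q))" using snoc.IH[OF e(1)] tail_in_cv by simp
    have "((u, []), (v, q @ [e])) \<in> vert_part N (head G e)"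
      using e snoc.prems awalk_last_in_verts
      by (auto simp: vert_part_N points_N cycle_words_iff awalk_Nil_iff)
    moreover have "edge_map N e ((u, []), (v, q @ [e])) = ((tail G e, []), (v, q))"
      by (simp add: edge_map_N red.simps)
    ultimately show ?case using IH inverse e(3) by metis
  qed
  have "P ((w, p), (v, q))" if "((w, p), (v, q)) \<in> points N" for w p q
    using that
  proof (induction p arbitrary: w)
    case Nil
    then show ?case using ghost by (auto simp: points_N cycle_words_iff awalk_Nil_iff)
  next
    case (Cons e p)
    then obtain u where u: "u \<in> cv" "awalk w (e # p) u" "awalk v q u"
      by (auto simp: points_N cycle_words_iff)
    then have e: "e \<in> arcs G" "w = tail G e" "awalk (head G e) p u" by (auto simp: awalk_Cons_iff)
    have "reduced ((head G e, p), (v, q))"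
      using Cons.prems by (auto simp: points_N)
    then have x: "((head G e, p), (v, q)) \<in> points N" using u e by (auto simp: points_N cycle_words_iff)
    moreover have "edge_map N e ((head G e, p), (v, q)) = ((w, e # p), (v, q))"
      using Cons.prems e(2) by (simp add: edge_map_N red_reduced points_N del: reduced.simps)
    ultimately show ?case
      using edge[OF e(1), of "((head G e, p), (v, q))"] Cons.IH[OF x] by (simp add: vert_part_N)
  qed
  moreover from x obtain w p q where "x = ((w, p), (v, q))" by (rule pointsE)
  ultimately show ?thesis using x by blast
qed

lemma vert_part_nonempty_iff: "vert_part N w \<noteq> {} \<longleftrightarrow> w \<in> R"
proof
  assume "vert_part N w \<noteq> {}"
  then obtain x where "x \<in> vert_part N w" by blast
  then have x: "x \<in> points N" "fst (fst x) = w" unfolding vert_part_N by simp_all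
  from x(1) obtain w' p q u where "x = ((w', p), (v, q))" "u \<in> cv" "awalk w' p u"
    by (rule pointsE)
  with x(2) show "w \<in> R" unfolding in_R_iff by auto
next
  assume "w \<in> R"
  then obtain u p where u: "u \<in> cv" "awalk w p u" unfolding in_R_iff by blast
  obtain q where "awalk v q u" by (rule cv_path[OF v_in_cv u(1)])
  with u have w: "((w, p), (v, q)) \<in> cycle_words G c v" unfolding cycle_words_iff by blast
  have "red ((w, p), (v, q)) \<in> vert_part N w"
    using red_in_points[OF w] source_red[OF w] by (simp add: vert_part_N)
  then show "vert_part N w \<noteq> {}" by blast
qed

end

section \<open>Isomorphisms of branching systems\<close>

lemma abelian_group_iso_zero:
  assumes "abelian_group M" "abelian_group N" "h ` carrier M \<subseteq> carrier N"
    and "\<forall>x\<in>carrier M. \<forall>y\<in>carrier M. h (x \<oplus>\<^bsub>M\<^esub> y) = h x \<oplus>\<^bsub>N\<^esub> h y"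
  shows "h \<zero>\<^bsub>M\<^esub> = \<zero>\<^bsub>N\<^esub>"
proof -
  interpret M: abelian_group M by fact
  interpret N: abelian_group N by fact
  have "h \<zero>\<^bsub>M\<^esub> \<in> carrier N" using assms(3) by auto
  moreover have "h \<zero>\<^bsub>M\<^esub> \<oplus>\<^bsub>N\<^esub> h \<zero>\<^bsub>M\<^esub> = h \<zero>\<^bsub>M\<^esub>"
    using assms(4) by (metis M.l_zero M.zero_closed)
  ultimately show ?thesis by simp
qed

lemma isomorphic_annihilator_eq:
  assumes "left_module A M" "left_module A N" "isomorphic A M N"
  shows "annihilator A M = annihilator A N"
proof -
  obtain h where h: "module_iso A M N h" using assms(3) by (auto simp: isomorphic_def)
  have M: "\<And>a x. a \<in> carrier A \<Longrightarrow> x \<in> carrier M \<Longrightarrow> a \<odot>\<^bsub>M\<^esub> x \<in> carrier M" "abelian_group M"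
    using assms(1) by (auto simp: left_module_def)
  have bij: "bij_betw h (carrier M) (carrier N)"
    and smult: "\<And>a x. a \<in> carrier A \<Longrightarrow> x \<in> carrier M \<Longrightarrow> h (a \<odot>\<^bsub>M\<^esub> x) = a \<odot>\<^bsub>N\<^esub> h x"
    using h by (auto simp: module_iso_def)
  have z: "h \<zero>\<^bsub>M\<^esub> = \<zero>\<^bsub>N\<^esub>"
    using assms h by (intro abelian_group_iso_zero) (auto simp: left_module_def module_iso_def bij_betw_def)
  have zM: "\<zero>\<^bsub>M\<^esub> \<in> carrier M"
    using M(2) by (simp add: abelian_group_def abelian_monoid.zero_closed)
  have "(a \<odot>\<^bsub>M\<^esub> x = \<zero>\<^bsub>M\<^esub>) \<longleftrightarrow> (a \<odot>\<^bsub>N\<^esub> h x = \<zero>\<^bsub>N\<^esub>)" if "a \<in> carrier A" "x \<in> carrier M" for a x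
    using smult[OF that] z bij M(1)[OF that] zM by (metis bij_betw_imp_inj_on inj_onD)
  moreover have "carrier N = h ` carrier M" using bij by (simp add: bij_betw_def)
  ultimately show ?thesis
    unfolding annihilator_def by auto
qed

definition point_vec :: "'k::zero \<Rightarrow> 'x \<Rightarrow> 'x \<Rightarrow> 'k" where
  "point_vec k x = (\<lambda>y. if y = x then k else 0)"

locale field_branching = branching_system G Y
  for K :: "'k::field itself" and G :: "('v, 'e) pre_digraph" and Y :: "('v, 'e, 'x) branching"
begin

sublocale weighted_branching "ring_of_type_algebra :: 'k ring" "\<lambda>k. k" G Y "\<lambda>_. 1"
  "branching_action G Y ring_of_type_algebra"
proof -
  interpret cring "ring_of_type_algebra :: 'k ring" by (rule cring_from_type_algebra)
  show "weighted_branching (ring_of_type_algebra :: 'k ring) (\<lambda>k. k) G Y (\<lambda>_. 1)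
      (branching_action G Y ring_of_type_algebra)"
    by unfold_locales (auto simp: scale_vec_def)
qed

abbreviation act_on :: "('v, 'e, 'k) free_elem \<Rightarrow> ('x \<Rightarrow> 'k) \<Rightarrow> 'x \<Rightarrow> 'k" (infixr "\<bullet>" 70) where
  "a \<bullet> m \<equiv> free_action ring_of_type_algebra (\<lambda>k. k) act a m"

lemma the_module_eq: "the_module = branching_module K G Y"
  by (simp add: the_module_def branching_module_def)

lemma V_iff: "m \<in> V \<longleftrightarrow> finite {x. m x \<noteq> 0} \<and> (\<forall>x. m x \<noteq> 0 \<longrightarrow> x \<in> points Y)"
  by (simp add: free_carrier_def)

lemma zero_vec_eq: "zero_vec (ring_of_type_algebra :: 'k ring) = (\<lambda>_. 0)"
  by (simp add: zero_vec_def)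

lemma add_vec_eq: "add_vec m n = (\<lambda>x. m x + n x)"
  by (simp add: add_vec_def)

lemma scale_vec_eq: "scale_vec (ring_of_type_algebra :: 'k ring) a m = (\<lambda>x. a * m x)"
  by (simp add: scale_vec_def)

lemma basis_vec_eq: "basis_vec (ring_of_type_algebra :: 'k ring) x = point_vec 1 x"
  by (simp add: basis_vec_def point_vec_def cong: if_cong)

lemma monomial_vec_eq:
  "monomial_vec k y = (case y of None \<Rightarrow> \<lambda>_. 0 | Some z \<Rightarrow> point_vec k z)"
  by (cases y) (auto simp: zero_vec_eq scale_vec_eq basis_vec_eq point_vec_def)

lemma word_weight_eq [simp]: "word_weight gs = 1"
  by (induction gs) auto

lemma point_vec_closed [intro, simp]: "x \<in> points Y \<Longrightarrow> point_vec k x \<in> V"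
  by (auto simp: V_iff point_vec_def intro: rev_finite_subset[of "{x}"])

lemma single_apply_point:
  assumes "x \<in> points Y"
  shows "Poly_Mapping.single (NC_Word gs) k \<bullet> point_vec 1 x =
    (case word_map gs x of None \<Rightarrow> \<lambda>_. 0 | Some z \<Rightarrow> point_vec k z)"
  using single_apply_basis[OF assms, of gs k] by (simp add: basis_vec_eq monomial_vec_eq)

lemma lin_map_expand:
  assumes T: "lin_map (points Y) T B" and m: "m \<in> V"
  shows "T m y = (\<Sum>x\<in>{x. m x \<noteq> 0}. m x * T (point_vec 1 x) y)"
  using m
proof (induction rule: free_carrier_induct)
  case zero
  then show ?case using lin_map_zero[OF T] by (simp add: zero_vec_eq)
next
  case (add x a m)
  let ?n = "add_vec (scale_vec ring_of_type_algebra a (basis_vec ring_of_type_algebra x)) m"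
  have bx: "basis_vec ring_of_type_algebra x \<in> V" using add(1) by (rule basis_vec_closed)
  have n: "?n = (\<lambda>z. (if z = x then a else 0) + m z)"
    by (auto simp: add_vec_eq scale_vec_eq basis_vec_eq point_vec_def)
  have "?n \<in> V" using add by simp
  \<comment> \<open>Adding a multiple of a basis vector may cancel the coordinate at
    \<open>x\<close>, so a set is taken that contains both supports and \<open>x\<close>.\<close>
  let ?A = "insert x ({z. m z \<noteq> 0} \<union> {z. ?n z \<noteq> 0})"
  have A: "finite ?A"
    using add(3) \<open>?n \<in> V\<close> by (simp add: V_iff)
  have "T ?n y = a * T (point_vec 1 x) y + T m y"
    using add bx by (simp add: lin_mapD[OF T] basis_vec_eq[symmetric])
      (simp add: add_vec_eq scale_vec_eq)
  also have "T m y = (\<Sum>z\<in>{z. m z \<noteq> 0}. m z * T (point_vec 1 z) y)"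
    by (rule add(4))
  also have "\<dots> = (\<Sum>z\<in>?A. m z * T (point_vec 1 z) y)"
    using A by (intro sum.mono_neutral_left) auto
  also have "a * T (point_vec 1 x) y = (\<Sum>z\<in>?A. (if z = x then a else 0) * T (point_vec 1 z) y)"
  proof -
    have "(\<Sum>z\<in>?A. (if z = x then a else 0) * T (point_vec 1 z) y) =
        (\<Sum>z\<in>?A. if z = x then a * T (point_vec 1 z) y else 0)"
      by (rule sum.cong) auto
    then show ?thesis using A by (simp only: sum.delta) simp
  qed
  also have "\<dots> + (\<Sum>z\<in>?A. m z * T (point_vec 1 z) y) = (\<Sum>z\<in>?A. ?n z * T (point_vec 1 z) y)"
    by (simp only: sum.distrib[symmetric] n distrib_right)
  also have "\<dots> = (\<Sum>z\<in>{z. ?n z \<noteq> 0}. ?n z * T (point_vec 1 z) y)"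
    using A by (intro sum.mono_neutral_right) auto
  finally show ?case .
qed

lemmas apply_expand = lin_map_expand[OF lin_map_free_action]

lemma single_apply:
  assumes m: "m \<in> V"
  shows "(Poly_Mapping.single (NC_Word gs) k \<bullet> m) y =
    (\<Sum>x\<in>{x. m x \<noteq> 0}. if word_map gs x = Some y then m x * k else 0)"
proof -
  have "(Poly_Mapping.single (NC_Word gs) k \<bullet> m) y =
      (\<Sum>x\<in>{x. m x \<noteq> 0}. m x * (Poly_Mapping.single (NC_Word gs) k \<bullet> point_vec 1 x) y)"
    by (rule apply_expand[OF m])
  also have "\<dots> = (\<Sum>x\<in>{x. m x \<noteq> 0}. if word_map gs x = Some y then m x * k else 0)"
  proof (rule sum.cong[OF refl])
    fix x assume "x \<in> {x. m x \<noteq> 0}"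
    then have "x \<in> points Y" using m by (simp add: V_iff)
    then show "m x * (Poly_Mapping.single (NC_Word gs) k \<bullet> point_vec 1 x) y =
        (if word_map gs x = Some y then m x * k else 0)"
      by (simp add: single_apply_point split: option.split) (auto simp: point_vec_def)
  qed
  finally show ?thesis .
qed

lemma nontrivial_action_the_module:
  assumes "w \<in> verts G" "x \<in> vert_part Y w"
  shows "nontrivial_action (leavitt K G) the_module"
proof -
  have x: "x \<in> points Y" using assms vert_part_subset by blast
  have "gn (Vert w) \<bullet> basis_vec ring_of_type_algebra x = point_vec (1::'k) x"
    using assms x by (simp add: gn_apply_basis monomial_vec_eq)
  then have "gn (Vert w) \<bullet> basis_vec ring_of_type_algebra x \<noteq> zero_vec (ring_of_type_algebra :: 'k ring)"
    by (simp add: zero_vec_eq point_vec_def fun_eq_iff)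
  moreover have "gn (Vert w) \<in> lpa_reps K G"
    using assms(1) by (intro lpa_reps_gn) simp
  ultimately show ?thesis
    unfolding nontrivial_action_def
    by (intro bexI[of _ "lpa_class K G (gn (Vert w))"] bexI[of _ "basis_vec ring_of_type_algebra x"])
      (use x in \<open>auto simp: carrier_leavitt lpa_reps_carrier\<close>)
qed

lemma submodule_the_moduleI:
  assumes "N \<subseteq> V" "zero_vec ring_of_type_algebra \<in> N"
    and "\<And>m n. m \<in> N \<Longrightarrow> n \<in> N \<Longrightarrow> add_vec m n \<in> N"
    and "\<And>m. m \<in> N \<Longrightarrow> (\<lambda>x. - m x) \<in> N"
    and "\<And>a m. a \<in> lpa_reps K G \<Longrightarrow> m \<in> N \<Longrightarrow> a \<bullet> m \<in> N"
  shows "submodule N (leavitt K G) the_module"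
proof -
  interpret M: abelian_group the_module by (rule abelian_group_the_module)
  have neg: "\<ominus>\<^bsub>the_module\<^esub> m = (\<lambda>x. - m x)" if "m \<in> N" for m
    using assms(1,4) that by (intro M.minus_equality) (auto simp: add_vec_eq zero_vec_eq)
  show ?thesis
  proof (intro submodule.intro submodule_axioms.intro M.add.subgroupI)
    fix a m assume "a \<in> carrier (leavitt K G)" "m \<in> N"
    then show "a \<odot>\<^bsub>the_module\<^esub> m \<in> N"
      using assms(1,5) by (auto simp: carrier_leavitt lpa_reps_carrier)
  qed (use assms neg in \<open>auto simp flip: a_inv_def\<close>)
qed

lemma submodule_the_moduleD:
  assumes "submodule N (leavitt K G) the_module"
  shows "N \<subseteq> V" "zero_vec ring_of_type_algebra \<in> N"
    "m \<in> N \<Longrightarrow> n \<in> N \<Longrightarrow> add_vec m n \<in> N"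
    "a \<in> lpa_reps K G \<Longrightarrow> m \<in> N \<Longrightarrow> a \<bullet> m \<in> N"
proof -
  interpret subgroup N "add_monoid the_module" using assms by (rule submodule.axioms)
  show sub: "N \<subseteq> V" using subset by simp
  show "zero_vec ring_of_type_algebra \<in> N" using one_closed by simp
  show "m \<in> N \<Longrightarrow> n \<in> N \<Longrightarrow> add_vec m n \<in> N" using m_closed[of m n] by simp
  show "a \<bullet> m \<in> N" if "a \<in> lpa_reps K G" "m \<in> N"
  proof -
    have "lpa_class K G a \<odot>\<^bsub>the_module\<^esub> m \<in> N"
      using that by (intro submodule.smult_closed[OF assms]) (auto simp: carrier_leavitt)
    moreover have "m \<in> V" using sub that by blast
    ultimately show ?thesis using that by (simp add: lpa_reps_carrier)
  qed
qed

end

locale branching_iso = Y1: field_branching K G Y + Y2: field_branching K G Y'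
  for K :: "'k::field itself" and G :: "('v, 'e) pre_digraph"
    and Y :: "('v, 'e, 'x) branching" and Y' :: "('v, 'e, 'y) branching" +
  fixes \<theta> :: "'x \<Rightarrow> 'y"
  assumes \<theta>_bij: "bij_betw \<theta> (points Y) (points Y')"
    and \<theta>_vert: "\<lbrakk>w \<in> verts G; x \<in> points Y\<rbrakk> \<Longrightarrow> \<theta> x \<in> vert_part Y' w \<longleftrightarrow> x \<in> vert_part Y w"
    and \<theta>_edge: "\<lbrakk>e \<in> arcs G; x \<in> points Y\<rbrakk> \<Longrightarrow> \<theta> x \<in> edge_part Y' e \<longleftrightarrow> x \<in> edge_part Y e"
    and \<theta>_map: "\<lbrakk>e \<in> arcs G; x \<in> vert_part Y (head G e)\<rbrakk> \<Longrightarrow> edge_map Y' e (\<theta> x) = \<theta> (edge_map Y e x)"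
begin

lemma \<theta>_closed: "x \<in> points Y \<Longrightarrow> \<theta> x \<in> points Y'"
  using \<theta>_bij bij_betwE by blast

text \<open>Compatibility is assumed for vertices and edges. For a ghost, \<open>\<theta>\<close>
  carries the preimage of \<open>x\<close> to a preimage of \<open>\<theta> x\<close>, and
  injectivity of the edge map of \<open>Y'\<close> leaves no other.\<close>

lemma partial_action_\<theta>:
  assumes "x \<in> points Y"
  shows "Y2.partial_action g (\<theta> x) = map_option \<theta> (Y1.partial_action g x)"
proof (cases g)
  case (Vert w)
  then show ?thesis using \<theta>_vert assms by auto
next
  case (Edge e)
  then show ?thesis using \<theta>_vert[of "head G e" x] \<theta>_map[of e x] assms by auto
next
  case (Ghost e)
  show ?thesis
  proof (cases "e \<in> arcs G \<and> x \<in> edge_part Y e")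
    case True
    define z where "z = inv_into (vert_part Y (head G e)) (edge_map Y e) x"
    have z: "z \<in> vert_part Y (head G e)" "edge_map Y e z = x"
      using True Y1.inv_edge_map_in Y1.edge_map_inv by (auto simp: z_def)
    have "head G e \<in> verts G" using True by simp
    then have "\<theta> z \<in> vert_part Y' (head G e)"
      using z(1) \<theta>_vert Y1.vert_part_subset by blast
    moreover have "edge_map Y' e (\<theta> z) = \<theta> x"
      using \<theta>_map[of e z] z True by simp
    ultimately have "inv_into (vert_part Y' (head G e)) (edge_map Y' e) (\<theta> x) = \<theta> z"
      using Y2.inv_edge_map[of e "\<theta> z"] True by simp
    then show ?thesis using True Ghost assms \<theta>_edge by (simp add: z_def)
  next
    case False
    then show ?thesis using Ghost assms \<theta>_edge by auto
  qed
qed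

lemma word_map_\<theta>:
  assumes "x \<in> points Y"
  shows "Y2.word_map gs (\<theta> x) = map_option \<theta> (Y1.word_map gs x)"
proof (induction gs)
  case (Cons g gs)
  show ?case
  proof (cases "Y1.word_map gs x")
    case (Some y)
    then have "y \<in> points Y" using assms Y1.word_map_closed by blast
    then show ?thesis using Cons Some by (simp add: partial_action_\<theta>)
  qed (use Cons in simp)
qed simp

text \<open>The linear extension of \<open>\<theta>\<close>, written as composition with the inverse
  bijection so that no sums occur.\<close>

definition push :: "('x \<Rightarrow> 'k) \<Rightarrow> 'y \<Rightarrow> 'k" where
  "push m = (\<lambda>y. if y \<in> points Y' then m (inv_into (points Y) \<theta> y) else 0)"

lemma inv_\<theta>: "x \<in> points Y \<Longrightarrow> inv_into (points Y) \<theta> (\<theta> x) = x"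
  using \<theta>_bij bij_betw_inv_into_left by metis

lemma \<theta>_inv: "y \<in> points Y' \<Longrightarrow> \<theta> (inv_into (points Y) \<theta> y) = y"
  "y \<in> points Y' \<Longrightarrow> inv_into (points Y) \<theta> y \<in> points Y"
  using \<theta>_bij by (metis bij_betw_inv_into_right, metis bij_betw_imp_surj_on inv_into_into)

lemma push_\<theta>: "x \<in> points Y \<Longrightarrow> push m (\<theta> x) = m x"
  by (simp add: push_def \<theta>_closed inv_\<theta>)

lemma push_nonzeroE:
  assumes "push m y \<noteq> 0"
  obtains x where "x \<in> points Y" "y = \<theta> x" "m x \<noteq> 0"
  using assms that[of "inv_into (points Y) \<theta> y"] \<theta>_inv[of y] unfolding push_def by (auto split: if_splits)

lemma push_closed: "m \<in> Y1.V \<Longrightarrow> push m \<in> Y2.V"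
proof -
  assume m: "m \<in> Y1.V"
  have "{y. push m y \<noteq> 0} \<subseteq> \<theta> ` {x. m x \<noteq> 0}"
    by (auto elim: push_nonzeroE)
  then have "finite {y. push m y \<noteq> 0}"
    by (rule finite_subset) (use m Y1.V_iff in auto)
  then show ?thesis unfolding Y2.V_iff by (auto simp: push_def)
qed

lemma push_point: "x \<in> points Y \<Longrightarrow> push (point_vec k x) = point_vec k (\<theta> x)"
  by (rule ext) (auto simp: push_def point_vec_def inv_\<theta> \<theta>_closed \<theta>_inv)

lemma lin_map_push: "Y1.lin_map (points Y) push (points Y')"
  unfolding Y1.lin_map_def
  by (auto simp: push_closed Y1.add_vec_eq Y1.scale_vec_eq) (auto simp: push_def)

lemma push_apply:
  assumes "m \<in> Y1.V"
  shows "push (free_action ring_of_type_algebra (\<lambda>k. k) Y1.act a m) =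
    free_action ring_of_type_algebra (\<lambda>k. k) Y2.act a (push m)"
proof (rule Y1.lin_map_eqI[OF _ _ assms])
  show "Y1.lin_map (points Y) (\<lambda>m. push (free_action ring_of_type_algebra (\<lambda>k. k) Y1.act a m)) (points Y')"
    by (rule Y1.lin_map_comp[OF Y1.lin_map_free_action lin_map_push])
  show "Y1.lin_map (points Y) (\<lambda>m. free_action ring_of_type_algebra (\<lambda>k. k) Y2.act a (push m)) (points Y')"
    by (rule Y1.lin_map_comp[OF lin_map_push Y2.lin_map_free_action])
  fix x assume x: "x \<in> points Y"
  show "push (free_action ring_of_type_algebra (\<lambda>k. k) Y1.act a (basis_vec ring_of_type_algebra x)) =
      free_action ring_of_type_algebra (\<lambda>k. k) Y2.act a (push (basis_vec ring_of_type_algebra x))"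
    unfolding Y1.basis_vec_eq push_point[OF x]
  proof (induction a rule: poly_mapping_single_induct)
    case (single w k)
    obtain gs where w: "w = NC_Word gs" by (cases w)
    have zero: "push (\<lambda>_. 0) = (\<lambda>_. 0)" by (auto simp: push_def)
    show ?case
      unfolding w Y1.single_apply_point[OF x] Y2.single_apply_point[OF \<theta>_closed[OF x]] word_map_\<theta>[OF x]
      using Y1.word_map_closed[OF x] by (auto split: option.split simp: zero push_point)
  next
    case (add a b)
    then show ?case
      using x \<theta>_closed[OF x]
      by (simp add: Y1.free_action_add Y2.free_action_add Y1.lin_mapD(2)[OF lin_map_push])
  qed
qed

lemma module_iso_push: "module_iso (leavitt K G) (branching_module K G Y) (branching_module K G Y') push"
  unfolding module_iso_def Y1.the_module_eq[symmetric] Y2.the_module_eq[symmetric]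
proof (intro conjI ballI)
  have inj: "inj_on push Y1.V"
  proof (rule inj_onI, rule ext)
    fix m n x assume mn: "m \<in> Y1.V" "n \<in> Y1.V" "push m = push n"
    show "m x = n x"
    proof (cases "x \<in> points Y")
      case True
      then show ?thesis using mn(3) push_\<theta>[of x m] push_\<theta>[of x n] by simp
    next
      case False
      then have "m x = 0" "n x = 0" using mn(1,2) unfolding Y1.V_iff by blast+
      then show ?thesis by simp
    qed
  qed
  have surj: "\<exists>m\<in>Y1.V. push m = n" if n: "n \<in> Y2.V" for n
  proof -
    define m where "m = (\<lambda>x. if x \<in> points Y then n (\<theta> x) else 0)"
    have "inj_on \<theta> {x. m x \<noteq> 0}"
      using \<theta>_bij unfolding bij_betw_def m_def by (auto intro: inj_on_subset)
    moreover have "\<theta> ` {x. m x \<noteq> 0} \<subseteq> {y. n y \<noteq> 0}" by (auto simp: m_def split: if_splits)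
    moreover have "finite {y. n y \<noteq> 0}" using n unfolding Y2.V_iff by blast
    ultimately have "finite {x. m x \<noteq> 0}" by (meson finite_imageD finite_subset)
    then have "m \<in> Y1.V" unfolding Y1.V_iff by (auto simp: m_def)
    moreover have "push m = n"
    proof
      fix y
      show "push m y = n y"
        using n \<theta>_inv[of y] unfolding Y2.V_iff by (auto simp: push_def m_def)
    qed
    ultimately show ?thesis by blast
  qed
  show "bij_betw push (carrier Y1.the_module) (carrier Y2.the_module)"
    unfolding bij_betw_def using inj surj push_closed by auto
next
  fix m n assume "m \<in> carrier Y1.the_module" "n \<in> carrier Y1.the_module"
  then show "push (m \<oplus>\<^bsub>Y1.the_module\<^esub> n) = push m \<oplus>\<^bsub>Y2.the_module\<^esub> push n"
    by (simp add: Y1.lin_mapD(2)[OF lin_map_push])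
next
  fix A m assume "A \<in> carrier (leavitt K G)" "m \<in> carrier Y1.the_module"
  then show "push (A \<odot>\<^bsub>Y1.the_module\<^esub> m) = A \<odot>\<^bsub>Y2.the_module\<^esub> push m"
    by (auto simp: carrier_leavitt lpa_reps_carrier push_apply push_closed)
qed

end

declare split_paired_All [simp del] split_paired_Ex [simp del]

section \<open>Action of words in terms of infinite path and degree\<close>

context cycle_word_system begin

text \<open>From here on the edge maps are used only through path and degree, and reduction of words
  disappears from the calculations.\<close>

lemma edge_rel_iff:
  assumes "x \<in> points N" "y \<in> points N" "e \<in> arcs G"
  shows "x \<in> vert_part N (head G e) \<and> edge_map N e x = y \<longleftrightarrow>
    infp y = case_nat e (infp x) \<and> word_degree y = word_degree x + 1"
proof
  assume "x \<in> vert_part N (head G e) \<and> edge_map N e x = y"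
  then show "infp y = case_nat e (infp x) \<and> word_degree y = word_degree x + 1"
    using edge_map_props[OF assms(3)] by blast
next
  assume y: "infp y = case_nat e (infp x) \<and> word_degree y = word_degree x + 1"
  then have "y \<in> edge_part N e" using assms by (simp add: edge_part_iff)
  then obtain z where z: "z \<in> vert_part N (head G e)" "edge_map N e z = y"
    using edge_map_surj[OF assms(3)] by blast
  have "z = x"
  proof (rule infp_degree_inject)
    show "z \<in> points N" using z(1) by (simp add: vert_part_N)
    show "infp z = infp x" "word_degree z = word_degree x"
      using edge_map_props(2,3)[OF assms(3) z(1)] z(2) y by simp_all
  qed (rule assms(1))
  with z show "x \<in> vert_part N (head G e) \<and> edge_map N e x = y" by simp
qed

lemma partial_action_Edge_iff:
  assumes "x \<in> points N" "e \<in> arcs G"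
  shows "partial_action (Edge e) x = Some y \<longleftrightarrow>
    y \<in> points N \<and> infp y = case_nat e (infp x) \<and> word_degree y = word_degree x + 1"
proof -
  have "partial_action (Edge e) x = Some y \<longleftrightarrow> x \<in> vert_part N (head G e) \<and> edge_map N e x = y"
    using assms(2) by simp
  moreover have "y \<in> points N" if "x \<in> vert_part N (head G e) \<and> edge_map N e x = y"
    using that edge_map_props(1)[OF assms(2)] by blast
  ultimately show ?thesis using edge_rel_iff[OF assms(1) _ assms(2)] by blast
qed

lemma partial_action_Ghost_iff:
  assumes "x \<in> points N" "e \<in> arcs G"
  shows "partial_action (Ghost e) x = Some y \<longleftrightarrow>
    y \<in> points N \<and> infp x = case_nat e (infp y) \<and> word_degree x = word_degree y + 1"
proof -
  have "partial_action (Ghost e) x = Some y \<longleftrightarrow> y \<in> vert_part N (head G e) \<and> edge_map N e y = x"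
  proof
    assume "partial_action (Ghost e) x = Some y"
    then show "y \<in> vert_part N (head G e) \<and> edge_map N e y = x"
      using inv_edge_map_in[OF assms(2), of x] edge_map_inv[OF assms(2), of x] assms(2)
      by (auto split: if_splits)
  next
    assume "y \<in> vert_part N (head G e) \<and> edge_map N e y = x"
    then show "partial_action (Ghost e) x = Some y"
      using inv_edge_map[OF assms(2), of y] edge_map_in[OF assms(2), of y] assms(2) by auto
  qed
  moreover have "y \<in> points N" if "y \<in> vert_part N (head G e) \<and> edge_map N e y = x"
    using that by (simp add: vert_part_N)
  ultimately show ?thesis using edge_rel_iff[OF _ assms(1) assms(2)] by blast
qed

lemma word_map_Edges_iff:
  assumes "x \<in> points N" "set p \<subseteq> arcs G"
  shows "word_map (map Edge p) x = Some y \<longleftrightarrow>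
    y \<in> points N \<and> infp y = prepend_path p (infp x) \<and> word_degree y = word_degree x + int (length p)"
  using assms(2)
proof (induction p arbitrary: y)
  case Nil
  then show ?case using assms(1) infp_degree_inject[of x y] by auto
next
  case (Cons e p)
  then have e: "e \<in> arcs G" and IH: "\<And>z. word_map (map Edge p) x = Some z \<longleftrightarrow>
      z \<in> points N \<and> infp z = prepend_path p (infp x) \<and> word_degree z = word_degree x + int (length p)"
    by auto
  have "word_map (map Edge (e # p)) x = Some y \<longleftrightarrow>
      (\<exists>z. word_map (map Edge p) x = Some z \<and> partial_action (Edge e) z = Some y)"
    by (simp add: bind_eq_Some_conv del: partial_action.simps)
  also have "\<dots> \<longleftrightarrow> (\<exists>z\<in>points N. infp z = prepend_path p (infp x) \<and>
      word_degree z = word_degree x + int (length p) \<and>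
      y \<in> points N \<and> infp y = case_nat e (infp z) \<and> word_degree y = word_degree z + 1)"
    unfolding IH using partial_action_Edge_iff[OF _ e] by blast
  also have "\<dots> \<longleftrightarrow> y \<in> points N \<and> infp y = prepend_path (e # p) (infp x) \<and>
      word_degree y = word_degree x + int (length (e # p))" (is "?L \<longleftrightarrow> ?R")
  proof
    assume ?R
    then have "y \<in> edge_part N e" using e by (simp add: edge_part_iff)
    then obtain z where z: "z \<in> vert_part N (head G e)" "edge_map N e z = y"
      using edge_map_surj[OF e] by blast
    then have "z \<in> points N" by (simp add: vert_part_N)
    with z \<open>?R\<close> edge_map_props(2,3)[OF e z(1)] show ?L by (intro bexI[of _ z]) auto
  qed auto
  finally show ?case .
qed

lemma word_map_Ghosts_iff:
  assumes "x \<in> points N" "set p \<subseteq> arcs G"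
  shows "word_map (map Ghost (rev p)) x = Some y \<longleftrightarrow>
    y \<in> points N \<and> infp x = prepend_path p (infp y) \<and> word_degree x = word_degree y + int (length p)"
  using assms
proof (induction p arbitrary: x)
  case Nil
  then show ?case using infp_degree_inject[of x y] word_map_closed[of x "[]" y] by auto
next
  case (Cons e p)
  then have e: "e \<in> arcs G" and IH: "\<And>z. z \<in> points N \<Longrightarrow> word_map (map Ghost (rev p)) z = Some y \<longleftrightarrow>
      y \<in> points N \<and> infp z = prepend_path p (infp y) \<and> word_degree z = word_degree y + int (length p)"
    by auto
  have "word_map (map Ghost (rev (e # p))) x = Some y \<longleftrightarrow>
      (\<exists>z. partial_action (Ghost e) x = Some z \<and> word_map (map Ghost (rev p)) z = Some y)"
    by (simp add: word_map_append bind_eq_Some_conv del: partial_action.simps)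
  also have "\<dots> \<longleftrightarrow> (\<exists>z\<in>points N. infp x = case_nat e (infp z) \<and> word_degree x = word_degree z + 1 \<and>
      y \<in> points N \<and> infp z = prepend_path p (infp y) \<and> word_degree z = word_degree y + int (length p))"
    using IH partial_action_Ghost_iff[OF Cons.prems(1) e] by blast
  also have "\<dots> \<longleftrightarrow> y \<in> points N \<and> infp x = prepend_path (e # p) (infp y) \<and>
      word_degree x = word_degree y + int (length (e # p))" (is "?L \<longleftrightarrow> ?R")
  proof
    assume ?R
    then have "x \<in> edge_part N e" using e Cons.prems(1) by (simp add: edge_part_iff)
    then obtain z where z: "z \<in> vert_part N (head G e)" "edge_map N e z = x"
      using edge_map_surj[OF e] by blast
    then have "z \<in> points N" by (simp add: vert_part_N)
    with z \<open>?R\<close> edge_map_props(2,3)[OF e z(1)] show ?L by (intro bexI[of _ z]) auto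
  qed auto
  finally show ?case .
qed

text \<open>A point never runs out of edges: once \<open>p\<close> is used up, ghost edges lengthen
  \<open>q\<close> along \<open>c\<close> and the degree keeps falling.\<close>

lemma drop_edges:
  assumes "x \<in> points N"
  shows "\<exists>y\<in>points N. infp x = prepend_path (map (infp x) [0..<k]) (infp y) \<and>
    word_degree x = word_degree y + int k \<and> set (map (infp x) [0..<k]) \<subseteq> arcs G"
proof (induction k)
  case 0
  then show ?case using assms by auto
next
  case (Suc k)
  then obtain y where y: "y \<in> points N" "infp x = prepend_path (map (infp x) [0..<k]) (infp y)"
    "word_degree x = word_degree y + int k" "set (map (infp x) [0..<k]) \<subseteq> arcs G" by blast
  define e where "e = infp y 0"
  have e: "e \<in> arcs G" using infp_0[OF y(1)] by (simp add: e_def)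
  have xk: "infp x k = e"
    using prepend_path_nth_add[of "map (infp x) [0..<k]" "infp y" 0] y(2) by (simp add: e_def)
  have "y \<in> edge_part N e" using y(1) e by (simp add: edge_part_iff e_def)
  then obtain z where z: "z \<in> vert_part N (head G e)" "edge_map N e z = y"
    using edge_map_surj[OF e] by blast
  have zy: "infp y = case_nat e (infp z)" "word_degree y = word_degree z + 1"
    using edge_map_props(2,3)[OF e z(1)] z(2) by auto
  have "infp x = prepend_path (map (infp x) [0..<Suc k]) (infp z)"
    using y(2) zy xk by (simp add: prepend_path_append)
  moreover have "z \<in> points N" using z by (simp add: vert_part_N)
  moreover have "set (map (infp x) [0..<Suc k]) \<subseteq> arcs G" using y(4) e xk by simp
  ultimately show ?case using zy y(3) by (intro bexI[of _ z]) auto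
qed

lemma prepend_in_points:
  assumes "awalk u p w" "y \<in> vert_part N w"
  shows "\<exists>z\<in>vert_part N u. infp z = prepend_path p (infp y) \<and> word_degree z = word_degree y + int (length p)"
  using assms
proof (induction p arbitrary: u)
  case Nil
  then show ?case by (auto simp: awalk_Nil_iff)
next
  case (Cons e p)
  then have e: "e \<in> arcs G" "u = tail G e" "awalk (head G e) p w" by (auto simp: awalk_Cons_iff)
  then obtain z where z: "z \<in> vert_part N (head G e)" "infp z = prepend_path p (infp y)"
      "word_degree z = word_degree y + int (length p)"
    using Cons by blast
  have "edge_map N e z \<in> vert_part N u"
    using edge_map_props(4)[OF e(1) z(1)] edge_part_subset[OF e(1)] e(2) by blast
  then show ?case
    using edge_map_props(2,3)[OF e(1) z(1)] z by (intro bexI[of _ "edge_map N e z"]) auto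
qed

end

text \<open>\<open>y0\<close> plays the role of the trivial word at \<open>v\<close> among the words
  based at \<open>w\<close>. With \<open>w\<close> different from \<open>v\<close> this describes
  the change of the base vertex; with \<open>w = v\<close> and \<open>y0\<close> a full turn it
  describes the rotation \<open>\<tau>\<close>.\<close>

locale two_base_points = V: cycle_word_system G c v + W: cycle_word_system G c w
  for G :: "('v, 'e) pre_digraph" and c v w +
  fixes n :: int and y0 :: "('v, 'e) path \<times> ('v, 'e) path"
  assumes y0: "y0 \<in> points W.N" "W.infp y0 = V.cycle_path v" "word_degree y0 = n"
begin

lemma ex_translate:
  assumes "x \<in> points V.N"
  shows "\<exists>y\<in>points W.N. W.infp y = V.infp x \<and> word_degree y = word_degree x + n"
  using assms
proof (induction rule: V.points_induct)
  case base
  then show ?case using y0 V.base_word by (intro bexI[of _ y0]) auto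
next
  case (edge e x)
  then obtain y where y: "y \<in> points W.N" "W.infp y = V.infp x" "word_degree y = word_degree x + n"
    by blast
  have "x \<in> points V.N" using edge(2) by (simp add: V.vert_part_N)
  then have "y \<in> vert_part W.N (head G e)"
    using edge(2) y by (simp add: V.vert_part_iff W.vert_part_iff)
  from W.edge_map_props[OF edge(1) this] V.edge_map_props[OF edge(1,2)] y
  show ?case by (intro bexI[of _ "edge_map W.N e y"]) auto
next
  case (inverse_edge e x)
  then obtain y where y: "y \<in> points W.N" "W.infp y = V.infp (edge_map V.N e x)"
      "word_degree y = word_degree (edge_map V.N e x) + n"
    by blast
  note x = V.edge_map_props[OF inverse_edge(1,2)]
  have "y \<in> edge_part W.N e"
    using y x inverse_edge(1) by (simp add: W.edge_part_iff)
  then obtain z where z: "z \<in> vert_part W.N (head G e)" "edge_map W.N e z = y"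
    using W.edge_map_surj[OF inverse_edge(1)] by blast
  have "z \<in> points W.N" using z by (simp add: W.vert_part_N)
  with W.edge_map_props[OF inverse_edge(1) z(1)] z(2) x y
  show ?case by (intro bexI[of _ z]) auto
qed

text \<open>The choice is unique by \<open>infp_degree_inject\<close>. Defining the map by path and
  degree makes its compatibility with edges immediate.\<close>

definition translate :: "('v, 'e) path \<times> ('v, 'e) path \<Rightarrow> ('v, 'e) path \<times> ('v, 'e) path" where
  "translate x = (SOME y. y \<in> points W.N \<and> W.infp y = V.infp x \<and> word_degree y = word_degree x + n)"

lemma translate:
  assumes "x \<in> points V.N"
  shows "translate x \<in> points W.N" "W.infp (translate x) = V.infp x"
    "word_degree (translate x) = word_degree x + n"
proof -
  have "translate x \<in> points W.N \<and> W.infp (translate x) = V.infp x \<and>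
      word_degree (translate x) = word_degree x + n"
    unfolding translate_def by (rule someI_ex) (use ex_translate[OF assms] in blast)
  then show "translate x \<in> points W.N" "W.infp (translate x) = V.infp x"
    "word_degree (translate x) = word_degree x + n" by auto
qed

text \<open>Exchanging the two paths turns \<open>pq\<^sup>*\<close> into \<open>qp\<^sup>*\<close>,
  which is again reduced, has the opposite degree and follows \<open>c\<close> from
  \<open>w\<close>. The translation in the other direction then gives surjectivity of
  \<open>translate\<close>.\<close>

lemma reverse: "two_base_points G c w v (- n) (prod.swap y0)"
proof
  obtain u p q t where y: "y0 = ((u, p), (w, q))" "t \<in> V.cv" "V.awalk u p t" "V.awalk w q t"
      "W.infp y0 = prepend_path p (V.cycle_path t)" "\<not> (p \<noteq> [] \<and> q \<noteq> [] \<and> last p = last q)"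
    using y0(1) by (rule W.pointsE)
  have "u = v"
  proof -
    have "tail G (W.infp y0 0) = u" using W.infp_0(2)[OF y0(1)] y(1) by simp
    then show ?thesis using y0(2) V.next_edge(2)[OF V.v_in_cv] by simp
  qed
  then have "prod.swap y0 \<in> cycle_words G c v"
    using y by (auto simp: V.cycle_words_iff)
  then show "prod.swap y0 \<in> points V.N"
    using y(6) by (auto simp: V.points_N y(1))
  show "V.infp (prod.swap y0) = V.cycle_path w"
    using V.prepend_cycle_path[OF y(4) W.v_in_cv y(2)] y by auto
  show "word_degree (prod.swap y0) = - n"
    using y0(3) by (simp add: y(1))
qed

lemma translate_bij: "bij_betw translate (points V.N) (points W.N)"
proof (rule bij_betwI')
  fix x y assume xy: "x \<in> points V.N" "y \<in> points V.N"
  show "translate x = translate y \<longleftrightarrow> x = y"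
    using translate(2,3)[OF xy(1)] translate(2,3)[OF xy(2)] V.infp_degree_inject[OF xy] by auto
next
  show "x \<in> points V.N \<Longrightarrow> translate x \<in> points W.N" for x by (rule translate)
next
  fix y assume y: "y \<in> points W.N"
  interpret rev: two_base_points G c w v "- n" "prod.swap y0" by (rule reverse)
  obtain x where x: "x \<in> points V.N" "V.infp x = W.infp y" "word_degree x = word_degree y - n"
    using rev.ex_translate[OF y] by auto
  have "y = translate x"
    by (rule W.infp_degree_inject) (use translate[OF x(1)] x y in auto)
  with x show "\<exists>x\<in>points V.N. y = translate x" by blast
qed

lemma branching_iso_translate: "branching_iso G V.N W.N translate"
proof
  fix u x assume "x \<in> points V.N"
  then show "translate x \<in> vert_part W.N u \<longleftrightarrow> x \<in> vert_part V.N u"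
    using translate by (simp add: V.vert_part_iff W.vert_part_iff)
next
  fix e x assume "e \<in> arcs G" "x \<in> points V.N"
  then show "translate x \<in> edge_part W.N e \<longleftrightarrow> x \<in> edge_part V.N e"
    using translate by (simp add: V.edge_part_iff W.edge_part_iff)
next
  fix e x assume e: "e \<in> arcs G" and x: "x \<in> vert_part V.N (head G e)"
  then have xp: "x \<in> points V.N" by (simp add: V.vert_part_N)
  have tx: "translate x \<in> vert_part W.N (head G e)"
    using x translate[OF xp] xp by (simp add: V.vert_part_iff W.vert_part_iff)
  note ex = V.edge_map_props[OF e x] and etx = W.edge_map_props[OF e tx]
  show "edge_map W.N e (translate x) = translate (edge_map V.N e x)"
    by (rule W.infp_degree_inject) (use ex etx translate[OF xp] translate[OF ex(1)] in auto)
qed (rule translate_bij)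

end

section \<open>Graded simplicity and change of the base vertex\<close>

locale cycle_module_system = cycle_word_system G c v
  for K :: "'k::field itself" and G :: "('v, 'e) pre_digraph" and c v
begin

sublocale field_branching K G N
  by unfold_locales

abbreviation lpa_act :: "('v, 'e, 'k) free_elem \<Rightarrow> (('v, 'e) path \<times> ('v, 'e) path \<Rightarrow> 'k) \<Rightarrow>
    ('v, 'e) path \<times> ('v, 'e) path \<Rightarrow> 'k" (infixr "\<bullet>" 70) where
  "a \<bullet> m \<equiv> free_action ring_of_type_algebra (\<lambda>k. k) act a m"

lemma cycle_module_eq: "cycle_module K G c v = the_module"
  by (simp add: cycle_module_def the_module_eq)

lemma cycle_grading_iff: "m \<in> cycle_grading K G c v n \<longleftrightarrow> m \<in> V \<and> (\<forall>x. m x \<noteq> 0 \<longrightarrow> word_degree x = n)"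
  by (simp add: cycle_grading_def cycle_module_eq)

lemma V_D: "m \<in> V \<Longrightarrow> m x \<noteq> 0 \<Longrightarrow> x \<in> points N"
  unfolding V_iff by blast

lemma cycle_gradingD:
  "m \<in> cycle_grading K G c v n \<Longrightarrow> m \<in> V"
  "m \<in> cycle_grading K G c v n \<Longrightarrow> m x \<noteq> 0 \<Longrightarrow> word_degree x = n"
  unfolding cycle_grading_iff by blast+

lemma cycle_grading_subset: "cycle_grading K G c v n \<subseteq> V"
  using cycle_gradingD(1) by blast

lemma gen_in_lpa_reps [intro]:
  "g \<in> gens G \<Longrightarrow> Poly_Mapping.single (NC_Word [g]) k \<in> lpa_reps K G"
  by (intro lpa_reps_single) auto

text \<open>An edge and its ghost move a basis vector forth and back, so membership in a submodule
  spreads along edges in both directions and, by \<open>points_induct\<close>, to all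
  points.\<close>

lemma submodule_basis_iff:
  assumes N': "submodule N' (leavitt K G) the_module" and x: "x \<in> points N"
  shows "point_vec 1 x \<in> N' \<longleftrightarrow> point_vec 1 base_word \<in> N'"
  using x
proof (induction rule: points_induct)
  case (edge e x)
  have x: "x \<in> points N" using edge(2) by (simp add: vert_part_N)
  have ex: "edge_map N e x \<in> points N" by (rule edge_map_props[OF edge(1,2)])
  have "Poly_Mapping.single (NC_Word [Edge e]) 1 \<bullet> point_vec 1 x = point_vec 1 (edge_map N e x)"
    using edge(1,2) by (simp add: single_apply_point[OF x])
  moreover have "Poly_Mapping.single (NC_Word [Ghost e]) 1 \<bullet> point_vec 1 (edge_map N e x) = point_vec 1 x"
    using edge(1,2) edge_map_in inv_edge_map by (simp add: single_apply_point[OF ex])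
  ultimately have "point_vec 1 (edge_map N e x) \<in> N' \<longleftrightarrow> point_vec 1 x \<in> N'"
    using submodule_the_moduleD(4)[OF N'] edge(1) by (metis gen_in_lpa_reps gens_iff(2,3))
  then show ?case using edge(3) by simp
next
  case (inverse_edge e x)
  have x: "x \<in> points N" using inverse_edge(2) by (simp add: vert_part_N)
  have ex: "edge_map N e x \<in> points N" by (rule edge_map_props[OF inverse_edge(1,2)])
  have "Poly_Mapping.single (NC_Word [Edge e]) 1 \<bullet> point_vec 1 x = point_vec 1 (edge_map N e x)"
    using inverse_edge(1,2) by (simp add: single_apply_point[OF x])
  moreover have "Poly_Mapping.single (NC_Word [Ghost e]) 1 \<bullet> point_vec 1 (edge_map N e x) = point_vec 1 x"
    using inverse_edge(1,2) edge_map_in inv_edge_map by (simp add: single_apply_point[OF ex])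
  ultimately have "point_vec 1 (edge_map N e x) \<in> N' \<longleftrightarrow> point_vec 1 x \<in> N'"
    using submodule_the_moduleD(4)[OF N'] inverse_edge(1) by (metis gen_in_lpa_reps gens_iff(2,3))
  then show ?case using inverse_edge(3) by simp
qed simp

lemma submodule_eq_V:
  assumes N': "submodule N' (leavitt K G) the_module" and x: "x \<in> points N" "point_vec 1 x \<in> N'"
  shows "N' = V"
proof
  show "N' \<subseteq> V" by (rule submodule_the_moduleD[OF N'])
  show "V \<subseteq> N'"
  proof
    fix m assume "m \<in> V"
    then show "m \<in> N'"
    proof (induction rule: free_carrier_induct)
      case zero
      then show ?case by (rule submodule_the_moduleD[OF N'])
    next
      case (add y a m)
      have y: "point_vec 1 y \<in> N'"
        using submodule_basis_iff[OF N'] x add(1) by blast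
      define u where "u = fst (fst y)"
      have "u \<in> verts G" "y \<in> vert_part N u"
        using tail_in_verts[OF infp_0(1)[OF add(1)]] infp_0(2)[OF add(1)] add(1)
        by (simp_all add: u_def vert_part_N)
      \<comment> \<open>The scalar \<open>a\<close> is realised by the algebra element
        \<open>a\<close> times the source of \<open>y\<close>, as a submodule is closed under the
        action of the algebra.\<close>
      then have "Poly_Mapping.single (NC_Word [Vert u]) a \<bullet> point_vec 1 y = point_vec a y"
        by (simp add: single_apply_point[OF add(1)])
      moreover have "scale_vec ring_of_type_algebra a (basis_vec ring_of_type_algebra y) = point_vec a y"
        by (auto simp: scale_vec_eq basis_vec_eq point_vec_def)
      ultimately have "scale_vec ring_of_type_algebra a (basis_vec ring_of_type_algebra y) \<in> N'"
        using submodule_the_moduleD(4)[OF N' _ y] \<open>u \<in> verts G\<close> by (metis gen_in_lpa_reps gens_iff(1))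
      then show ?case using add(4) by (rule submodule_the_moduleD(3)[OF N'])
    qed
  qed
qed

text \<open>Distinct points of equal degree have distinct infinite paths, so a ghost path that follows
  one of them long enough annihilates all others.\<close>

lemma homogeneous_separate:
  assumes m: "m \<in> cycle_grading K G c v n" and x0: "m x0 \<noteq> 0"
  shows "\<exists>a\<in>lpa_reps K G. \<exists>y\<in>points N. a \<bullet> m = point_vec 1 y"
proof -
  have mV: "m \<in> V" by (rule cycle_gradingD[OF m])
  note deg = cycle_gradingD(2)[OF m] and pts = V_D[OF mV]
  have fin: "finite {x. m x \<noteq> 0}" using mV by (simp add: V_iff)
  have "\<exists>i. infp x i \<noteq> infp x0 i" if "m x \<noteq> 0" "x \<noteq> x0" for x
    using infp_degree_inject[OF pts[OF that(1)] pts[OF x0]] deg that x0 by auto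
  then obtain d where d: "\<And>x. m x \<noteq> 0 \<Longrightarrow> x \<noteq> x0 \<Longrightarrow> infp x (d x) \<noteq> infp x0 (d x)"
    by metis
  \<comment> \<open>\<open>Suc\<close> puts \<open>k\<close> beyond every separating index and also
    makes it positive, so that the ghost path \<open>p\<close> is a nonempty word and defines an
    element of the nonunital algebra.\<close>
  define k where "k = Suc (Max (insert 0 (d ` {x. m x \<noteq> 0})))"
  have k: "d x < k" if "m x \<noteq> 0" for x
    unfolding k_def using fin that by (intro le_imp_less_Suc Max_ge) auto
  define p where "p = map (infp x0) [0..<k]"
  obtain y where y: "y \<in> points N" "infp x0 = prepend_path p (infp y)"
      "word_degree x0 = word_degree y + int k" "set p \<subseteq> arcs G"
    using drop_edges[OF pts[OF x0], of k] unfolding p_def by blast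
  have len: "length p = k" by (simp add: p_def)
  have x0_map: "word_map (map Ghost (rev p)) x0 = Some y"
    using y len by (simp add: word_map_Ghosts_iff[OF pts[OF x0] y(4)])
  have other: "word_map (map Ghost (rev p)) x = None" if x: "m x \<noteq> 0" "x \<noteq> x0" for x
  proof (rule ccontr)
    assume "word_map (map Ghost (rev p)) x \<noteq> None"
    then obtain z where "infp x = prepend_path p (infp z)"
      using word_map_Ghosts_iff[OF pts[OF x(1)] y(4)] by auto
    then have "infp x (d x) = p ! d x" using k[OF x(1)] len by (simp add: prepend_path_nth)
    also have "\<dots> = infp x0 (d x)" using k[OF x(1)] by (simp add: p_def)
    finally show False using d[OF x] by simp
  qed
  define a :: "('v, 'e, 'k) free_elem"
    where "a = Poly_Mapping.single (NC_Word (map Ghost (rev p))) (1 / m x0)"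
  have "a \<bullet> m = point_vec 1 y"
  proof
    fix z
    have "(a \<bullet> m) z = (\<Sum>x\<in>{x. m x \<noteq> 0}.
        if word_map (map Ghost (rev p)) x = Some z then m x * (1 / m x0) else 0)"
      unfolding a_def by (rule single_apply[OF mV])
    also have "\<dots> = (\<Sum>x\<in>{x. m x \<noteq> 0}. if x = x0 then point_vec 1 y z else 0)"
      using other x0_map x0 by (intro sum.cong) (auto simp: point_vec_def)
    also have "\<dots> = point_vec 1 y z" using fin x0 by simp
    finally show "(a \<bullet> m) z = point_vec 1 y z" .
  qed
  moreover have "a \<in> lpa_reps K G"
    unfolding a_def using y(4) len by (intro lpa_reps_single) (auto simp: k_def)
  ultimately show ?thesis using y(1) by blast
qed

section \<open>Homogeneous components and graded simplicity\<close>

lemma finsum_the_module: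
  assumes "f ` A \<subseteq> V" "finite A"
  shows "finsum the_module f A = (\<lambda>x. \<Sum>i\<in>A. f i x)"
proof -
  interpret M: abelian_group the_module by (rule abelian_group_the_module)
  show ?thesis
    using assms(2,1)
  proof (induction A rule: finite_induct)
    case (insert i A)
    then have "f \<in> A \<rightarrow> carrier the_module" "f i \<in> carrier the_module" by auto
    then show ?case using insert by (simp add: M.finsum_insert add_vec_eq)
  qed (simp add: zero_vec_eq)
qed

lemma homogeneous_decomposition_iff:
  assumes "\<And>n. Mg n \<subseteq> V"
  shows "homogeneous_decomposition the_module Mg m y \<longleftrightarrow>
    (\<forall>n. y n \<in> Mg n) \<and> finite {n. y n \<noteq> (\<lambda>_. 0)} \<and> m = (\<lambda>x. \<Sum>n\<in>{n. y n \<noteq> (\<lambda>_. 0)}. y n x)"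
proof -
  have "finsum the_module y {n. y n \<noteq> (\<lambda>_. 0)} = (\<lambda>x. \<Sum>n\<in>{n. y n \<noteq> (\<lambda>_. 0)}. y n x)"
    if "\<forall>n. y n \<in> Mg n" "finite {n. y n \<noteq> (\<lambda>_. 0)}"
    using assms that by (intro finsum_the_module) blast+
  then show ?thesis
    unfolding homogeneous_decomposition_def the_module_simps zero_vec_eq by auto
qed

text \<open>At \<open>x\<close> only the component whose index is the degree of \<open>x\<close> can
  be nonzero, so the sum of the components has at most one nonzero term there.\<close>

lemma graded_decomposition:
  assumes y: "homogeneous_decomposition the_module (cycle_grading K G c v) m y"
  shows "y n = (\<lambda>x. if word_degree x = n then m x else 0)"
proof
  fix x
  have yy: "\<And>n. y n \<in> cycle_grading K G c v n" "finite {n. y n \<noteq> (\<lambda>_. 0)}"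
    "m x = (\<Sum>n\<in>{n. y n \<noteq> (\<lambda>_. 0)}. y n x)"
    using y unfolding homogeneous_decomposition_iff[OF cycle_grading_subset] by auto
  have deg: "word_degree x = k" if "y k x \<noteq> 0" for k
    by (rule cycle_gradingD(2)[OF yy(1) that])
  have "m x = (\<Sum>k\<in>{n. y n \<noteq> (\<lambda>_. 0)}. if k = word_degree x then y (word_degree x) x else 0)"
    unfolding yy(3) using deg by (intro sum.cong) auto
  also have "\<dots> = y (word_degree x) x"
    using yy(2) by auto
  finally show "y n x = (if word_degree x = n then m x else 0)"
    using deg[of n] by auto
qed

lemma ex_graded_decomposition:
  assumes m: "m \<in> V"
  shows "homogeneous_decomposition the_module (cycle_grading K G c v) m
    (\<lambda>n x. if word_degree x = n then m x else 0)" (is "homogeneous_decomposition _ _ _ ?y")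
proof -
  have fin: "finite {x. m x \<noteq> 0}" using m by (simp add: V_iff)
  have sub: "{n. ?y n \<noteq> (\<lambda>_. 0)} \<subseteq> word_degree ` {x. m x \<noteq> 0}"
    by (auto simp: fun_eq_iff simp del: word_degree.simps split: if_splits)
  then have fin': "finite {n. ?y n \<noteq> (\<lambda>_. 0)}" using fin finite_surj by blast
  have "?y n \<in> cycle_grading K G c v n" for n
  proof -
    have "finite {x. ?y n x \<noteq> 0}" by (rule rev_finite_subset[OF fin]) auto
    then show ?thesis unfolding cycle_grading_iff V_iff using V_D[OF m] by auto
  qed
  moreover have "m x = (\<Sum>n\<in>{n. ?y n \<noteq> (\<lambda>_. 0)}. ?y n x)" for x
  proof (cases "m x = 0")
    case False
    then have "word_degree x \<in> {n. ?y n \<noteq> (\<lambda>_. 0)}" by (auto simp: fun_eq_iff)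
    then show ?thesis using fin' by simp
  qed (simp add: sum.neutral)
  ultimately show ?thesis
    unfolding homogeneous_decomposition_iff[OF cycle_grading_subset] using fin' by blast
qed

lemma word_map_degree:
  assumes "x \<in> points N" "word_map gs x = Some y"
  shows "word_degree y = word_degree x +
    (\<Sum>g\<leftarrow>gs. case g of Vert _ \<Rightarrow> 0 | Edge _ \<Rightarrow> 1 | Ghost _ \<Rightarrow> -1)"
  using assms(2)
proof (induction gs arbitrary: y)
  case (Cons g gs)
  then obtain z where z: "word_map gs x = Some z" "partial_action g z = Some y"
    by (auto simp: bind_eq_Some_conv simp del: partial_action.simps)
  have zp: "z \<in> points N" using assms(1) z(1) by (rule word_map_closed)
  have "word_degree y = word_degree z + (case g of Vert _ \<Rightarrow> 0 | Edge _ \<Rightarrow> 1 | Ghost _ \<Rightarrow> -1)"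
  proof (cases g)
    case (Vert u)
    then show ?thesis using z(2) by (auto split: if_splits)
  next
    case (Edge e)
    then have "e \<in> arcs G" using z(2) by (auto split: if_splits)
    then show ?thesis using z(2) partial_action_Edge_iff[OF zp] Edge by simp
  next
    case (Ghost e)
    then have "e \<in> arcs G" using z(2) by (auto split: if_splits)
    then show ?thesis using z(2) partial_action_Ghost_iff[OF zp] Ghost by simp
  qed
  then show ?case using Cons.IH[OF z(1)] by simp
qed simp

lemma path_ghost_word_degree:
  "(\<Sum>g\<leftarrow>(path_word (u, p) @ ghost_word (w, q) :: ('v, 'e) gen list). case g of Vert _ \<Rightarrow> 0 | Edge _ \<Rightarrow> 1 | Ghost _ \<Rightarrow> -1) =
    int (length p) - int (length q)"
proof -
  have "(\<Sum>g\<leftarrow>(map Edge p :: ('v, 'e) gen list). case g of Vert _ \<Rightarrow> 0 | Edge _ \<Rightarrow> 1 | Ghost _ \<Rightarrow> (-1::int)) =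
      int (length p)" for p
    by (induction p) auto
  moreover have "(\<Sum>g\<leftarrow>(map Ghost q :: ('v, 'e) gen list). case g of Vert _ \<Rightarrow> 0 | Edge _ \<Rightarrow> 1 | Ghost _ \<Rightarrow> (-1::int)) =
      - int (length q)" for q
    by (induction q) auto
  ultimately show ?thesis by simp
qed

text \<open>A nonzero coordinate of the image at \<open>y\<close> comes from a word of
  \<open>a\<close> and a point in the support of \<open>m\<close> that this word sends to
  \<open>y\<close>; the letters of the word then determine the degree of \<open>y\<close>.\<close>

lemma leavitt_grading_act:
  assumes A: "A \<in> leavitt_grading K G i" and m: "m \<in> cycle_grading K G c v j"
  shows "A \<odot>\<^bsub>the_module\<^esub> m \<in> cycle_grading K G c v (i + j)"
proof -
  obtain a where a: "A = lpa_class K G a" "Poly_Mapping.keys a \<subseteq>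
      {NC_Word (path_word (u, p) @ ghost_word (w, q)) | u p w q.
        (\<exists>x. awalk u p x) \<and> (\<exists>y. awalk w q y) \<and> int (length p) - int (length q) = i}"
    using A unfolding leavitt_grading_def by blast
  have gens: "set (path_word (u, p) @ ghost_word (w, q)) \<subseteq> gens G"
    if "awalk u p x" "awalk w q y" for u p w q x y
    using that by (auto simp: awalk_def)
  have keys: "set gs \<subseteq> gens G \<and>
      (\<Sum>g\<leftarrow>gs. case g of Vert _ \<Rightarrow> 0 | Edge _ \<Rightarrow> 1 | Ghost _ \<Rightarrow> -1) = i"
    if gs: "NC_Word gs \<in> Poly_Mapping.keys a" for gs
  proof -
    obtain u p w q x y where "gs = path_word (u, p) @ ghost_word (w, q)" "awalk u p x" "awalk w q y"
        "int (length p) - int (length q) = i"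
      using a(2) gs by blast
    then show ?thesis using gens path_ghost_word_degree by metis
  qed
  have carr: "a \<in> carrier (free_algebra K G)"
    unfolding carrier_free_algebra using keys by (metis nc_word.collapse)
  have mV: "m \<in> V" by (rule cycle_gradingD[OF m])
  note deg = cycle_gradingD(2)[OF m]
  have "word_degree y = i + j" if nz: "(a \<bullet> m) y \<noteq> 0" for y
  proof -
    have "(a \<bullet> m) y = (\<Sum>w\<in>Poly_Mapping.keys a. Poly_Mapping.lookup a w * word_action ring_of_type_algebra act w m y)"
      by (simp add: free_action_def)
    with nz have "\<exists>w\<in>Poly_Mapping.keys a.
        Poly_Mapping.lookup a w * word_action ring_of_type_algebra act w m y \<noteq> 0"
      by (metis (no_types, lifting) sum.neutral)
    then obtain w where w: "w \<in> Poly_Mapping.keys a" "word_action ring_of_type_algebra act w m y \<noteq> 0"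
      by auto
    obtain gs where gs: "w = NC_Word gs" by (cases w)
    have "(Poly_Mapping.single (NC_Word gs) 1 \<bullet> m) y \<noteq> 0"
      using w(2) gs by (simp add: free_action_single[OF mV] scale_vec_eq)
    then have "(\<Sum>x\<in>{x. m x \<noteq> 0}. if word_map gs x = Some y then m x * 1 else 0) \<noteq> 0"
      using single_apply[OF mV] by metis
    then obtain x where "x \<in> {x. m x \<noteq> 0}" "(if word_map gs x = Some y then m x * 1 else 0) \<noteq> 0"
      by (rule sum.not_neutral_contains_not_neutral)
    then have x: "m x \<noteq> 0" "word_map gs x = Some y"
      by (auto split: if_splits)
    have "(\<Sum>g\<leftarrow>gs. case g of Vert _ \<Rightarrow> 0 | Edge _ \<Rightarrow> 1 | Ghost _ \<Rightarrow> -1) = i"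
      using keys w(1) gs by blast
    moreover have "x \<in> points N" by (rule V_D[OF mV x(1)])
    ultimately show ?thesis using word_map_degree[OF _ x(2)] deg[OF x(1)] by simp
  qed
  then show ?thesis
    using mV carr by (simp add: a(1) cycle_grading_iff)
qed

lemma graded_module: "graded_module (leavitt K G) (leavitt_grading K G) the_module (cycle_grading K G c v)"
  unfolding graded_module_def
proof (intro conjI allI ballI)
  interpret M: abelian_group the_module by (rule abelian_group_the_module)
  show "left_module (leavitt K G) the_module" by (rule left_module_the_module)
  show "additive_subgroup (cycle_grading K G c v n) the_module" for n
  proof (intro additive_subgroupI M.add.subgroupI)
    show "cycle_grading K G c v n \<noteq> {}"
    proof -
      have "(\<lambda>_. 0) \<in> cycle_grading K G c v n" by (simp add: cycle_grading_iff V_iff)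
      then show ?thesis by blast
    qed
    fix m assume m: "m \<in> cycle_grading K G c v n"
    have "\<ominus>\<^bsub>the_module\<^esub> m = (\<lambda>x. - m x)"
      using m by (intro M.minus_equality) (simp_all add: cycle_grading_iff V_iff add_vec_eq zero_vec_eq)
    then show "\<ominus>\<^bsub>the_module\<^esub> m \<in> cycle_grading K G c v n"
      using m by (simp add: cycle_grading_iff V_iff)
  next
    fix m m' assume mm: "m \<in> cycle_grading K G c v n" "m' \<in> cycle_grading K G c v n"
    have "add_vec m m' \<in> V" by (rule add_vec_closed[OF mm[THEN cycle_gradingD(1)]])
    moreover have "word_degree x = n" if "add_vec m m' x \<noteq> 0" for x
    proof -
      have "m x \<noteq> 0 \<or> m' x \<noteq> 0" using that by (auto simp: add_vec_eq)
      then show ?thesis using cycle_gradingD(2) mm by blast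
    qed
    ultimately show "m \<oplus>\<^bsub>the_module\<^esub> m' \<in> cycle_grading K G c v n"
      by (simp add: cycle_grading_iff)
  qed (simp add: cycle_grading_subset)
  show "\<exists>!y. homogeneous_decomposition the_module (cycle_grading K G c v) m y"
    if "m \<in> carrier the_module" for m
  proof (rule ex1I)
    show "homogeneous_decomposition the_module (cycle_grading K G c v) m
        (\<lambda>n x. if word_degree x = n then m x else 0)"
      using that by (intro ex_graded_decomposition) simp
    fix y assume "homogeneous_decomposition the_module (cycle_grading K G c v) m y"
    then show "y = (\<lambda>n x. if word_degree x = n then m x else 0)"
      using graded_decomposition by blast
  qed
  show "a \<odot>\<^bsub>the_module\<^esub> m \<in> cycle_grading K G c v (i + j)"
    if "a \<in> leavitt_grading K G i" "m \<in> cycle_grading K G c v j" for i j a m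
    using that by (rule leavitt_grading_act)
qed

lemma graded_simple:
  "graded_simple_module (leavitt K G) (leavitt_grading K G) the_module (cycle_grading K G c v)"
  unfolding graded_simple_module_def
proof (intro conjI allI impI)
  show "graded_module (leavitt K G) (leavitt_grading K G) the_module (cycle_grading K G c v)"
    by (rule graded_module)
  show "nontrivial_action (leavitt K G) the_module"
    using nontrivial_action_the_module base_word(4) v_in_cv cv_verts by blast
  fix N' assume "graded_submodule N' (leavitt K G) the_module (cycle_grading K G c v)"
  then have N': "submodule N' (leavitt K G) the_module"
    and dec: "\<And>m. m \<in> N' \<Longrightarrow> \<exists>y. homogeneous_decomposition the_module (\<lambda>n. N' \<inter> cycle_grading K G c v n) m y"
    by (auto simp: graded_submodule_def)
  show "N' = {\<zero>\<^bsub>the_module\<^esub>} \<or> N' = carrier the_module"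
  proof (cases "N' \<subseteq> {\<lambda>_. 0}")
    case True
    then show ?thesis using submodule_the_moduleD(2)[OF N'] by (auto simp: zero_vec_eq)
  next
    case False
    then obtain m where m: "m \<in> N'" "m \<noteq> (\<lambda>_. 0)" by blast
    obtain y where y: "homogeneous_decomposition the_module (\<lambda>n. N' \<inter> cycle_grading K G c v n) m y"
      using dec[OF m(1)] by blast
    have "N' \<inter> cycle_grading K G c v n \<subseteq> V" for n by (auto simp: cycle_grading_iff)
    then have y': "\<And>n. y n \<in> N' \<inter> cycle_grading K G c v n"
        "m = (\<lambda>x. \<Sum>n\<in>{n. y n \<noteq> (\<lambda>_. 0)}. y n x)"
      using y by (simp_all add: homogeneous_decomposition_iff)
    have "\<exists>n. y n \<noteq> (\<lambda>_. 0)"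
    proof (rule ccontr)
      assume "\<not> (\<exists>n. y n \<noteq> (\<lambda>_. 0))"
      then have "{n. y n \<noteq> (\<lambda>_. 0)} = {}" by blast
      with y'(2) m(2) show False by simp
    qed
    then obtain n x where "y n x \<noteq> 0" by (auto simp: fun_eq_iff)
    then obtain a z where "a \<in> lpa_reps K G" "z \<in> points N" "a \<bullet> y n = point_vec 1 z"
      using homogeneous_separate y'(1)[of n] by blast
    then have "point_vec 1 z \<in> N'"
      using submodule_the_moduleD(4)[OF N'] y'(1)[of n] by (metis IntE)
    then show ?thesis using submodule_eq_V[OF N' \<open>z \<in> points N\<close>] by simp
  qed
qed

end

section \<open>Change of the base vertex and failure of simplicity\<close>

lemma (in graph_with_exclusive_cycle) two_base_points_path:
  assumes "v \<in> cv" "w \<in> cv" "awalk v r w"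
  shows "two_base_points G c v w (int (length r)) ((v, r), (w, []))"
proof -
  interpret V: cycle_word_system G c v by unfold_locales (rule assms)
  interpret W: cycle_word_system G c w by unfold_locales (rule assms)
  have "awalk w [] w" using assms(3) by (auto simp: awalk_Nil_iff)
  then have "((v, r), (w, [])) \<in> cycle_words G c w"
    using assms by (auto simp: W.cycle_words_iff)
  then have "((v, r), (w, [])) \<in> points W.N"
    by (simp add: W.points_N)
  moreover have "word_path G c ((v, r), (w, [])) = cycle_path v"
    using prepend_cycle_path[OF assms(3,1,2)] assms(3) by auto
  ultimately show ?thesis by unfold_locales simp_all
qed

lemma (in graph_with_exclusive_cycle) path_in_cycle:
  assumes "v \<in> cv" "w \<in> cv"
  shows "awalk v (path_in_cycle G c v w) w"
proof -
  obtain p where "awalk v p w" "set p \<subseteq> set c" by (rule cv_path[OF assms])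
  then show ?thesis
    unfolding path_in_cycle_def
    using arg_min_natI[of "\<lambda>p. awalk v p w \<and> set p \<subseteq> set c" p length] by blast
qed

text \<open>A longer walk from \<open>v\<close> to \<open>w\<close> merely shifts the degree
  further. The shortest one gives the shift in the statement, and any of them gives the ungraded
  isomorphism.\<close>

lemma (in graph_with_exclusive_cycle) graded_isomorphic_shift:
  assumes "v \<in> cv" "w \<in> cv" "awalk v r w"
  shows "graded_isomorphic (leavitt K G) (cycle_module K G c v) (cycle_grading K G c v)
    (cycle_module K G c w) (shift_grading (int (length r)) (cycle_grading K G c w))"
proof -
  interpret two_base_points G c v w "int (length r)" "((v, r), (w, []))"
    by (rule two_base_points_path[OF assms])
  interpret V: cycle_module_system K G c v by unfold_locales
  interpret W: cycle_module_system K G c w by unfold_locales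
  interpret iso: branching_iso K G V.N W.N translate by (rule branching_iso_translate)
  have "iso.push m \<in> shift_grading (int (length r)) (cycle_grading K G c w) n"
    if m: "m \<in> cycle_grading K G c v n" for m n
  proof -
    have "word_degree y = n + int (length r)" if "iso.push m y \<noteq> 0" for y
    proof -
      obtain x where "x \<in> points V.N" "y = translate x" "m x \<noteq> 0"
        by (rule iso.push_nonzeroE[OF \<open>iso.push m y \<noteq> 0\<close>])
      then show ?thesis using translate(3) V.cycle_gradingD(2)[OF m] by simp
    qed
    then show ?thesis
      using iso.push_closed[OF V.cycle_gradingD(1)[OF m]]
      by (simp add: shift_grading_def W.cycle_grading_iff)
  qed
  moreover have "module_iso (leavitt K G) (cycle_module K G c v) (cycle_module K G c w) iso.push"
    unfolding cycle_module_def by (rule iso.module_iso_push)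
  ultimately show ?thesis unfolding graded_isomorphic_def by blast
qed

text \<open>For the automorphism \<open>\<tau>\<close> that moves once around the cycle, the range of \<open>1 - \<tau>\<close> is a submodule; it is
  proper because the sum of the coordinates vanishes on it.\<close>

lemma (in cycle_module_system) not_simple: "\<not> simple_module (leavitt K G) the_module"
proof
  assume simple: "simple_module (leavitt K G) the_module"
  \<comment> \<open>The positive length of \<open>r\<close> makes the rotation change degrees, so it
    fixes no point.\<close>
  obtain r where r: "awalk v r v" "set r \<subseteq> set c" "r \<noteq> []" by (rule cv_path[OF v_in_cv v_in_cv])
  interpret T: two_base_points G c v v "int (length r)" "((v, r), (v, []))"
    by (rule two_base_points_path[OF v_in_cv v_in_cv r(1)])
  interpret iso: branching_iso K G N N T.translate by (rule T.branching_iso_translate)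
  define \<delta> where "\<delta> m = (\<lambda>x. m x - iso.push m x)" for m :: "_ \<Rightarrow> 'k"
  have push_V: "iso.push m \<in> V" if "m \<in> V" for m
    using that by (rule iso.push_closed)
  have lin_push: "iso.push (add_vec m n) = add_vec (iso.push m) (iso.push n)" for m n
    by (auto simp: iso.push_def add_vec_eq)
  have \<delta>_add: "\<delta> (add_vec m n) = add_vec (\<delta> m) (\<delta> n)" for m n
    unfolding \<delta>_def lin_push by (auto simp: add_vec_eq)
  have \<delta>_alt: "\<delta> m = add_vec m (scale_vec ring_of_type_algebra (- 1) (iso.push m))" for m
    by (auto simp: \<delta>_def add_vec_eq scale_vec_eq)
  have \<delta>_V: "\<delta> m \<in> V" if "m \<in> V" for m
    unfolding \<delta>_alt using push_V[OF that] that by (intro add_vec_closed scale_vec_closed) auto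
  have \<delta>_act: "a \<bullet> \<delta> m = \<delta> (a \<bullet> m)" if "m \<in> V" for a m
  proof -
    have "a \<bullet> \<delta> m = add_vec (a \<bullet> m) (scale_vec ring_of_type_algebra (- 1) (a \<bullet> iso.push m))"
      unfolding \<delta>_alt using that push_V[OF that] lin_mapD[OF lin_map_free_action] by simp
    also have "a \<bullet> iso.push m = iso.push (a \<bullet> m)" using iso.push_apply[OF that] by simp
    finally show ?thesis by (simp add: \<delta>_alt)
  qed
  have sub: "submodule (\<delta> ` V) (leavitt K G) the_module"
  proof (rule submodule_the_moduleI)
    show "\<delta> ` V \<subseteq> V" using \<delta>_V by blast
    have "\<delta> (\<lambda>_. 0) = zero_vec ring_of_type_algebra" by (auto simp: \<delta>_def iso.push_def zero_vec_eq)
    moreover have "(\<lambda>_. 0) \<in> V" by (simp add: V_iff)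
    ultimately show "zero_vec ring_of_type_algebra \<in> \<delta> ` V" by (metis image_eqI)
    show "add_vec m n \<in> \<delta> ` V" if mn: "m \<in> \<delta> ` V" "n \<in> \<delta> ` V" for m n
    proof -
      obtain m' n' where "m' \<in> V" "n' \<in> V" "m = \<delta> m'" "n = \<delta> n'" using mn by blast
      then show ?thesis using \<delta>_add[of m' n', symmetric] add_vec_closed[of m' "points N" n'] by simp
    qed
    show "(\<lambda>x. - m x) \<in> \<delta> ` V" if m: "m \<in> \<delta> ` V" for m
    proof -
      obtain n where n: "n \<in> V" "m = \<delta> n" using m by blast
      have "(\<lambda>x. - m x) = \<delta> (\<lambda>x. - n x)" by (auto simp: n(2) \<delta>_def iso.push_def)
      moreover have "(\<lambda>x. - n x) \<in> V" using n(1) by (simp add: V_iff)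
      ultimately show ?thesis by blast
    qed
    show "a \<bullet> m \<in> \<delta> ` V" if m: "m \<in> \<delta> ` V" for a m
    proof -
      obtain m' where "m' \<in> V" "m = \<delta> m'" using m by blast
      then show ?thesis using \<delta>_act[of m' a] free_action_closed[of m' a] by simp
    qed
  qed
  have b: "base_word \<in> points N" by (rule base_word)
  have "\<delta> (point_vec 1 base_word) \<noteq> (\<lambda>_. 0)"
  proof
    assume eq: "\<delta> (point_vec 1 base_word) = (\<lambda>_. 0)"
    \<comment> \<open>The two words differ in degree by the length of \<open>r\<close>, so
      subtracting the rotated vector leaves the coordinate at \<open>base_word\<close> equal to
      1.\<close>
    have "T.translate base_word \<noteq> base_word" using T.translate(3)[OF b] r(3) by auto
    then have "\<delta> (point_vec 1 base_word) base_word = 1"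
      unfolding \<delta>_def iso.push_point[OF b] by (auto simp: point_vec_def)
    with eq show False by simp
  qed
  then have "\<delta> ` V \<noteq> {\<zero>\<^bsub>the_module\<^esub>}"
    using point_vec_closed[OF b] by (auto simp: zero_vec_eq)
  then have all: "\<delta> ` V = V"
    using simple sub unfolding simple_module_def by auto
  \<comment> \<open>\<open>push\<close> only permutes coordinates, so \<open>m\<close> and
    \<open>push m\<close> have the same coordinate sum. The union of their supports is used because
    \<open>\<delta> m\<close> may have a smaller support.\<close>
  have zero_sum: "(\<Sum>x\<in>{x. \<delta> m x \<noteq> 0}. \<delta> m x) = 0" if m: "m \<in> V" for m
  proof -
    have fin: "finite {x. m x \<noteq> 0}" "finite {x. iso.push m x \<noteq> 0}"
      using m push_V[OF m] by (simp_all add: V_iff)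
    let ?A = "{x. m x \<noteq> 0} \<union> {x. iso.push m x \<noteq> 0}"
    have "(\<Sum>x\<in>{x. \<delta> m x \<noteq> 0}. \<delta> m x) = (\<Sum>x\<in>?A. \<delta> m x)"
      using fin by (intro sum.mono_neutral_left) (auto simp: \<delta>_def)
    also have "\<dots> = (\<Sum>x\<in>?A. m x) - (\<Sum>x\<in>?A. iso.push m x)"
      by (simp add: \<delta>_def sum_subtractf)
    also have "(\<Sum>x\<in>?A. m x) = (\<Sum>x\<in>{x. m x \<noteq> 0}. m x)"
      using fin by (intro sum.mono_neutral_right) auto
    also have "(\<Sum>x\<in>?A. iso.push m x) = (\<Sum>x\<in>{x. iso.push m x \<noteq> 0}. iso.push m x)"
      using fin by (intro sum.mono_neutral_right) auto
    also have "{x. iso.push m x \<noteq> 0} = T.translate ` {x. m x \<noteq> 0}"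
      using V_D[OF m] iso.push_\<theta> by (auto elim!: iso.push_nonzeroE)
    also have "(\<Sum>x\<in>T.translate ` {x. m x \<noteq> 0}. iso.push m x) = (\<Sum>x\<in>{x. m x \<noteq> 0}. iso.push m (T.translate x))"
    proof (rule sum.reindex_cong)
      show "inj_on T.translate {x. m x \<noteq> 0}"
        using T.translate_bij V_D[OF m] unfolding bij_betw_def by (auto intro: inj_on_subset)
    qed auto
    also have "\<dots> = (\<Sum>x\<in>{x. m x \<noteq> 0}. m x)"
      using V_D[OF m] iso.push_\<theta> by (intro sum.cong) auto
    finally show ?thesis by simp
  qed
  have "point_vec 1 base_word \<in> \<delta> ` V" using all point_vec_closed[OF b] by blast
  then obtain m where "m \<in> V" "point_vec 1 base_word = \<delta> m" by blast
  then have "(\<Sum>x\<in>{x. point_vec (1::'k) base_word x \<noteq> 0}. point_vec (1::'k) base_word x) = 0"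
    using zero_sum by simp
  moreover have "{x. point_vec (1::'k) base_word x \<noteq> 0} = {base_word}" by (auto simp: point_vec_def)
  ultimately show False by (simp add: point_vec_def)
qed

lemma same_cycle_verts: "same_cycle c d \<Longrightarrow> cycle_verts G c = cycle_verts G d"
  by (auto simp: same_cycle_def cycle_verts_def)

text \<open>The cycle enters the construction only through its set of vertices, so its starting
  vertex is irrelevant.\<close>

lemma cycle_module_cong:
  assumes "cycle_verts G c = cycle_verts G d"
  shows "cycle_module K G c v = cycle_module K G d v" "cycle_grading K G c v = cycle_grading K G d v"
proof -
  have "cycle_words G c v = cycle_words G d v"
    by (simp add: cycle_words_def assms)
  then have "cycle_branching G c v = cycle_branching G d v"
    by (simp add: cycle_branching_def)
  then show "cycle_module K G c v = cycle_module K G d v" by (simp add: cycle_module_def)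
  then show "cycle_grading K G c v = cycle_grading K G d v"
    by (simp add: cycle_grading_def fun_eq_iff)
qed

context cycle_module_system begin

lemma vertex_annihilates_iff:
  assumes "u \<in> verts G"
  shows "lpa_class K G (gn (Vert u)) \<in> annihilator (leavitt K G) (cycle_module K G c v) \<longleftrightarrow> u \<notin> R"
  unfolding cycle_module_eq
  using vertex_in_annihilator_iff[OF assms] vert_part_nonempty_iff by auto

lemma left_module_cycle_module: "left_module (leavitt K G) (cycle_module K G c v)"
  unfolding cycle_module_eq by (rule left_module_the_module)

text \<open>In degree 0 and with source \<open>v\<close>, a reduced word over \<open>w\<close> must be trivial,
  since the edges of \<open>c\<close> are determined by their ranges.\<close>

lemma graded_isomorphic_same_base:
  assumes w: "w \<in> cv"
    and iso: "graded_isomorphic (leavitt K G) (cycle_module K G c v) (cycle_grading K G c v)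
      (cycle_module K G c w) (cycle_grading K G c w)"
  shows "v = w"
proof -
  interpret W: cycle_module_system K G c w by unfold_locales (rule w)
  obtain h where h: "module_iso (leavitt K G) (cycle_module K G c v) (cycle_module K G c w) h"
    and gr: "\<And>n. h ` cycle_grading K G c v n \<subseteq> cycle_grading K G c w n"
    using iso unfolding graded_isomorphic_def by blast
  \<comment> \<open>The image of the trivial word has degree 0 and is fixed by the vertex
    \<open>v\<close>. Hence any word in its support has source \<open>v\<close> and paths
    \<open>p\<close> and \<open>q\<close> of equal length.\<close>
  define m where "m = h (point_vec 1 base_word)"
  have b: "base_word \<in> points N" by (rule base_word)
  have v: "v \<in> verts G" using v_in_cv cv_verts by blast
  have gnv: "gn (Vert v) \<in> lpa_reps K G" using v by (intro lpa_reps_gn) simp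
  have pb: "point_vec 1 base_word \<in> cycle_grading K G c v 0"
    using base_word point_vec_closed[OF b] by (auto simp: cycle_grading_iff point_vec_def)
  then have m: "m \<in> cycle_grading K G c w 0" using gr unfolding m_def by blast
  have mV: "m \<in> W.V" by (rule W.cycle_gradingD[OF m])
  have "h (lpa_class K G (gn (Vert v)) \<odot>\<^bsub>the_module\<^esub> point_vec 1 base_word) =
      lpa_class K G (gn (Vert v)) \<odot>\<^bsub>W.the_module\<^esub> m"
    using h cycle_gradingD(1)[OF pb] gnv
    unfolding module_iso_def cycle_module_eq W.cycle_module_eq m_def
    by (auto simp: carrier_leavitt)
  moreover have "gn (Vert v) \<bullet> point_vec 1 base_word = point_vec 1 base_word"
    using single_apply_point[OF b, of "[Vert v]" 1] base_word(4) v by (simp add: gn_def)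
  ultimately have vm: "m = W.lpa_act (gn (Vert v)) m"
    using gnv cycle_gradingD(1)[OF pb] mV by (simp add: lpa_reps_carrier m_def)
  have bij: "bij_betw h V W.V"
    and add: "\<And>x y. x \<in> V \<Longrightarrow> y \<in> V \<Longrightarrow> h (x \<oplus>\<^bsub>the_module\<^esub> y) = h x \<oplus>\<^bsub>W.the_module\<^esub> h y"
    using h unfolding module_iso_def cycle_module_eq W.cycle_module_eq the_module_simps(1) W.the_module_simps(1)
    by blast+
  have h0: "h \<zero>\<^bsub>the_module\<^esub> = \<zero>\<^bsub>W.the_module\<^esub>"
  proof (rule abelian_group_iso_zero[OF abelian_group_the_module W.abelian_group_the_module])
    show "h ` carrier the_module \<subseteq> carrier W.the_module" using bij by (simp add: bij_betw_def)
    show "\<forall>x\<in>carrier the_module. \<forall>y\<in>carrier the_module.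
        h (x \<oplus>\<^bsub>the_module\<^esub> y) = h x \<oplus>\<^bsub>W.the_module\<^esub> h y"
      using add unfolding the_module_simps(1) by blast
  qed
  have "m \<noteq> (\<lambda>_. 0)"
  proof
    assume "m = (\<lambda>_. 0)"
    then have "h (point_vec 1 base_word) = h (\<lambda>_. 0)"
      using h0 by (simp add: m_def zero_vec_eq)
    moreover have "(\<lambda>_. 0) \<in> V" by (simp add: V_iff)
    ultimately have "point_vec (1::'k) base_word = (\<lambda>_. 0)"
      using bij cycle_gradingD(1)[OF pb] by (metis bij_betw_imp_inj_on inj_onD)
    then have "point_vec (1::'k) base_word base_word = 0" by simp
    then show False by (simp add: point_vec_def)
  qed
  then obtain y where y: "m y \<noteq> 0" by (auto simp: fun_eq_iff)
  then have "W.lpa_act (gn (Vert v)) m y \<noteq> 0" using vm by simp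
  then have "(\<Sum>x\<in>{x. m x \<noteq> 0}. if W.word_map [Vert v] x = Some y then m x * 1 else 0) \<noteq> 0"
    using W.single_apply[OF mV, of "[Vert v]" 1 y] by (simp add: gn_def)
  then obtain x where "(if W.word_map [Vert v] x = Some y then m x * 1 else 0) \<noteq> 0"
    by (rule sum.not_neutral_contains_not_neutral)
  then have "y \<in> vert_part W.N v" by (auto split: if_splits)
  then have y_props: "y \<in> points W.N" "fst (fst y) = v" "word_degree y = 0"
    using W.cycle_gradingD(2)[OF m y] by (simp_all add: W.vert_part_N)
  obtain w' p q u where yy: "y = ((w', p), (w, q))" "u \<in> cv" "awalk w' p u" "awalk w q u"
      "\<not> (p \<noteq> [] \<and> q \<noteq> [] \<and> last p = last q)"
    using y_props(1) by (rule W.pointsE)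
  then have p: "awalk v p u" and len: "length p = length q" using y_props by auto
  have "p = []"
  proof (rule ccontr)
    assume "p \<noteq> []"
    then have "q \<noteq> []" using len by auto
    have "awlast v p = u" "awlast w q = u" using p yy(4) by auto
    then have "head G (last p) = u" "head G (last q) = u"
      using \<open>p \<noteq> []\<close> \<open>q \<noteq> []\<close> by (simp_all add: awalk_verts_conv)
    moreover have "last p \<in> set c" "last q \<in> set c"
      using path_in_cycle_edges[OF p v_in_cv yy(2)] path_in_cycle_edges[OF yy(4) w yy(2)]
        \<open>p \<noteq> []\<close> \<open>q \<noteq> []\<close> last_in_set by blast+
    ultimately have "last p = last q" using inj_on_head by (metis inj_onD)
    then show False using yy(5) \<open>p \<noteq> []\<close> \<open>q \<noteq> []\<close> by simp
  qed
  then show ?thesis using len p yy(4) by (simp add: awalk_Nil_iff)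
qed

end

section \<open>Normal forms and the annihilator\<close>

locale leavitt_words = wf_digraph G
  for K :: "'k::field itself" and G :: "('v, 'e) pre_digraph"
begin

abbreviation mono_word :: "('v, 'e) gen list \<Rightarrow> 'k \<Rightarrow> ('v, 'e, 'k) free_elem" where
  "mono_word gs k \<equiv> Poly_Mapping.single (NC_Word gs) k"

abbreviation Rel :: "('v, 'e, 'k) free_elem set" where
  "Rel \<equiv> lpa_relation_ideal K G"

text \<open>Quantified over all coefficients, so that words can be exchanged inside linear
  combinations. The relations yield this after multiplication by the empty word with a coefficient,
  available in the free unital algebra.\<close>

definition word_eq :: "('v, 'e) gen list \<Rightarrow> ('v, 'e) gen list \<Rightarrow> bool" (infix "\<approx>" 50) where
  "gs \<approx> hs \<longleftrightarrow> (\<forall>k. mono_word gs k - mono_word hs k \<in> Rel)"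

definition word_null :: "('v, 'e) gen list \<Rightarrow> bool" where
  "word_null gs \<longleftrightarrow> (\<forall>k. mono_word gs k \<in> Rel)"

lemma mono_word_mult: "mono_word gs k * mono_word hs l = mono_word (gs @ hs) (k * l)"
  by (simp add: mult_single plus_nc_word_def)

lemma mono_word_carrier: "set gs \<subseteq> gens G \<Longrightarrow> mono_word gs k \<in> carrier (free_algebra K G)"
  by (rule carrier_free_algebra_single) simp

lemma word_eq_refl [simp]: "gs \<approx> gs"
  by (simp add: word_eq_def)

lemma word_eq_sym: "gs \<approx> hs \<Longrightarrow> hs \<approx> gs"
  unfolding word_eq_def
proof
  fix k assume "\<forall>k. mono_word gs k - mono_word hs k \<in> Rel"
  then have "- (mono_word gs k - mono_word hs k) \<in> Rel"
    by (intro lpa_relation_ideal_closed(2)) simp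
  then show "mono_word hs k - mono_word gs k \<in> Rel" by simp
qed

lemma word_eq_trans [trans]: "gs \<approx> hs \<Longrightarrow> hs \<approx> is \<Longrightarrow> gs \<approx> is"
  unfolding word_eq_def
proof
  fix k
  assume "\<forall>k. mono_word gs k - mono_word hs k \<in> Rel" "\<forall>k. mono_word hs k - mono_word is k \<in> Rel"
  then have "(mono_word gs k - mono_word hs k) + (mono_word hs k - mono_word is k) \<in> Rel"
    by (intro lpa_relation_ideal_closed(1)) simp_all
  then show "mono_word gs k - mono_word is k \<in> Rel" by simp
qed

lemma word_null_eq: "gs \<approx> hs \<Longrightarrow> word_null hs \<Longrightarrow> word_null gs"
  unfolding word_eq_def word_null_def
proof
  fix k
  assume "\<forall>k. mono_word gs k - mono_word hs k \<in> Rel" "\<forall>k. mono_word hs k \<in> Rel"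
  then have "(mono_word gs k - mono_word hs k) + mono_word hs k \<in> Rel"
    by (intro lpa_relation_ideal_closed(1)) simp_all
  then show "mono_word gs k \<in> Rel" by simp
qed

lemma word_eq_context:
  assumes "gs \<approx> hs" "set as \<subseteq> gens G" "set bs \<subseteq> gens G"
  shows "as @ gs @ bs \<approx> as @ hs @ bs"
  unfolding word_eq_def
proof
  fix k
  have "mono_word (as @ gs @ bs) k - mono_word (as @ hs @ bs) k =
      mono_word as 1 * (mono_word gs k - mono_word hs k) * mono_word bs 1"
    by (simp add: algebra_simps mono_word_mult)
  moreover have "mono_word gs k - mono_word hs k \<in> Rel" using assms(1) by (simp add: word_eq_def)
  ultimately show "mono_word (as @ gs @ bs) k - mono_word (as @ hs @ bs) k \<in> Rel"
    using lpa_relation_ideal_closed(5,6) mono_word_carrier assms(2,3) by metis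
qed

lemma word_null_context:
  assumes "word_null gs" "set as \<subseteq> gens G" "set bs \<subseteq> gens G"
  shows "word_null (as @ gs @ bs)"
  unfolding word_null_def
proof
  fix k
  have "mono_word (as @ gs @ bs) k = mono_word as 1 * mono_word gs k * mono_word bs 1"
    by (simp add: mono_word_mult)
  moreover have "mono_word gs k \<in> Rel" using assms(1) by (simp add: word_null_def)
  ultimately show "mono_word (as @ gs @ bs) k \<in> Rel"
    using lpa_relation_ideal_closed(5,6) mono_word_carrier assms(2,3) by metis
qed

lemma word_eq_left: "gs \<approx> hs \<Longrightarrow> set as \<subseteq> gens G \<Longrightarrow> as @ gs \<approx> as @ hs"
  using word_eq_context[of gs hs as "[]"] by simp

lemma word_eq_right: "gs \<approx> hs \<Longrightarrow> set bs \<subseteq> gens G \<Longrightarrow> gs @ bs \<approx> hs @ bs"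
  using word_eq_context[of gs hs "[]" bs] by simp

lemma word_null_left: "word_null gs \<Longrightarrow> set as \<subseteq> gens G \<Longrightarrow> word_null (as @ gs)"
  using word_null_context[of gs as "[]"] by simp

lemma word_null_right: "word_null gs \<Longrightarrow> set bs \<subseteq> gens G \<Longrightarrow> word_null (gs @ bs)"
  using word_null_context[of gs "[]" bs] by simp

lemma word_eq_relation:
  assumes "gn g * gn h - gn i \<in> lpa_relations K G"
  shows "[g, h] \<approx> [i]"
  unfolding word_eq_def
proof
  fix k :: 'k
  have "mono_word [] k * (gn g * gn h - gn i) \<in> Rel"
    by (rule lpa_relation_ideal_closed(5)[OF lpa_relations_in_ideal[OF assms]]) (simp add: mono_word_carrier)
  then show "mono_word [g, h] k - mono_word [i] k \<in> Rel"
    by (simp add: gn_def right_diff_distrib mono_word_mult mult.assoc[symmetric])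
qed

lemma word_null_relation:
  assumes "gn g * gn h \<in> lpa_relations K G"
  shows "word_null [g, h]"
  unfolding word_null_def
proof
  fix k :: 'k
  have "mono_word [] k * (gn g * gn h) \<in> Rel"
    by (rule lpa_relation_ideal_closed(5)[OF lpa_relations_in_ideal[OF assms]]) (simp add: mono_word_carrier)
  then show "mono_word [g, h] k \<in> Rel"
    by (simp add: gn_def mono_word_mult mult.assoc[symmetric])
qed

lemma vert_vert:
  assumes "u \<in> verts G" shows "[Vert u, Vert u] \<approx> [Vert u]"
proof -
  have "gn (Vert u) * gn (Vert u) - (if u = u then gn (Vert u) else 0) \<in> lpa_relations K G"
    unfolding lpa_relations_def using assms by blast
  then show ?thesis by (intro word_eq_relation) simp
qed

lemma vert_vert_null:
  assumes "u \<in> verts G" "w \<in> verts G" "u \<noteq> w" shows "word_null [Vert u, Vert w]"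
proof -
  have "gn (Vert u) * gn (Vert w) - (if u = w then gn (Vert u) else 0) \<in> lpa_relations K G"
    unfolding lpa_relations_def using assms by blast
  then show ?thesis using assms(3) by (intro word_null_relation) simp
qed

lemma tail_edge: "e \<in> arcs G \<Longrightarrow> [Vert (tail G e), Edge e] \<approx> [Edge e]"
  and edge_head: "e \<in> arcs G \<Longrightarrow> [Edge e, Vert (head G e)] \<approx> [Edge e]"
  and head_ghost: "e \<in> arcs G \<Longrightarrow> [Vert (head G e), Ghost e] \<approx> [Ghost e]"
  and ghost_tail: "e \<in> arcs G \<Longrightarrow> [Ghost e, Vert (tail G e)] \<approx> [Ghost e]"
  by (rule word_eq_relation, unfold lpa_relations_def, blast)+

lemma ghost_edge:
  assumes "e \<in> arcs G" shows "[Ghost e, Edge e] \<approx> [Vert (head G e)]"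
proof -
  have "gn (Ghost e) * gn (Edge e) - (if e = e then gn (Vert (head G e)) else 0) \<in> lpa_relations K G"
    unfolding lpa_relations_def using assms by blast
  then show ?thesis by (intro word_eq_relation) simp
qed

lemma ghost_edge_null:
  assumes "e \<in> arcs G" "f \<in> arcs G" "e \<noteq> f" shows "word_null [Ghost e, Edge f]"
proof -
  have "gn (Ghost e) * gn (Edge f) - (if e = f then gn (Vert (head G e)) else 0) \<in> lpa_relations K G"
    unfolding lpa_relations_def using assms by blast
  then show ?thesis using assms(3) by (intro word_null_relation) simp
qed

lemma path_word_gens: "awalk u p x \<Longrightarrow> set (path_word (u, p)) \<subseteq> gens G"
  by (auto simp: awalk_def)

lemma ghost_word_gens: "awalk u p x \<Longrightarrow> set (ghost_word (u, p)) \<subseteq> gens G"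
  by (auto simp: awalk_def)

lemma path_word_Cons: "awalk u (e # p) x \<Longrightarrow> path_word (u, e # p) \<approx> [Edge e] @ path_word (head G e, p)"
  using edge_head[THEN word_eq_sym, of e] by (auto simp: awalk_Cons_iff)

lemma source_path: "awalk u p x \<Longrightarrow> [Vert u] @ path_word (u, p) \<approx> path_word (u, p)"
proof (cases p)
  case Nil
  moreover assume "awalk u p x"
  ultimately show ?thesis using vert_vert by (auto simp: awalk_Nil_iff)
next
  case (Cons e q)
  moreover assume "awalk u p x"
  ultimately have e: "e \<in> arcs G" "u = tail G e" "awalk (head G e) q x" by (auto simp: awalk_Cons_iff)
  have "set (map Edge q) \<subseteq> gens G" using e(3) by (auto simp: awalk_def)
  from word_eq_right[OF tail_edge[OF e(1)] this] show ?thesis using Cons e(2) by simp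
qed

lemma path_range: "awalk u p x \<Longrightarrow> path_word (u, p) @ [Vert x] \<approx> path_word (u, p)"
proof (cases p rule: rev_cases)
  case Nil
  moreover assume "awalk u p x"
  ultimately show ?thesis using vert_vert by (auto simp: awalk_Nil_iff)
next
  case (snoc q e)
  moreover assume "awalk u p x"
  ultimately have e: "e \<in> arcs G" "x = head G e" "awalk u q (tail G e)" by (auto simp: awalk_simps)
  have "set (map Edge q) \<subseteq> gens G" using e(3) by (auto simp: awalk_def)
  from word_eq_left[OF edge_head[OF e(1)] this] show ?thesis using snoc e(2) by simp
qed

lemma range_ghost: "awalk w q x \<Longrightarrow> [Vert x] @ ghost_word (w, q) \<approx> ghost_word (w, q)"
proof (cases q rule: rev_cases)
  case Nil
  moreover assume "awalk w q x"
  ultimately show ?thesis using vert_vert by (auto simp: awalk_Nil_iff)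
next
  case (snoc r e)
  moreover assume "awalk w q x"
  ultimately have e: "e \<in> arcs G" "x = head G e" "awalk w r (tail G e)" by (auto simp: awalk_simps)
  have "set (map Ghost (rev r)) \<subseteq> gens G" using e(3) by (auto simp: awalk_def)
  from word_eq_right[OF head_ghost[OF e(1)] this] show ?thesis using snoc e(2) by simp
qed

lemma path_snoc: "awalk u p (tail G e) \<Longrightarrow> e \<in> arcs G \<Longrightarrow> path_word (u, p) @ [Edge e] \<approx> path_word (u, p @ [e])"
  using tail_edge[of e] by (cases p) (auto simp: awalk_Nil_iff)

lemma ghost_snoc: "awalk w q (tail G e) \<Longrightarrow> e \<in> arcs G \<Longrightarrow> [Ghost e] @ ghost_word (w, q) \<approx> ghost_word (w, q @ [e])"
  using ghost_tail[of e] by (cases q) (auto simp: awalk_Nil_iff)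

definition path_pair :: "('v \<times> 'e list) \<times> ('v \<times> 'e list) \<Rightarrow> 'v \<Rightarrow> bool" where
  "path_pair z x \<longleftrightarrow> awalk (fst (fst z)) (snd (fst z)) x \<and> awalk (fst (snd z)) (snd (snd z)) x"

definition pair_word :: "('v \<times> 'e list) \<times> ('v \<times> 'e list) \<Rightarrow> ('v, 'e) gen list" where
  "pair_word z = path_word (fst z) @ ghost_word (snd z)"

lemma path_pair_iff [simp]: "path_pair ((u, p), (w, q)) x \<longleftrightarrow> awalk u p x \<and> awalk w q x"
  by (simp add: path_pair_def)

text \<open>A product of generators is either zero or a single \<open>pq\<^sup>*\<close> with common
  range. This shape is stable under prefixing a generator, which leads to the usual spanning
  set.\<close>

definition reducible_word :: "('v, 'e) gen list \<Rightarrow> bool" where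
  "reducible_word gs \<longleftrightarrow> word_null gs \<or> (\<exists>z x. path_pair z x \<and> gs \<approx> pair_word z)"

lemma reducible_word_eq: "gs \<approx> hs \<Longrightarrow> reducible_word hs \<Longrightarrow> reducible_word gs"
  unfolding reducible_word_def using word_null_eq word_eq_trans by blast

lemma reducible_wordI: "path_pair z x \<Longrightarrow> gs \<approx> pair_word z \<Longrightarrow> reducible_word gs"
  unfolding reducible_word_def by blast

lemma reducible_word_null: "word_null gs \<Longrightarrow> reducible_word gs"
  unfolding reducible_word_def by blast

text \<open>Generators that do not fit produce a product of two distinct vertices or of a ghost with
  another edge, hence zero. A fitting ghost cancels the first edge of \<open>p\<close>; if
  \<open>p\<close> is empty, it lengthens \<open>q\<close> instead.\<close>

lemma reducible_gen_pair:
  assumes g: "g \<in> gens G" and z: "path_pair z x"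
  shows "reducible_word (g # pair_word z)"
proof -
  obtain u p w q where zz: "z = ((u, p), (w, q))" by (metis prod.collapse)
  have up: "awalk u p x" and wq: "awalk w q x" using z zz by auto
  have u: "u \<in> verts G" using up by auto
  have pw: "set (path_word (u, p)) \<subseteq> gens G" and gw: "set (ghost_word (w, q)) \<subseteq> gens G"
    using path_word_gens[OF up] ghost_word_gens[OF wq] by auto
  let ?P = "path_word (u, p)" and ?Q = "ghost_word (w, q)"
  have word: "pair_word z = ?P @ ?Q" by (simp add: zz pair_word_def)
  show ?thesis
  proof (cases g)
    case (Vert y)
    then have y: "y \<in> verts G" using g by simp
    show ?thesis
    proof (cases "y = u")
      case True
      have "[Vert u] @ ?P @ ?Q \<approx> ?P @ ?Q"
        using word_eq_right[OF source_path[OF up] gw] by simp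
      then show ?thesis
        using reducible_wordI[OF z] Vert True word by simp
    next
      case False
      have "word_null ([Vert y, Vert u] @ ?P @ ?Q)"
        by (rule word_null_right[OF vert_vert_null[OF y u False]]) (use pw gw in auto)
      moreover have "[Vert y] @ ?P @ ?Q \<approx> [Vert y] @ ([Vert u] @ ?P) @ ?Q"
        by (rule word_eq_context[OF word_eq_sym[OF source_path[OF up]]]) (use y gw in auto)
      ultimately show ?thesis
        using word_null_eq Vert word by (auto intro!: reducible_word_null)
    qed
  next
    case (Edge e)
    then have e: "e \<in> arcs G" using g by simp
    show ?thesis
    proof (cases "head G e = u")
      case True
      then have ep: "awalk (tail G e) (e # p) x" using up e by (simp add: awalk_Cons_iff)
      have "([Edge e] @ ?P) @ ?Q \<approx> path_word (tail G e, e # p) @ ?Q"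
        using word_eq_right[OF word_eq_sym[OF path_word_Cons[OF ep]] gw] True by simp
      then show ?thesis
        using ep wq Edge word by (intro reducible_wordI[of "((tail G e, e # p), (w, q))" x])
          (simp_all add: pair_word_def)
    next
      case False
      have "word_null ([Edge e] @ [Vert (head G e), Vert u] @ ?P @ ?Q)"
        by (rule word_null_context[OF vert_vert_null]) (use e u False pw gw in auto)
      moreover have "[Edge e] @ ?P @ ?Q \<approx> [Edge e, Vert (head G e)] @ ?P @ ?Q"
        using word_eq_right[OF word_eq_sym[OF edge_head[OF e]], of "?P @ ?Q"] pw gw by simp
      moreover have "[Edge e, Vert (head G e)] @ ?P @ ?Q \<approx> [Edge e, Vert (head G e)] @ ([Vert u] @ ?P) @ ?Q"
        by (rule word_eq_context[OF word_eq_sym[OF source_path[OF up]]]) (use e gw in auto)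
      ultimately show ?thesis
        using word_null_eq Edge word by (auto intro!: reducible_word_null)
    qed
  next
    case (Ghost e)
    then have e: "e \<in> arcs G" using g by simp
    show ?thesis
    proof (cases p)
      case (Cons f p')
      then have f: "f \<in> arcs G" "u = tail G f" "awalk (head G f) p' x"
        using up by (auto simp: awalk_Cons_iff)
      have p'g: "set (map Edge p') \<subseteq> gens G" using f(3) by (auto simp: awalk_def)
      show ?thesis
      proof (cases "e = f")
        case True
        have "[Ghost e, Edge e] @ map Edge p' \<approx> [Vert (head G e)] @ map Edge p'"
          by (rule word_eq_right[OF ghost_edge[OF e] p'g])
        also have "[Vert (head G e)] @ map Edge p' \<approx> path_word (head G e, p')"
          using source_path[OF f(3)] True by (cases p') simp_all
        finally have "([Ghost e, Edge e] @ map Edge p') @ ?Q \<approx> path_word (head G e, p') @ ?Q"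
          by (rule word_eq_right) (rule gw)
        then show ?thesis
          using f(3) wq Ghost word True Cons by (intro reducible_wordI[of "((head G e, p'), (w, q))" x])
            (simp_all add: pair_word_def)
      next
        case False
        have "word_null ([Ghost e, Edge f] @ map Edge p' @ ?Q)"
          by (rule word_null_right[OF ghost_edge_null[OF e f(1) False]]) (use p'g gw in auto)
        then show ?thesis using Ghost word Cons by (intro reducible_word_null) simp
      qed
    next
      case Nil
      then have x: "u = x" "?P = [Vert x]" using up by (auto simp: awalk_Nil_iff)
      show ?thesis
      proof (cases "tail G e = x")
        case True
        then have q': "awalk w (q @ [e]) (head G e)"
          using wq arc_implies_awalk[OF e] awalk_appendI by blast
        have "[Ghost e, Vert x] @ ?Q \<approx> [Ghost e] @ ?Q"
          using word_eq_right[OF ghost_tail[OF e] gw] True by simp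
        also have "[Ghost e] @ ?Q \<approx> ghost_word (w, q @ [e])"
          using ghost_snoc wq e True by simp
        also have "ghost_word (w, q @ [e]) \<approx> [Vert (head G e)] @ ghost_word (w, q @ [e])"
          by (rule word_eq_sym[OF range_ghost[OF q']])
        finally show ?thesis
          using q' e Ghost word x by (intro reducible_wordI[of "((head G e, []), (w, q @ [e]))" "head G e"])
            (simp_all add: pair_word_def awalk_Nil_iff)
      next
        case False
        have "word_null ([Ghost e] @ [Vert (tail G e), Vert x] @ ?Q)"
          by (rule word_null_context[OF vert_vert_null]) (use e u x False gw in auto)
        moreover have "[Ghost e] @ [Vert x] @ ?Q \<approx> [Ghost e, Vert (tail G e)] @ [Vert x] @ ?Q"
          using word_eq_right[OF word_eq_sym[OF ghost_tail[OF e]], of "[Vert x] @ ?Q"] gw u x by simp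
        ultimately show ?thesis
          using word_null_eq Ghost word x by (auto intro!: reducible_word_null)
      qed
    qed
  qed
qed

lemma reducible_word:
  assumes "set gs \<subseteq> gens G" "gs \<noteq> []"
  shows "reducible_word gs"
proof -
  \<comment> \<open>The induction prefixes generators and has to start from some
    \<open>pq\<^sup>*\<close>. The range vertex of the last letter can be appended without changing
    the class, and as a product of two trivial paths it is such a start.\<close>
  have "reducible_word (gs @ [Vert u])" if "u \<in> verts G" "set gs \<subseteq> gens G" for u gs
    using that(2)
  proof (induction gs)
    case Nil
    have "[Vert u] \<approx> pair_word ((u, []), (u, []))"
      using vert_vert[OF that(1)] by (auto simp: pair_word_def intro: word_eq_sym)
    then show ?case
      using that(1) by (intro reducible_wordI[of "((u, []), (u, []))" u]) (simp_all add: awalk_Nil_iff)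
  next
    case (Cons g gs)
    then have g: "g \<in> gens G" "set gs \<subseteq> gens G" "reducible_word (gs @ [Vert u])" by auto
    show ?case
    proof (cases "word_null (gs @ [Vert u])")
      case True
      then show ?thesis using word_null_left[OF True, of "[g]"] g(1) by (auto intro: reducible_word_null)
    next
      case False
      then obtain z x where z: "path_pair z x" "gs @ [Vert u] \<approx> pair_word z"
        using g(3) unfolding reducible_word_def by blast
      have "[g] @ gs @ [Vert u] \<approx> [g] @ pair_word z"
        by (rule word_eq_left[OF z(2)]) (use g in simp)
      then show ?thesis using reducible_word_eq reducible_gen_pair[OF g(1) z(1)] by simp
    qed
  qed
  moreover have "\<exists>u\<in>verts G. gs @ [Vert u] \<approx> gs"
  proof -
    obtain hs g where gs: "gs = hs @ [g]" using assms(2) by (cases gs rule: rev_cases) auto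
    have "\<exists>u\<in>verts G. [g, Vert u] \<approx> [g]"
    proof (cases g)
      case (Vert u)
      then show ?thesis using vert_vert assms(1) gs by auto
    next
      case (Edge e)
      then show ?thesis using edge_head assms(1) gs by (intro bexI[of _ "head G e"]) auto
    next
      case (Ghost e)
      then show ?thesis using ghost_tail assms(1) gs by (intro bexI[of _ "tail G e"]) auto
    qed
    then obtain u where u: "u \<in> verts G" "[g, Vert u] \<approx> [g]" by blast
    have "hs @ [g, Vert u] \<approx> hs @ [g]" by (rule word_eq_left[OF u(2)]) (use assms(1) gs in auto)
    with u(1) gs show ?thesis by auto
  qed
  ultimately show ?thesis using assms(1) reducible_word_eq word_eq_sym by blast
qed

end

section \<open>Two-sided ideals of rings without identity\<close>

lemma nonunital_ideal_Inter:
  assumes "abelian_group A" "\<I> \<noteq> {}" "\<And>I. I \<in> \<I> \<Longrightarrow> nonunital_ideal I A"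
  shows "nonunital_ideal (\<Inter>\<I>) A"
proof -
  interpret abelian_group A by fact
  have "subgroup (\<Inter>\<I>) (add_monoid A)"
    using assms(2,3) by (intro add.subgroups_Inter)
      (auto simp: nonunital_ideal_def additive_subgroup_def)
  then show ?thesis
    using assms(3) by (auto simp: nonunital_ideal_def additive_subgroup_def)
qed

lemma nonunital_ideal_generated:
  assumes "abelian_group A" "nonunital_ideal I A" "S \<subseteq> I"
  shows "nonunital_ideal (generated_ideal A S) A" "generated_ideal A S \<subseteq> I" "S \<subseteq> generated_ideal A S"
  unfolding generated_ideal_def using assms by (auto intro!: nonunital_ideal_Inter)

lemma (in weighted_branching) nonunital_ideal_annihilator:
  "nonunital_ideal (annihilator (leavitt K G) the_module) (leavitt K G)"
proof -
  interpret L: abelian_group "leavitt K G" by (rule abelian_group_leavitt)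
  let ?Z = "annihilator (leavitt K G) the_module"
  have elem: "A \<in> ?Z \<longleftrightarrow> (\<exists>a\<in>lpa_reps K G. A = lpa_class K G a \<and> (\<forall>m\<in>V. free_action C \<iota> act a m = zero_vec C))" for A
    by (auto simp: annihilator_def carrier_leavitt lpa_reps_carrier)
  have zero: "free_action C \<iota> act b (zero_vec C) = zero_vec C" for b
    by (rule lin_map_zero[OF lin_map_free_action])
  have "subgroup ?Z (add_monoid (leavitt K G))"
  proof (rule L.add.subgroupI)
    show "?Z \<subseteq> carrier (leavitt K G)" by (auto simp: annihilator_def)
    have "lpa_class K G 0 \<in> ?Z" unfolding elem by (intro bexI[of _ 0]) auto
    then show "?Z \<noteq> {}" by blast
  next
    fix A assume "A \<in> ?Z"
    then obtain a where a: "a \<in> lpa_reps K G" "A = lpa_class K G a"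
        "\<forall>m\<in>V. free_action C \<iota> act a m = zero_vec C"
      unfolding elem by blast
    have "free_action C \<iota> act (- a) m = zero_vec C" if "m \<in> V" for m
      using free_action_diff_eq_zero_iff[OF that, of 0 a] a(3) that by simp
    then show "\<ominus>\<^bsub>leavitt K G\<^esub> A \<in> ?Z"
      unfolding elem using a lpa_reps_closed(2)[OF a(1)] leavitt_a_inv[OF a(1)] by blast
  next
    fix A A' assume "A \<in> ?Z" "A' \<in> ?Z"
    then obtain a a' where a: "a \<in> lpa_reps K G" "A = lpa_class K G a"
        "\<forall>m\<in>V. free_action C \<iota> act a m = zero_vec C" "a' \<in> lpa_reps K G" "A' = lpa_class K G a'"
        "\<forall>m\<in>V. free_action C \<iota> act a' m = zero_vec C"
      unfolding elem by blast
    then have "A \<oplus>\<^bsub>leavitt K G\<^esub> A' = lpa_class K G (a + a')"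
      by (simp add: leavitt_ops lpa_reps_carrier)
    moreover have "a + a' \<in> lpa_reps K G" using a by blast
    moreover have "free_action C \<iota> act (a + a') m = zero_vec C" if "m \<in> V" for m
      using a that by (simp add: free_action_add add_vec_zero[OF zero_vec_closed])
    ultimately show "A \<oplus>\<^bsub>leavitt K G\<^esub> A' \<in> ?Z" unfolding elem by blast
  qed
  moreover have "r \<otimes>\<^bsub>leavitt K G\<^esub> A \<in> ?Z \<and> A \<otimes>\<^bsub>leavitt K G\<^esub> r \<in> ?Z"
    if A: "A \<in> ?Z" and r: "r \<in> carrier (leavitt K G)" for A r
  proof -
    obtain a where a: "a \<in> lpa_reps K G" "A = lpa_class K G a"
        "\<forall>m\<in>V. free_action C \<iota> act a m = zero_vec C"
      using A unfolding elem by blast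
    obtain b where b: "b \<in> lpa_reps K G" "r = lpa_class K G b"
      using r by (auto simp: carrier_leavitt)
    have "r \<otimes>\<^bsub>leavitt K G\<^esub> A = lpa_class K G (b * a)" "A \<otimes>\<^bsub>leavitt K G\<^esub> r = lpa_class K G (a * b)"
      using a b by (simp_all add: leavitt_ops lpa_reps_carrier)
    moreover have "b * a \<in> lpa_reps K G" "a * b \<in> lpa_reps K G"
      using a b lpa_reps_carrier lpa_reps_closed by blast+
    moreover have "\<forall>m\<in>V. free_action C \<iota> act (b * a) m = zero_vec C"
      "\<forall>m\<in>V. free_action C \<iota> act (a * b) m = zero_vec C"
      using a zero by (auto simp: free_action_mult)
    ultimately show ?thesis unfolding elem by blast
  qed
  ultimately show ?thesis
    by (auto simp: nonunital_ideal_def additive_subgroup_def)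
qed

declare path_word.simps [simp del] ghost_word.simps [simp del]

text \<open>\<open>J\<close> is the preimage of \<open>I\<close> in the free algebra, where
  calculations modulo \<open>I\<close> take place. The detour through \<open>b\<close> respects that
  \<open>I\<close> consists of classes without constant term.\<close>

locale leavitt_ideal = leavitt_words K G
  for K :: "'k::field itself" and G :: "('v, 'e) pre_digraph" +
  fixes I :: "('v, 'e, 'k) lpa_elem set" and J :: "('v, 'e, 'k) free_elem set"
  assumes I: "nonunital_ideal I (leavitt K G)"
    and J_def: "J = {a. \<exists>b\<in>lpa_reps K G. lpa_class K G b \<in> I \<and> a - b \<in> lpa_relation_ideal K G}"
begin

lemma JI: "\<lbrakk>b \<in> lpa_reps K G; lpa_class K G b \<in> I; a - b \<in> Rel\<rbrakk> \<Longrightarrow> a \<in> J"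
  unfolding J_def by blast

lemma JE:
  assumes "a \<in> J"
  obtains b where "b \<in> lpa_reps K G" "lpa_class K G b \<in> I" "a - b \<in> Rel"
  using assms unfolding J_def by blast

lemma I_closed:
  assumes "a \<in> lpa_reps K G" "lpa_class K G a \<in> I"
  shows "b \<in> lpa_reps K G \<Longrightarrow> lpa_class K G b \<in> I \<Longrightarrow> lpa_class K G (a + b) \<in> I"
    "lpa_class K G (- a) \<in> I"
    "r \<in> lpa_reps K G \<Longrightarrow> lpa_class K G (r * a) \<in> I"
    "r \<in> lpa_reps K G \<Longrightarrow> lpa_class K G (a * r) \<in> I"
proof -
  interpret additive_subgroup I "leavitt K G" using I by (simp add: nonunital_ideal_def)
  interpret L: abelian_group "leavitt K G" by (rule abelian_group_leavitt)
  show "b \<in> lpa_reps K G \<Longrightarrow> lpa_class K G b \<in> I \<Longrightarrow> lpa_class K G (a + b) \<in> I"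
    using a_closed[OF assms(2), of "lpa_class K G b"] assms(1) by (simp add: leavitt_ops lpa_reps_carrier)
  show "lpa_class K G (- a) \<in> I"
    using additive_subgroup.a_inv_closed[OF additive_subgroup_axioms assms(2)] leavitt_a_inv[OF assms(1)] by simp
  have I': "r \<otimes>\<^bsub>leavitt K G\<^esub> lpa_class K G a \<in> I \<and> lpa_class K G a \<otimes>\<^bsub>leavitt K G\<^esub> r \<in> I"
    if "r \<in> carrier (leavitt K G)" for r
    using I assms(2) that by (auto simp: nonunital_ideal_def)
  show "r \<in> lpa_reps K G \<Longrightarrow> lpa_class K G (r * a) \<in> I"
    "r \<in> lpa_reps K G \<Longrightarrow> lpa_class K G (a * r) \<in> I"
    using I'[of "lpa_class K G r"] assms(1) by (auto simp: carrier_leavitt leavitt_ops lpa_reps_carrier)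
qed

lemma Rel_J: "a \<in> Rel \<Longrightarrow> a \<in> J"
proof -
  interpret additive_subgroup I "leavitt K G" using I by (simp add: nonunital_ideal_def)
  assume "a \<in> Rel"
  moreover have "lpa_class K G 0 \<in> I" using zero_closed by (simp add: leavitt_zero)
  ultimately show ?thesis by (intro JI[of 0]) auto
qed

lemma J_add: "a \<in> J \<Longrightarrow> b \<in> J \<Longrightarrow> a + b \<in> J"
proof -
  assume "a \<in> J" "b \<in> J"
  then obtain a' b' where ab: "a' \<in> lpa_reps K G" "lpa_class K G a' \<in> I" "a - a' \<in> Rel"
      "b' \<in> lpa_reps K G" "lpa_class K G b' \<in> I" "b - b' \<in> Rel"
    by (elim JE)
  have "(a - a') + (b - b') \<in> Rel" by (rule lpa_relation_ideal_closed(1)) (use ab in auto)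
  then show ?thesis
    using ab I_closed(1)[of a' b'] by (intro JI[of "a' + b'"]) (auto simp: algebra_simps)
qed

lemma J_sum: "(\<And>i. i \<in> A \<Longrightarrow> f i \<in> J) \<Longrightarrow> sum f A \<in> J"
  using Rel_J[of 0] by (induction A rule: infinite_finite_induct) (auto intro: J_add)

lemma J_mult: "a \<in> J \<Longrightarrow> r \<in> lpa_reps K G \<Longrightarrow> r * a \<in> J" "a \<in> J \<Longrightarrow> r \<in> lpa_reps K G \<Longrightarrow> a * r \<in> J"
proof -
  assume "a \<in> J" and r: "r \<in> lpa_reps K G"
  then obtain a' where a: "a' \<in> lpa_reps K G" "lpa_class K G a' \<in> I" "a - a' \<in> Rel"
    by (elim JE)
  have rc: "r \<in> carrier (free_algebra K G)" using r by (rule lpa_reps_carrier)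
  have "r * (a - a') \<in> Rel" by (rule lpa_relation_ideal_closed(5)[OF a(3) rc])
  then show "r * a \<in> J"
    using a I_closed(3)[of a' r] r rc lpa_reps_closed(4)[OF a(1) rc]
    by (intro JI[of "r * a'"]) (auto simp: algebra_simps)
  have "(a - a') * r \<in> Rel" by (rule lpa_relation_ideal_closed(6)[OF a(3) rc])
  then show "a * r \<in> J"
    using a I_closed(4)[of a' r] r rc lpa_reps_closed(5)[OF a(1) rc]
    by (intro JI[of "a' * r"]) (auto simp: algebra_simps)
qed

lemma word_eq_J: "gs \<approx> hs \<Longrightarrow> mono_word gs k - mono_word hs k \<in> J"
  using Rel_J by (simp add: word_eq_def)

lemma path_word_nonempty [simp]: "path_word z \<noteq> []" "ghost_word z \<noteq> []"
  by (cases z; simp add: path_word.simps ghost_word.simps)+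

lemma path_mono_reps:
  "awalk u p x \<Longrightarrow> mono_word (path_word (u, p)) k \<in> lpa_reps K G"
  "awalk u p x \<Longrightarrow> mono_word (ghost_word (u, p)) k \<in> lpa_reps K G"
  by (rule lpa_reps_single; simp add: path_word_gens ghost_word_gens)+

lemma pair_word_range:
  assumes "path_pair ((u, p), (w, q)) x"
  shows "pair_word ((u, p), (w, q)) \<approx> path_word (u, p) @ [Vert x] @ ghost_word (w, q)"
  using word_eq_right[OF word_eq_sym[OF path_range], of u p x "ghost_word (w, q)"] assms
    ghost_word_gens[of w q x]
  by (simp add: pair_word_def)

text \<open>The range vertex can be inserted between \<open>e\<close> and \<open>e\<^sup>*\<close>,
  which turns the product into a multiple of an element of \<open>J\<close>.\<close>

lemma edge_ghost_in_J:
  assumes "e \<in> arcs G" "gn (Vert (head G e)) \<in> J"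
  shows "gn (Edge e) * gn (Ghost e) \<in> J"
proof -
  have "gn (Edge e) * gn (Vert (head G e)) * gn (Ghost e) \<in> J"
    using assms by (intro J_mult lpa_reps_gn) simp_all
  moreover have "[Edge e] @ [Ghost e] \<approx> [Edge e, Vert (head G e)] @ [Ghost e]"
    by (rule word_eq_right[OF word_eq_sym[OF edge_head]]) (use assms(1) in simp_all)
  then have "gn (Edge e) * gn (Ghost e) - gn (Edge e) * gn (Vert (head G e)) * gn (Ghost e) \<in> J"
    using word_eq_J[of _ _ 1] by (simp add: gn_def mono_word_mult)
  ultimately show ?thesis using J_add by fastforce
qed

end

text \<open>Modulo \<open>I\<close> the vertices outside \<open>R\<close> vanish, and a vertex of
  \<open>R\<close> with finitely many edges into \<open>R\<close> becomes the sum of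
  \<open>ee\<^sup>*\<close> over these edges, as at a regular vertex of the subgraph spanned by
  \<open>R\<close>. Apart from the ideal properties, the normal form rests on these two
  facts.\<close>

locale leavitt_ideal_cuntz_krieger = leavitt_ideal K G I J
  for K :: "'k::field itself" and G :: "('v, 'e) pre_digraph"
    and I :: "('v, 'e, 'k) lpa_elem set" and J :: "('v, 'e, 'k) free_elem set" +
  fixes R :: "'v set"
  assumes vertex_in_J: "\<lbrakk>x \<in> verts G; x \<notin> R\<rbrakk> \<Longrightarrow> gn (Vert x) \<in> J"
    and cuntz_krieger_in_J: "\<lbrakk>x \<in> R; finite {e \<in> out_arcs G x. head G e \<in> R}\<rbrakk> \<Longrightarrow>
      gn (Vert x) - (\<Sum>e\<in>{e \<in> out_arcs G x. head G e \<in> R}. gn (Edge e) * gn (Ghost e)) \<in> J"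
begin

lemma pair_word_outside:
  assumes z: "path_pair z x" and x: "x \<notin> R"
  shows "mono_word (pair_word z) k \<in> J"
proof -
  obtain u p w q where zz: "z = ((u, p), (w, q))" by (metis prod.collapse)
  have up: "awalk u p x" and wq: "awalk w q x" using z zz by auto
  have "gn (Vert x) \<in> J" using vertex_in_J up x by auto
  then have "mono_word (path_word (u, p)) k * gn (Vert x) * mono_word (ghost_word (w, q)) 1 \<in> J"
    by (intro J_mult path_mono_reps[OF up] path_mono_reps[OF wq])
  then have *: "mono_word (path_word (u, p) @ [Vert x] @ ghost_word (w, q)) k \<in> J"
    by (simp add: gn_def mono_word_mult)
  have "pair_word z \<approx> path_word (u, p) @ [Vert x] @ ghost_word (w, q)"
    using pair_word_range z zz by simp
  from J_add[OF word_eq_J[OF this, of k] *] show ?thesis by simp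
qed

fun extend_pair :: "('v \<times> 'e list) \<times> ('v \<times> 'e list) \<Rightarrow> 'e \<Rightarrow> ('v \<times> 'e list) \<times> ('v \<times> 'e list)" where
  "extend_pair ((u, p), (w, q)) e = ((u, p @ [e]), (w, q @ [e]))"

abbreviation out_R :: "'v \<Rightarrow> 'e set" where "out_R x \<equiv> {e \<in> out_arcs G x. head G e \<in> R}"

text \<open>Insert the range \<open>x\<close> between \<open>p\<close> and \<open>q\<^sup>*\<close>
  and replace it by the sum of \<open>ee\<^sup>*\<close> over the edges into
  \<open>R\<close>.\<close>

lemma pair_word_expand:
  assumes z: "path_pair z x" and x: "x \<in> R" "finite (out_R x)"
  shows "mono_word (pair_word z) k - (\<Sum>e\<in>out_R x. mono_word (pair_word (extend_pair z e)) k) \<in> J"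
proof -
  obtain u p w q where zz: "z = ((u, p), (w, q))" by (metis prod.collapse)
  have up: "awalk u p x" and wq: "awalk w q x" using z zz by auto
  let ?P = "path_word (u, p)" and ?Q = "ghost_word (w, q)"
  have "mono_word ?P k * (gn (Vert x) - (\<Sum>e\<in>out_R x. gn (Edge e) * gn (Ghost e))) * mono_word ?Q 1 \<in> J"
    using cuntz_krieger_in_J[OF x] by (intro J_mult path_mono_reps[OF up] path_mono_reps[OF wq])
  then have 1: "mono_word (?P @ [Vert x] @ ?Q) k - (\<Sum>e\<in>out_R x. mono_word (?P @ [Edge e, Ghost e] @ ?Q) k) \<in> J"
    by (simp add: gn_def mono_word_mult right_diff_distrib left_diff_distrib sum_distrib_left
        sum_distrib_right)
  have ext: "?P @ [Edge e, Ghost e] @ ?Q \<approx> pair_word (extend_pair z e)" if "e \<in> out_R x" for e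
  proof -
    have e: "e \<in> arcs G" "tail G e = x" using that by auto
    have "(?P @ [Edge e]) @ ([Ghost e] @ ?Q) \<approx> path_word (u, p @ [e]) @ ([Ghost e] @ ?Q)"
      by (rule word_eq_right[OF path_snoc]) (use up e ghost_word_gens[OF wq] in auto)
    also have "path_word (u, p @ [e]) @ ([Ghost e] @ ?Q) \<approx> path_word (u, p @ [e]) @ ghost_word (w, q @ [e])"
    proof (rule word_eq_left[OF ghost_snoc])
      show "awalk w q (tail G e)" "e \<in> arcs G" using wq e by auto
      have "set p \<subseteq> arcs G" using up by (auto simp: awalk_def)
      then show "set (path_word (u, p @ [e])) \<subseteq> gens G" using e by (auto simp: path_word.simps)
    qed
    finally show ?thesis by (simp add: zz pair_word_def)
  qed
  have "(\<Sum>e\<in>out_R x. mono_word (?P @ [Edge e, Ghost e] @ ?Q) k - mono_word (pair_word (extend_pair z e)) k) \<in> J"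
    using word_eq_J[OF ext] by (rule J_sum)
  then have 2: "(\<Sum>e\<in>out_R x. mono_word (?P @ [Edge e, Ghost e] @ ?Q) k)
      - (\<Sum>e\<in>out_R x. mono_word (pair_word (extend_pair z e)) k) \<in> J"
    by (simp only: sum_subtractf)
  have "pair_word z \<approx> ?P @ [Vert x] @ ?Q"
    using pair_word_range z zz by simp
  from J_add[OF J_add[OF word_eq_J[OF this, of k] 1] 2] show ?thesis
    by (simp)
qed

definition normal_pairs :: "nat \<Rightarrow> (('v \<times> 'e list) \<times> ('v \<times> 'e list)) set" where
  "normal_pairs n = {z. \<exists>x\<in>R. path_pair z x \<and>
     (length (snd (snd z)) = n \<or> length (snd (snd z)) < n \<and> infinite (out_R x))}"

definition normalizable :: "nat \<Rightarrow> ('v, 'e, 'k) free_elem set" where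
  "normalizable n = {a. \<exists>F f. finite F \<and> F \<subseteq> normal_pairs n \<and>
     a - (\<Sum>z\<in>F. mono_word (pair_word z) (f z)) \<in> J}"

lemma normalizable_J: "a \<in> J \<Longrightarrow> a \<in> normalizable n"
  unfolding normalizable_def by (auto intro!: exI[of _ "{}"])

lemma normalizable_single: "z \<in> normal_pairs n \<Longrightarrow> mono_word (pair_word z) k \<in> normalizable n"
  unfolding normalizable_def using Rel_J[of 0] by (auto intro!: exI[of _ "{z}"] exI[of _ "\<lambda>_. k"])

lemma normalizable_add:
  assumes "a \<in> normalizable n" "b \<in> normalizable n"
  shows "a + b \<in> normalizable n"
proof -
  obtain F f where F: "finite F" "F \<subseteq> normal_pairs n" "a - (\<Sum>z\<in>F. mono_word (pair_word z) (f z)) \<in> J"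
    using assms(1) unfolding normalizable_def by blast
  obtain F' f' where F': "finite F'" "F' \<subseteq> normal_pairs n" "b - (\<Sum>z\<in>F'. mono_word (pair_word z) (f' z)) \<in> J"
    using assms(2) unfolding normalizable_def by blast
  \<comment> \<open>Coefficients are extended by zero so that both combinations run over the same
    finite set.\<close>
  define g where "g z = (if z \<in> F then f z else 0)" for z
  define g' where "g' z = (if z \<in> F' then f' z else 0)" for z
  have "(\<Sum>z\<in>F. mono_word (pair_word z) (f z)) = (\<Sum>z\<in>F \<union> F'. mono_word (pair_word z) (g z))"
    using F F' by (intro sum.mono_neutral_cong_left) (auto simp: g_def)
  moreover have "(\<Sum>z\<in>F'. mono_word (pair_word z) (f' z)) = (\<Sum>z\<in>F \<union> F'. mono_word (pair_word z) (g' z))"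
    using F F' by (intro sum.mono_neutral_cong_left) (auto simp: g'_def)
  ultimately have "(a - (\<Sum>z\<in>F. mono_word (pair_word z) (f z))) + (b - (\<Sum>z\<in>F'. mono_word (pair_word z) (f' z))) =
      a + b - (\<Sum>z\<in>F \<union> F'. mono_word (pair_word z) (g z + g' z))"
    by (simp add: single_add sum.distrib)
  moreover have "(a - (\<Sum>z\<in>F. mono_word (pair_word z) (f z))) + (b - (\<Sum>z\<in>F'. mono_word (pair_word z) (f' z))) \<in> J"
    by (rule J_add[OF F(3) F'(3)])
  ultimately show ?thesis
    unfolding normalizable_def using F(1,2) F'(1,2)
    by (intro CollectI exI[of _ "F \<union> F'"] exI[of _ "\<lambda>z. g z + g' z"]) (simp only: finite_UnI Un_least)
qed

lemma normalizable_sum: "(\<And>i. i \<in> A \<Longrightarrow> f i \<in> normalizable n) \<Longrightarrow> sum f A \<in> normalizable n"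
  using normalizable_J[OF Rel_J[of 0]]
  by (induction A rule: infinite_finite_induct) (auto intro: normalizable_add)

lemma normalizable_cong: "a - b \<in> J \<Longrightarrow> b \<in> normalizable n \<Longrightarrow> a \<in> normalizable n"
  using normalizable_add[OF normalizable_J[of "a - b" n], of b] by simp

text \<open>A pair whose range has finitely many edges into \<open>R\<close> has \<open>q\<close> of
  length exactly \<open>n\<close> and is expanded once; all others are kept. In this way summands
  with different bounds are brought to a common one.\<close>

lemma normalizable_Suc:
  assumes "a \<in> normalizable n"
  shows "a \<in> normalizable (Suc n)"
proof -
  obtain F f where F: "finite F" "F \<subseteq> normal_pairs n" "a - (\<Sum>z\<in>F. mono_word (pair_word z) (f z)) \<in> J"
    using assms unfolding normalizable_def by blast
  have "mono_word (pair_word z) (f z) \<in> normalizable (Suc n)" if "z \<in> F" for z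
  proof -
    from that F(2) obtain x where x: "x \<in> R" "path_pair z x"
        "length (snd (snd z)) = n \<or> length (snd (snd z)) < n \<and> infinite (out_R x)"
      unfolding normal_pairs_def by blast
    show ?thesis
    proof (cases "finite (out_R x)")
      case False
      then have "z \<in> normal_pairs (Suc n)" using x unfolding normal_pairs_def by auto
      then show ?thesis by (rule normalizable_single)
    next
      case True
      then have len: "length (snd (snd z)) = n" using x(3) by blast
      have "extend_pair z e \<in> normal_pairs (Suc n)" if e: "e \<in> out_R x" for e
      proof -
        obtain u p w q where zz: "z = ((u, p), (w, q))" by (metis prod.collapse)
        have "awalk x [e] (head G e)" using e arc_implies_awalk[of e] by auto
        moreover have "awalk u p x" "awalk w q x" using x(2) zz by simp_all
        ultimately have "awalk u (p @ [e]) (head G e)" "awalk w (q @ [e]) (head G e)"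
          using awalk_appendI by blast+
        then have "path_pair (extend_pair z e) (head G e)"
          unfolding zz extend_pair.simps path_pair_iff by blast
        then show ?thesis
          using e len zz unfolding normal_pairs_def by auto
      qed
      then have "(\<Sum>e\<in>out_R x. mono_word (pair_word (extend_pair z e)) (f z)) \<in> normalizable (Suc n)"
        by (intro normalizable_sum normalizable_single)
      then show ?thesis
        using pair_word_expand[OF x(2,1) True] normalizable_cong by blast
    qed
  qed
  then have "(\<Sum>z\<in>F. mono_word (pair_word z) (f z)) \<in> normalizable (Suc n)"
    by (rule normalizable_sum)
  then show ?thesis using F(3) normalizable_cong by blast
qed

lemma normalizable_mono: "n \<le> m \<Longrightarrow> a \<in> normalizable n \<Longrightarrow> a \<in> normalizable m"
  by (induction m rule: dec_induct) (auto intro: normalizable_Suc)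

lemma ex_normalizable_word:
  assumes "set gs \<subseteq> gens G" "gs \<noteq> []"
  shows "\<exists>n. mono_word gs k \<in> normalizable n"
proof (cases "word_null gs")
  case True
  then show ?thesis using Rel_J normalizable_J by (auto simp: word_null_def)
next
  case False
  then obtain z x where z: "path_pair z x" "gs \<approx> pair_word z"
    using reducible_word[OF assms] unfolding reducible_word_def by blast
  have "\<exists>n. mono_word (pair_word z) k \<in> normalizable n"
  proof (cases "x \<in> R")
    case True
    then have "z \<in> normal_pairs (length (snd (snd z)))"
      using z(1) unfolding normal_pairs_def by blast
    then show ?thesis using normalizable_single by blast
  next
    case False
    then show ?thesis using pair_word_outside[OF z(1)] normalizable_J by blast
  qed
  then show ?thesis using normalizable_cong[OF word_eq_J[OF z(2)]] by blast
qed

lemma ex_normalizable: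
  assumes "a \<in> lpa_reps K G"
  shows "\<exists>n. a \<in> normalizable n"
proof -
  have "\<exists>n. (\<Sum>w\<in>A. Poly_Mapping.single w (Poly_Mapping.lookup a w)) \<in> normalizable n"
    if "finite A" "A \<subseteq> Poly_Mapping.keys a" for A
    using that
  proof (induction A rule: finite_induct)
    case empty
    then show ?case using normalizable_J[OF Rel_J[of 0]] by auto
  next
    case (insert w A)
    then obtain n where n: "(\<Sum>w\<in>A. Poly_Mapping.single w (Poly_Mapping.lookup a w)) \<in> normalizable n" by auto
    obtain gs where gs: "w = NC_Word gs" by (cases w)
    have "w \<in> Poly_Mapping.keys a" using insert by simp
    moreover have "0 \<notin> Poly_Mapping.keys a" using assms by (simp add: lpa_reps_def in_keys_iff)
    ultimately have "set gs \<subseteq> gens G" "gs \<noteq> []"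
      using lpa_reps_carrier[OF assms] gs unfolding carrier_free_algebra
      by (metis nc_word.sel, metis zero_nc_word_def)
    then obtain m where m: "Poly_Mapping.single w (Poly_Mapping.lookup a w) \<in> normalizable m"
      using ex_normalizable_word gs by blast
    have "Poly_Mapping.single w (Poly_Mapping.lookup a w) + (\<Sum>w\<in>A. Poly_Mapping.single w (Poly_Mapping.lookup a w))
        \<in> normalizable (max m n)"
      by (intro normalizable_add normalizable_mono[OF max.cobounded1 m] normalizable_mono[OF max.cobounded2 n])
    then show ?case using insert by auto
  qed
  then have "\<exists>n. (\<Sum>w\<in>Poly_Mapping.keys a. Poly_Mapping.single w (Poly_Mapping.lookup a w)) \<in> normalizable n"
    by simp
  moreover have "(\<Sum>w\<in>Poly_Mapping.keys a. Poly_Mapping.single w (Poly_Mapping.lookup a w)) = a"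
    by (rule poly_mapping_eqI) (simp add: lookup_sum lookup_single when_def in_keys_iff)
  ultimately show ?thesis by simp
qed

end

section \<open>Action of the words \<open>pq\<^sup>*\<close> on points\<close>

context cycle_word_system begin

lemma infp_Suc:
  assumes "y \<in> points N"
  shows "head G (infp y n) = tail G (infp y (Suc n))"
proof -
  obtain z where z: "z \<in> points N" "infp y = prepend_path (map (infp y) [0..<n]) (infp z)"
    using drop_edges[OF assms] by blast
  have nth: "infp y (n + k) = infp z k" for k
    using prepend_path_nth_add[of "map (infp y) [0..<n]" "infp z" k] z(2) by simp
  define e where "e = infp z 0"
  have e: "e \<in> arcs G" using infp_0[OF z(1)] by (simp add: e_def)
  have "z \<in> edge_part N e" using z(1) e by (simp add: edge_part_iff e_def)
  then obtain t where t: "t \<in> vert_part N (head G e)" "edge_map N e t = z"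
    using edge_map_surj[OF e] by blast
  then have "infp z = case_nat e (infp t)" using edge_map_props(2)[OF e t(1)] by simp
  moreover have "tail G (infp t 0) = head G e" using t(1) by (simp add: vert_part_N infp_0)
  ultimately show ?thesis using nth[of 0] nth[of 1] by simp
qed

lemma infp_prepend_range:
  assumes "y \<in> points N" "awalk w q x" "q \<noteq> []" "infp y = prepend_path q \<beta>"
  shows "tail G (\<beta> 0) = x"
proof -
  obtain q' e where q: "q = q' @ [e]" using assms(3) by (cases q rule: rev_cases) auto
  have "head G e = x" using assms(2) unfolding q by (auto simp: awalk_simps)
  moreover have "infp y (length q') = e"
    using assms(4) prepend_path_nth[of "length q'" q] by (simp add: q)
  moreover have "infp y (Suc (length q')) = \<beta> 0"
    using assms(4) prepend_path_nth_add[of q \<beta> 0] by (simp add: q)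
  ultimately show ?thesis using infp_Suc[OF assms(1), of "length q'"] by simp
qed

text \<open>For nonempty \<open>q\<close> the position of \<open>t\<close> at \<open>x\<close>
  follows from the path; for empty \<open>q\<close> it is precisely what the vertex letter tests.
  Both cases get the same description.\<close>

lemma word_map_ghost_word_iff:
  assumes y: "y \<in> points N" and wq: "awalk w q x"
  shows "word_map (ghost_word (w, q)) y = Some t \<longleftrightarrow>
    t \<in> vert_part N x \<and> infp y = prepend_path q (infp t) \<and> word_degree y = word_degree t + int (length q)"
proof (cases "q = []")
  case True
  then have w: "w = x" "w \<in> verts G" using wq by (auto simp: awalk_Nil_iff)
  have "word_map (ghost_word (w, q)) y = Some t \<longleftrightarrow> y \<in> vert_part N x \<and> t = y"
    using True w by (auto simp: ghost_word.simps)
  also have "\<dots> \<longleftrightarrow> t \<in> vert_part N x \<and> infp y = infp t \<and> word_degree y = word_degree t"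
    using infp_degree_inject[of y t] y by (auto simp: vert_part_N)
  finally show ?thesis using True by simp
next
  case False
  have "set q \<subseteq> arcs G" using wq by (auto simp: awalk_def)
  have "word_map (ghost_word (w, q)) y = Some t \<longleftrightarrow>
      t \<in> points N \<and> infp y = prepend_path q (infp t) \<and> word_degree y = word_degree t + int (length q)"
    using word_map_Ghosts_iff[OF y \<open>set q \<subseteq> arcs G\<close>] False by (simp add: ghost_word.simps)
  moreover have "t \<in> vert_part N x" if "t \<in> points N" "infp y = prepend_path q (infp t)"
    using infp_prepend_range[OF y wq False that(2)] that(1) by (simp add: vert_part_iff)
  ultimately show ?thesis by (auto simp: vert_part_N)
qed

lemma word_map_path_word_iff:
  assumes t: "t \<in> vert_part N x" and up: "awalk u p x"
  shows "word_map (path_word (u, p)) t = Some z \<longleftrightarrow>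
    z \<in> points N \<and> infp z = prepend_path p (infp t) \<and> word_degree z = word_degree t + int (length p)"
proof (cases "p = []")
  case True
  then have u: "u = x" "u \<in> verts G" using up by (auto simp: awalk_Nil_iff)
  have "word_map (path_word (u, p)) t = Some z \<longleftrightarrow> z = t"
    using True u t by (auto simp: path_word.simps)
  also have "\<dots> \<longleftrightarrow> z \<in> points N \<and> infp z = infp t \<and> word_degree z = word_degree t"
    using infp_degree_inject[of z t] t by (auto simp: vert_part_N)
  finally show ?thesis using True by simp
next
  case False
  have "set p \<subseteq> arcs G" using up by (auto simp: awalk_def)
  moreover have "t \<in> points N" using t by (simp add: vert_part_N)
  ultimately show ?thesis
    using word_map_Edges_iff False by (simp add: path_word.simps)
qed

end

context cycle_module_system begin

sublocale leavitt_words K G by unfold_locales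

abbreviation H :: "'v set" where "H \<equiv> verts G - R"

lemma verts_minus_H: "verts G - H = R"
  using R_verts by blast

definition ideal_gens :: "('v, 'e, 'k) lpa_elem set" where
  "ideal_gens = (\<lambda>u. lpa_class K G (gn (Vert u))) ` H \<union> breaking_element K G H ` breaking_vertices G H"

abbreviation I :: "('v, 'e, 'k) lpa_elem set" where
  "I \<equiv> admissible_ideal K G H (breaking_vertices G H)"

definition J :: "('v, 'e, 'k) free_elem set" where
  "J = {a. \<exists>b\<in>lpa_reps K G. lpa_class K G b \<in> I \<and> a - b \<in> Rel}"

text \<open>Removing the first edge of the path of \<open>y\<close> leaves a point at the range of
  that edge, so this range lies in \<open>R\<close>. Hence the edges into \<open>R\<close> already
  cover all points at \<open>x\<close>.\<close>

lemma edge_into_R: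
  assumes "y \<in> vert_part N x"
  shows "\<exists>e\<in>{e \<in> out_arcs G x. head G e \<in> R}. y \<in> edge_part N e"
proof -
  have y: "y \<in> points N" using assms by (simp add: vert_part_N)
  have e: "infp y 0 \<in> arcs G" "tail G (infp y 0) = x"
    using infp_0[OF y] assms by (simp_all add: vert_part_N)
  have ye: "y \<in> edge_part N (infp y 0)" using y e by (simp add: edge_part_iff)
  then obtain z where "z \<in> vert_part N (head G (infp y 0))"
    using edge_map_surj[OF e(1)] by blast
  then have "head G (infp y 0) \<in> R" using vert_part_nonempty_iff by blast
  with e ye show ?thesis by (intro bexI[of _ "infp y 0"]) auto
qed

lemma ideal_gens_subset: "ideal_gens \<subseteq> annihilator (leavitt K G) the_module"
proof
  fix A assume "A \<in> ideal_gens"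
  then consider u where "u \<in> H" "A = lpa_class K G (gn (Vert u))"
    | u where "u \<in> breaking_vertices G H" "A = breaking_element K G H u"
    unfolding ideal_gens_def by blast
  then show "A \<in> annihilator (leavitt K G) the_module"
  proof cases
    case 1
    then show ?thesis using vertex_annihilates_iff[of u] by (simp add: cycle_module_eq)
  next
    case 2
    let ?F = "{e \<in> out_arcs G u. head G e \<in> R}"
    have u: "u \<in> verts G" "finite ?F"
      using 2(1) unfolding breaking_vertices_def verts_minus_H by auto
    have "gn (Vert u) - (\<Sum>e\<in>?F. gn (Edge e) * gn (Ghost e)) \<in> lpa_reps K G"
      using u by (intro lpa_reps_closed(3) lpa_reps_sum lpa_reps_closed(4) lpa_reps_gn
          lpa_reps_carrier) simp_all
    moreover have "(gn (Vert u) - (\<Sum>e\<in>?F. gn (Edge e) * gn (Ghost e))) \<bullet>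
        basis_vec ring_of_type_algebra x = zero_vec ring_of_type_algebra" if "x \<in> points N" for x
      by (rule cuntz_krieger_apply_basis[OF that u]) (use edge_into_R in auto)
    ultimately show ?thesis
      unfolding 2(2) breaking_element_def verts_minus_H by (simp add: lpa_class_in_annihilator_iff)
  qed
qed

lemma I_props: "nonunital_ideal I (leavitt K G)" "I \<subseteq> annihilator (leavitt K G) the_module"
  "ideal_gens \<subseteq> I"
  using nonunital_ideal_generated[OF abelian_group_leavitt nonunital_ideal_annihilator ideal_gens_subset]
  unfolding admissible_ideal_def ideal_gens_def by simp_all

sublocale leavitt_ideal K G I J
  by unfold_locales (simp_all add: I_props J_def)

lemma gens_in_J: "a \<in> lpa_reps K G \<Longrightarrow> lpa_class K G a \<in> ideal_gens \<Longrightarrow> a \<in> J"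
  using I_props(3) by (intro JI[of a]) auto

lemma vertex_H_in_J: "x \<in> verts G \<Longrightarrow> x \<notin> R \<Longrightarrow> gn (Vert x) \<in> J"
  by (rule gens_in_J) (auto simp: ideal_gens_def)

text \<open>A vertex of \<open>R\<close> with finitely many edges into \<open>R\<close> is of one of
  two kinds. If it is an infinite emitter, it is a breaking vertex and the element is a generator of
  the ideal. If it is regular, the Cuntz-Krieger relation is available, and its terms for edges into
  \<open>H\<close> lie in \<open>J\<close>.\<close>

sublocale leavitt_ideal_cuntz_krieger K G I J R
proof
  show "gn (Vert x) \<in> J" if "x \<in> verts G" "x \<notin> R" for x
    using that by (rule vertex_H_in_J)
next
  fix x
  let ?F = "{e \<in> out_arcs G x. head G e \<in> R}"
  assume x: "x \<in> R" and fin: "finite ?F"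
  have xv: "x \<in> verts G" using x R_verts by blast
  obtain y where "y \<in> vert_part N x" using x vert_part_nonempty_iff by blast
  \<comment> \<open>Nonemptiness belongs to the definition of a breaking vertex and, in the other
    case, excludes a sink.\<close>
  then have ne: "?F \<noteq> {}" using edge_into_R by blast
  have reps: "gn (Vert x) - (\<Sum>e\<in>?F. gn (Edge e) * gn (Ghost e)) \<in> lpa_reps K G"
    using xv by (intro lpa_reps_closed(3) lpa_reps_sum lpa_reps_closed(4) lpa_reps_gn
        lpa_reps_carrier) simp_all
  show "gn (Vert x) - (\<Sum>e\<in>?F. gn (Edge e) * gn (Ghost e)) \<in> J"
  proof (cases "infinite_emitter G x")
    case True
    then have "x \<in> breaking_vertices G H"
      unfolding breaking_vertices_def verts_minus_H using x fin ne by simp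
    then have "breaking_element K G H x \<in> ideal_gens"
      unfolding ideal_gens_def by blast
    then show ?thesis
      using gens_in_J[OF reps] unfolding breaking_element_def verts_minus_H by simp
  next
    case False
    then have reg: "regular G x" using xv ne by (auto simp: regular_def sink_def)
    then have fin': "finite (out_arcs G x)" by (auto simp: regular_def infinite_emitter_def)
    have 1: "gn (Vert x) - (\<Sum>e\<in>out_arcs G x. gn (Edge e) * gn (Ghost e)) \<in> J"
      by (intro Rel_J lpa_relations_in_ideal) (use reg in \<open>auto simp: lpa_relations_def\<close>)
    have 2: "(\<Sum>e\<in>out_arcs G x - ?F. gn (Edge e) * gn (Ghost e)) \<in> J"
      by (intro J_sum edge_ghost_in_J vertex_H_in_J) auto
    have "(\<Sum>e\<in>out_arcs G x. gn (Edge e) * gn (Ghost e) :: ('v, 'e, 'k) free_elem) =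
        (\<Sum>e\<in>out_arcs G x - ?F. gn (Edge e) * gn (Ghost e)) + (\<Sum>e\<in>?F. gn (Edge e) * gn (Ghost e))"
      using fin' by (intro sum.subset_diff) auto
    then have "gn (Vert x) - (\<Sum>e\<in>?F. gn (Edge e) * gn (Ghost e)) =
        (gn (Vert x) - (\<Sum>e\<in>out_arcs G x. gn (Edge e) * gn (Ghost e))) +
        (\<Sum>e\<in>out_arcs G x - ?F. gn (Edge e) * gn (Ghost e) :: ('v, 'e, 'k) free_elem)"
      by simp
    then show ?thesis using J_add[OF 1 2] by (simp only:)
  qed
qed

lemma J_apply:
  assumes "a \<in> J" "m \<in> V"
  shows "a \<bullet> m = zero_vec ring_of_type_algebra"
proof -
  obtain b where b: "b \<in> lpa_reps K G" "lpa_class K G b \<in> I" "a - b \<in> Rel"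
    using assms(1) by (rule JE)
  have "lpa_class K G b \<odot>\<^bsub>the_module\<^esub> m = zero_vec ring_of_type_algebra"
    using b(2) I_props(2) assms(2) unfolding annihilator_def by auto
  then have "b \<bullet> m = zero_vec ring_of_type_algebra"
    using b(1) assms(2) by (simp add: lpa_reps_carrier)
  moreover have "(a - b) \<bullet> m = zero_vec ring_of_type_algebra"
    by (rule lpa_relation_ideal_apply[OF b(3) assms(2)])
  ultimately show ?thesis
    using free_action_diff_eq_zero_iff[OF assms(2)] by simp
qed

text \<open>Let \<open>q\<close> be of minimal length among the pairs with nonzero coefficient, and let \<open>t\<close> be a point at
  the range of \<open>q\<close> whose first edge occurs in no other pair if \<open>q\<close> can be extended. Then only pairs \<open>(p, q)\<close>
  contribute to the image of \<open>qt\<close>, and their contributions \<open>pt\<close> are distinct.\<close>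

lemma normal_form_faithful:
  assumes F: "finite F" "F \<subseteq> normal_pairs n"
    and zero: "\<And>y. y \<in> points N \<Longrightarrow>
      (\<Sum>z\<in>F. mono_word (pair_word z) (f z)) \<bullet> point_vec 1 y = zero_vec ring_of_type_algebra"
    and z: "z \<in> F"
  shows "f z = 0"
proof (rule ccontr)
  assume "f z \<noteq> 0"
  define len where "len z = length (snd (snd z))" for z :: "('v \<times> 'e list) \<times> ('v \<times> 'e list)"
  obtain z1 where z1: "z1 \<in> F" "f z1 \<noteq> 0" and min: "\<And>z. z \<in> F \<Longrightarrow> f z \<noteq> 0 \<Longrightarrow> len z1 \<le> len z"
    using ex_has_least_nat[of "\<lambda>z. z \<in> F \<and> f z \<noteq> 0" z len] z \<open>f z \<noteq> 0\<close> by blast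
  obtain u1 p1 w1 q1 where z1': "z1 = ((u1, p1), (w1, q1))" by (metis prod.collapse)
  obtain x1 where x1: "x1 \<in> R" "awalk u1 p1 x1" "awalk w1 q1 x1"
      "length q1 = n \<or> length q1 < n \<and> infinite (out_R x1)"
    using z1(1) F(2) unfolding z1' normal_pairs_def by auto
  \<comment> \<open>The edges that occur in some \<open>q\<close>. There are finitely many, so a
    vertex with infinitely many edges into \<open>R\<close> has one outside
    \<open>D\<close>.\<close>
  define D where "D = (\<Union>z\<in>F. set (snd (snd z)))"
  have "finite D" using F(1) by (auto simp: D_def)
  have len_le: "len z \<le> n" if "z \<in> F" for z
    using that F(2) unfolding normal_pairs_def len_def by auto
  have "\<exists>t\<in>vert_part N x1. length q1 < n \<longrightarrow> infp t 0 \<notin> D"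
  proof (cases "length q1 < n")
    case True
    then have "infinite (out_R x1)" using x1(4) by simp
    then have "infinite (out_R x1 - D)" using \<open>finite D\<close> by simp
    then have "out_R x1 - D \<noteq> {}" by (rule infinite_imp_nonempty)
    then obtain e where e: "e \<in> out_R x1" "e \<notin> D" by blast
    then obtain t where t: "t \<in> vert_part N (head G e)" using vert_part_nonempty_iff by blast
    have "e \<in> arcs G" "tail G e = x1" using e(1) by auto
    then show ?thesis
      using edge_map_props[OF _ t] edge_part_subset[of e] e(2) by (intro bexI[of _ "edge_map N e t"]) auto
  next
    case False
    then show ?thesis using x1(1) vert_part_nonempty_iff by blast
  qed
  then obtain t where t: "t \<in> vert_part N x1" "length q1 < n \<Longrightarrow> infp t 0 \<notin> D" by blast
  have tp: "t \<in> points N" using t(1) by (simp add: vert_part_N)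
  \<comment> \<open>The test point \<open>y\<close> is \<open>q1\<close> followed by
    \<open>t\<close>, and \<open>z'\<close> is \<open>p1\<close> followed by \<open>t\<close>; the
    coefficient of \<open>z1\<close> is read off as the coordinate at \<open>z'\<close> of the image
    of \<open>y\<close>.\<close>
  obtain y where y: "y \<in> vert_part N w1" "infp y = prepend_path q1 (infp t)"
      "word_degree y = word_degree t + int (length q1)"
    using prepend_in_points[OF x1(3) t(1)] by blast
  obtain z' where z': "z' \<in> vert_part N u1" "infp z' = prepend_path p1 (infp t)"
      "word_degree z' = word_degree t + int (length p1)"
    using prepend_in_points[OF x1(2) t(1)] by blast
  have yp: "y \<in> points N" "fst (fst y) = w1" and zp: "z' \<in> points N" "fst (fst z') = u1"
    using y(1) z'(1) by (simp_all add: vert_part_N)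
  have map1: "word_map (pair_word z1) y = Some z'"
  proof -
    have "word_map (ghost_word (w1, q1)) y = Some t"
      using word_map_ghost_word_iff[OF yp(1) x1(3), of t] t(1) y(2,3) by blast
    moreover have "word_map (path_word (u1, p1)) t = Some z'"
      using word_map_path_word_iff[OF t(1) x1(2), of z'] zp(1) z'(2,3) by blast
    ultimately show ?thesis by (simp add: z1' pair_word_def word_map_append)
  qed
  have unique: "z = z1" if z: "z \<in> F" "f z \<noteq> 0" "word_map (pair_word z) y = Some z'" for z
  proof -
    obtain u p w q where zz: "z = ((u, p), (w, q))" by (metis prod.collapse)
    have "z \<in> normal_pairs n" using z(1) F(2) by blast
    then obtain x where "path_pair z x" unfolding normal_pairs_def by blast
    then have x: "awalk u p x" "awalk w q x" by (simp_all add: zz)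
    obtain s where s: "word_map (ghost_word (w, q)) y = Some s" "word_map (path_word (u, p)) s = Some z'"
      using z(3) by (auto simp: zz pair_word_def word_map_append bind_eq_Some_conv)
    have s': "s \<in> vert_part N x" "infp y = prepend_path q (infp s)"
        "word_degree y = word_degree s + int (length q)"
      using s(1) word_map_ghost_word_iff[OF yp(1) x(2)] by auto
    have s'': "infp z' = prepend_path p (infp s)" "word_degree z' = word_degree s + int (length p)"
      using s(2) word_map_path_word_iff[OF s'(1) x(1)] by auto
    \<comment> \<open>Both \<open>q\<close> and \<open>q1\<close> are prefixes of the path of
      \<open>y\<close>, so by minimality \<open>q\<close> extends \<open>q1\<close>.\<close>
    have "length q1 \<le> length q" using min[OF z(1,2)] by (simp add: len_def zz z1')
    then obtain r where r: "q = q1 @ r" "infp t = prepend_path r (infp s)"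
      using y(2) s'(2) prepend_path_eqD[of q1 "infp t" q "infp s"] by auto
    \<comment> \<open>Otherwise \<open>q1\<close> is shorter than \<open>n\<close>, so
      \<open>t\<close> was chosen to begin with an edge outside \<open>D\<close>; but the first edge
      of \<open>r\<close> is part of \<open>q\<close>.\<close>
    have "r = []"
    proof (rule ccontr)
      assume "r \<noteq> []"
      then obtain e r' where re: "r = e # r'" by (cases r) auto
      then have "length q1 < n" using len_le[OF z(1)] r(1) by (simp add: len_def zz)
      then have "e \<notin> D" using t(2) r(2) re by simp
      moreover have "e \<in> D" unfolding D_def using z(1) zz r(1) re by force
      ultimately show False by simp
    qed
    then have q: "q = q1" "infp s = infp t" using r by auto
    then have "word_degree s = word_degree t" using s'(3) y(3) by simp
    moreover have sp: "s \<in> points N" using s'(1) by (simp add: vert_part_N)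
    ultimately have st: "s = t" using infp_degree_inject[OF sp tp q(2)] by simp
    have "length p = length p1" using s''(2) z'(3) st by simp
    then have p: "p = p1"
      using s''(1) z'(2) st prepend_path_eqD[of p "infp t" p1 "infp t"] by auto
    have "x = x1" using s'(1) t(1) st by (simp add: vert_part_N)
    have "u = u1"
      using x(1) x1(2) \<open>x = x1\<close> p by (cases p) (auto simp: awalk_simps)
    moreover have "w = w1"
      using x(2) x1(3) \<open>x = x1\<close> q(1) by (cases q) (auto simp: awalk_simps)
    ultimately show ?thesis using zz z1' p q(1) by simp
  qed
  have pv: "point_vec 1 y \<in> V" using yp(1) by simp
  have eval: "((\<Sum>z\<in>A. mono_word (pair_word z) (f z)) \<bullet> point_vec 1 y) z' =
      (\<Sum>z\<in>A. (mono_word (pair_word z) (f z) \<bullet> point_vec 1 y) z')" if "finite A" for A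
    using that
    by (induction A rule: finite_induct) (simp_all add: free_action_add[OF pv] add_vec_eq pv zero_vec_eq)
  have "((\<Sum>z\<in>F. mono_word (pair_word z) (f z)) \<bullet> point_vec 1 y) z' = 0"
    using zero[OF yp(1)] by (simp only: zero_vec_eq)
  then have "(\<Sum>z\<in>F. (mono_word (pair_word z) (f z) \<bullet> point_vec 1 y) z') = 0"
    using eval[OF F(1)] by (simp only:)
  moreover have "(\<Sum>z\<in>F. (mono_word (pair_word z) (f z) \<bullet> point_vec 1 y) z') =
      (\<Sum>z\<in>F. if z = z1 then f z1 else 0)"
  proof (rule sum.cong[OF refl])
    fix z assume z: "z \<in> F"
    show "(mono_word (pair_word z) (f z) \<bullet> point_vec 1 y) z' = (if z = z1 then f z1 else 0)"
      unfolding single_apply_point[OF yp(1)] using unique[OF z] map1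
      by (auto simp: point_vec_def split: option.split)
  qed
  ultimately show False using z1 F(1) by simp
qed

theorem annihilator_cycle_module: "annihilator (leavitt K G) (cycle_module K G c v) = I"
  unfolding cycle_module_eq
proof
  show "I \<subseteq> annihilator (leavitt K G) the_module" by (rule I_props)
  show "annihilator (leavitt K G) the_module \<subseteq> I"
  proof
    fix A assume A: "A \<in> annihilator (leavitt K G) the_module"
    then obtain a where a: "a \<in> lpa_reps K G" "A = lpa_class K G a"
      by (auto simp: annihilator_def carrier_leavitt)
    have az: "a \<bullet> point_vec 1 y = zero_vec ring_of_type_algebra" if "y \<in> points N" for y
      using A a that by (simp add: lpa_class_in_annihilator_iff basis_vec_eq)
    obtain n F f where F: "finite F" "F \<subseteq> normal_pairs n"
        and nf: "a - (\<Sum>z\<in>F. mono_word (pair_word z) (f z)) \<in> J"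
      using ex_normalizable[OF a(1)] unfolding normalizable_def by blast
    \<comment> \<open>The normal form acts as zero because both \<open>a\<close> and all elements of
      \<open>J\<close> do. So its coefficients vanish, and \<open>a\<close> itself lies in
      \<open>J\<close>.\<close>
    have "f z = 0" if "z \<in> F" for z
    proof (rule normal_form_faithful[OF F _ that])
      fix y assume y: "y \<in> points N"
      then have "(a - (\<Sum>z\<in>F. mono_word (pair_word z) (f z))) \<bullet> point_vec 1 y = zero_vec ring_of_type_algebra"
        by (intro J_apply[OF nf]) simp
      then show "(\<Sum>z\<in>F. mono_word (pair_word z) (f z)) \<bullet> point_vec 1 y = zero_vec ring_of_type_algebra"
        using free_action_diff_eq_zero_iff[OF point_vec_closed[OF y]] az[OF y] by simp
    qed
    then have "(\<Sum>z\<in>F. mono_word (pair_word z) (f z)) = 0" by simp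
    then have "a \<in> J" using nf by simp
    then obtain b where b: "b \<in> lpa_reps K G" "lpa_class K G b \<in> I" "a - b \<in> Rel" by (rule JE)
    then have "A = lpa_class K G b"
      using a lpa_class_eq_iff[OF lpa_reps_carrier[OF a(1)] lpa_reps_carrier[OF b(1)]] by simp
    then show "A \<in> I" using b(2) by simp
  qed
qed

end

section \<open>Chen modules\<close>

lemma tail_equivalent_Cons_iff [simp]: "tail_equivalent (case_nat e \<beta>) \<alpha> \<longleftrightarrow> tail_equivalent \<beta> \<alpha>"
proof
  assume "tail_equivalent (case_nat e \<beta>) \<alpha>"
  then obtain m n where mn: "\<And>k. case_nat e \<beta> (m + k) = \<alpha> (n + k)"
    unfolding tail_equivalent_def by blast
  have "\<beta> (m + k) = \<alpha> (Suc n + k)" for k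
    using mn[of "Suc k"] by simp
  then show "tail_equivalent \<beta> \<alpha>" unfolding tail_equivalent_def by blast
next
  assume "tail_equivalent \<beta> \<alpha>"
  then obtain m n where "\<And>k. \<beta> (m + k) = \<alpha> (n + k)"
    unfolding tail_equivalent_def by blast
  then have "\<And>k. case_nat e \<beta> (Suc m + k) = \<alpha> (n + k)" by simp
  then show "tail_equivalent (case_nat e \<beta>) \<alpha>" unfolding tail_equivalent_def by blast
qed

lemma tail_equivalent_prepend_iff: "tail_equivalent (prepend_path p \<beta>) \<alpha> \<longleftrightarrow> tail_equivalent \<beta> \<alpha>"
  by (induction p) auto

lemma tail_equivalent_drop: "tail_equivalent (\<lambda>k. \<alpha> (n + k)) \<alpha>"
  unfolding tail_equivalent_def by (rule exI[of _ 0], rule exI[of _ n]) simp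

lemma case_nat_decompose: "case_nat (\<beta> 0) (\<lambda>k. \<beta> (Suc k)) = \<beta>"
  by (auto split: nat.split)

section \<open>Branching systems of infinite and finite paths\<close>

context wf_digraph begin

lemma infinite_path_Cons_iff [simp]:
  "infinite_path G (case_nat e \<beta>) \<longleftrightarrow> e \<in> arcs G \<and> head G e = tail G (\<beta> 0) \<and> infinite_path G \<beta>"
proof
  assume *: "infinite_path G (case_nat e \<beta>)"
  have "infinite_path G \<beta>"
    unfolding infinite_path_def
  proof
    fix n show "\<beta> n \<in> arcs G \<and> head G (\<beta> n) = tail G (\<beta> (Suc n))"
      using *[unfolded infinite_path_def, rule_format, of "Suc n"] by simp
  qed
  then show "e \<in> arcs G \<and> head G e = tail G (\<beta> 0) \<and> infinite_path G \<beta>"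
    using *[unfolded infinite_path_def, rule_format, of 0] by simp
next
  assume "e \<in> arcs G \<and> head G e = tail G (\<beta> 0) \<and> infinite_path G \<beta>"
  then show "infinite_path G (case_nat e \<beta>)"
    unfolding infinite_path_def by (auto split: nat.split)
qed

lemma infinite_path_drop: "infinite_path G \<beta> \<Longrightarrow> infinite_path G (\<lambda>k. \<beta> (n + k))"
  unfolding infinite_path_def by simp

lemma infinite_path_prepend:
  "awalk u p (tail G (\<beta> 0)) \<Longrightarrow> infinite_path G \<beta> \<Longrightarrow>
    infinite_path G (prepend_path p \<beta>) \<and> tail G (prepend_path p \<beta> 0) = u"
  by (induction p arbitrary: u) (auto simp: awalk_simps)

lemma awalk_take_infinite_path:
  "infinite_path G \<beta> \<Longrightarrow> awalk (tail G (\<beta> 0)) (map \<beta> [0..<n]) (tail G (\<beta> n))"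
proof (induction n)
  case 0
  then show ?case by (simp add: awalk_Nil_iff infinite_path_def)
next
  case (Suc n)
  then have "awalk (tail G (\<beta> n)) [\<beta> n] (tail G (\<beta> (Suc n)))"
    by (simp add: awalk_simps infinite_path_def)
  then show ?case using awalk_appendI[OF Suc.IH[OF Suc.prems]] by simp
qed

lemma branching_system_infinite_path: "branching_system G (infinite_path_branching G \<alpha>)"
proof
  let ?Y = "infinite_path_branching G \<alpha>"
  show "bij_betw (edge_map ?Y e) (vert_part ?Y (head G e)) (edge_part ?Y e)" if e: "e \<in> arcs G" for e
  proof (rule bij_betwI[where g = "\<lambda>\<beta> k. \<beta> (Suc k)"])
    show "edge_map ?Y e \<in> vert_part ?Y (head G e) \<rightarrow> edge_part ?Y e"
      using e by (auto simp: infinite_path_branching_def)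
    show "(\<lambda>\<beta> k. \<beta> (Suc k)) \<in> edge_part ?Y e \<rightarrow> vert_part ?Y (head G e)"
    proof
      fix \<beta> assume "\<beta> \<in> edge_part ?Y e"
      then have "infinite_path G \<beta>" "tail_equivalent \<beta> \<alpha>" "\<beta> 0 = e"
        by (auto simp: infinite_path_branching_def)
      then have "infinite_path G (case_nat e (\<lambda>k. \<beta> (Suc k)))" "tail_equivalent (case_nat e (\<lambda>k. \<beta> (Suc k))) \<alpha>"
        using case_nat_decompose[of \<beta>] by simp_all
      then show "(\<lambda>k. \<beta> (Suc k)) \<in> vert_part ?Y (head G e)"
        by (simp add: infinite_path_branching_def)
    qed
  qed (auto simp: infinite_path_branching_def case_nat_decompose)
qed (auto simp: infinite_path_branching_def infinite_path_def)

lemma infinite_path_vert_part_iff: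
  assumes "infinite_path G \<alpha>"
  shows "vert_part (infinite_path_branching G \<alpha>) w \<noteq> {} \<longleftrightarrow> (\<exists>p n. awalk w p (tail G (\<alpha> n)))"
proof
  assume "vert_part (infinite_path_branching G \<alpha>) w \<noteq> {}"
  then obtain \<beta> where \<beta>: "infinite_path G \<beta>" "tail_equivalent \<beta> \<alpha>" "tail G (\<beta> 0) = w"
    by (auto simp: infinite_path_branching_def)
  then obtain m n where "\<And>k. \<beta> (m + k) = \<alpha> (n + k)" unfolding tail_equivalent_def by blast
  then have "\<beta> m = \<alpha> n" by (metis add_0_right)
  then show "\<exists>p n. awalk w p (tail G (\<alpha> n))"
    using awalk_take_infinite_path[OF \<beta>(1), of m] \<beta>(3) by metis
next
  assume "\<exists>p n. awalk w p (tail G (\<alpha> n))"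
  then obtain p n where "awalk w p (tail G (\<alpha> n))" by blast
  then have "infinite_path G (prepend_path p (\<lambda>k. \<alpha> (n + k))) \<and> tail G (prepend_path p (\<lambda>k. \<alpha> (n + k)) 0) = w"
    by (intro infinite_path_prepend) (simp_all add: infinite_path_drop[OF assms])
  then have "prepend_path p (\<lambda>k. \<alpha> (n + k)) \<in> vert_part (infinite_path_branching G \<alpha>) w"
    by (simp add: infinite_path_branching_def tail_equivalent_prepend_iff tail_equivalent_drop)
  then show "vert_part (infinite_path_branching G \<alpha>) w \<noteq> {}" by blast
qed

text \<open>The trivial path at \<open>u\<close> is the only point without a first edge, so the
  covering condition can fail only at \<open>u\<close>, where it is not demanded.\<close>

lemma branching_system_finite_path:
  assumes "\<not> regular G u"
  shows "branching_system G (finite_path_branching G u)"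
proof
  let ?Y = "finite_path_branching G u"
  show "bij_betw (edge_map ?Y e) (vert_part ?Y (head G e)) (edge_part ?Y e)" if e: "e \<in> arcs G" for e
  proof (rule bij_betwI[where g = "\<lambda>(w, p). (head G e, tl p)"])
    show "edge_map ?Y e \<in> vert_part ?Y (head G e) \<rightarrow> edge_part ?Y e"
      using e by (auto simp: finite_path_branching_def awalk_Cons_iff)
    show "(\<lambda>(w, p). (head G e, tl p)) \<in> edge_part ?Y e \<rightarrow> vert_part ?Y (head G e)"
    proof
      fix x assume "x \<in> edge_part ?Y e"
      then obtain w p where "x = (w, e # p)" "awalk w (e # p) u"
        unfolding finite_path_branching_def by (auto simp: neq_Nil_conv)
      then show "(case x of (w, p) \<Rightarrow> (head G e, tl p)) \<in> vert_part ?Y (head G e)"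
        by (simp add: finite_path_branching_def awalk_Cons_iff)
    qed
    show "edge_map ?Y e (case x of (w, p) \<Rightarrow> (head G e, tl p)) = x" if "x \<in> edge_part ?Y e" for x
    proof -
      from that obtain w p where "x = (w, e # p)" "awalk w (e # p) u"
        unfolding finite_path_branching_def by (auto simp: neq_Nil_conv)
      then show ?thesis by (simp add: finite_path_branching_def awalk_Cons_iff)
    qed
  qed (auto simp: finite_path_branching_def)
  show "edge_part ?Y e \<subseteq> vert_part ?Y (tail G e)" if "e \<in> arcs G" for e
    using that by (auto simp: finite_path_branching_def neq_Nil_conv awalk_Cons_iff)
  show "vert_part ?Y w \<subseteq> (\<Union>e\<in>out_arcs G w. edge_part ?Y e)" if w: "regular G w" for w
  proof
    fix x assume "x \<in> vert_part ?Y w"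
    then obtain p where x: "x = (w, p)" "awalk w p u" by (auto simp: finite_path_branching_def)
    then have "p \<noteq> []" using w assms by (auto simp: awalk_Nil_iff)
    then obtain e p' where "p = e # p'" by (cases p) auto
    then show "x \<in> (\<Union>e\<in>out_arcs G w. edge_part ?Y e)"
      using x by (auto simp: finite_path_branching_def awalk_Cons_iff)
  qed
qed (auto simp: finite_path_branching_def)

end

section \<open>Infinite paths that end on the exclusive cycle\<close>

context graph_with_exclusive_cycle begin

lemma cycle_path_unique:
  assumes "infinite_path G \<beta>" "\<And>k. \<beta> k \<in> set c"
  shows "\<beta> = cycle_path (tail G (\<beta> 0))"
proof
  fix n
  have "\<beta> n = cycle_path (tail G (\<beta> 0)) n"
    using assms
  proof (induction n arbitrary: \<beta>)
    case 0
    then show ?case by (simp add: assms)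
  next
    case (Suc n)
    have e: "\<beta> 0 \<in> set c" using Suc.prems(2) .
    have "\<beta> (Suc n) = cycle_path (tail G (\<beta> (Suc 0))) n"
      using Suc.IH[of "\<lambda>k. \<beta> (Suc k)"] infinite_path_drop[OF Suc.prems(1), of 1] Suc.prems(2) by simp
    also have "tail G (\<beta> (Suc 0)) = head G (\<beta> 0)"
      using Suc.prems(1) by (simp add: infinite_path_def)
    also have "cycle_path (head G (\<beta> 0)) n = cycle_path (tail G (\<beta> 0)) (Suc n)"
      using cycle_path_edge[OF e] by (metis nat.simps(5))
    finally show ?case .
  qed
  then show "\<beta> n = cycle_path (tail G (\<beta> 0)) n" .
qed

text \<open>The initial segment of \<open>\<beta>\<close> leads from \<open>c\<close> to the part of
  \<open>\<beta>\<close> that lies on \<open>c\<close>, so it is confined to \<open>c\<close> as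
  well and \<open>\<beta>\<close> never has a choice.\<close>

lemma tail_equivalent_cycle_path:
  assumes "infinite_path G \<beta>" "tail_equivalent \<beta> \<alpha>" "\<And>k. \<alpha> (n + k) \<in> set c" "tail G (\<beta> 0) \<in> cv"
  shows "\<beta> = cycle_path (tail G (\<beta> 0))"
proof -
  obtain i j where ij: "\<And>k. \<beta> (i + k) = \<alpha> (j + k)"
    using assms(2) unfolding tail_equivalent_def by blast
  have late: "\<beta> (i + n + k) \<in> set c" for k
    using ij[of "n + k"] assms(3)[of "j + k"] by (simp add: add_ac)
  have aw: "awalk (tail G (\<beta> 0)) (map \<beta> [0..<i + n]) (tail G (\<beta> (i + n)))"
    by (rule awalk_take_infinite_path[OF assms(1)])
  have "tail G (\<beta> (i + n)) \<in> cv" using tail_in_cv[OF late[of 0]] by simp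
  then have early: "set (map \<beta> [0..<i + n]) \<subseteq> set c"
    using path_in_cycle_edges[OF aw assms(4)] by blast
  have "\<beta> k \<in> set c" for k
  proof (cases "k < i + n")
    case True
    then have "\<beta> k \<in> set (map \<beta> [0..<i + n])" by auto
    then show ?thesis using early by blast
  next
    case False
    then show ?thesis using late[of "k - (i + n)"] by simp
  qed
  then show ?thesis by (rule cycle_path_unique[OF assms(1)])
qed

text \<open>If the vertices from which \<open>\<alpha>\<close> can be reached are those from which \<open>c\<close> can be reached, then
  \<open>c\<close> leads to \<open>\<alpha>\<close> and back, so \<open>\<alpha>\<close> ends on \<open>c\<close>.\<close>

lemma eventually_on_cycle:
  assumes \<alpha>: "infinite_path G \<alpha>"
    and R: "\<And>w. w \<in> verts G \<Longrightarrow> vert_part (infinite_path_branching G \<alpha>) w \<noteq> {} \<longleftrightarrow> w \<in> R"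
  shows "\<exists>n. \<forall>k. \<alpha> (n + k) \<in> set c"
proof -
  obtain v where v: "v \<in> cv" using c_nonempty by (cases c) (auto simp: cycle_verts_def)
  then have "vert_part (infinite_path_branching G \<alpha>) v \<noteq> {}"
    using R cv_verts cv_subset_R by blast
  then obtain p n where p: "awalk v p (tail G (\<alpha> n))"
    unfolding infinite_path_vert_part_iff[OF \<alpha>] by blast
  \<comment> \<open>Each such vertex supports the module, by the tail of \<alpha> that starts there,
    and so reaches \<open>c\<close>; it is also reached from \<open>v\<close>.\<close>
  have on: "tail G (\<alpha> (n + k)) \<in> cv" for k
  proof -
    have aw: "awalk (tail G (\<alpha> n)) (map (\<lambda>k. \<alpha> (n + k)) [0..<k]) (tail G (\<alpha> (n + k)))"
      using awalk_take_infinite_path[OF infinite_path_drop[OF \<alpha>, of n], of k] by simp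
    have "awalk v (p @ map (\<lambda>k. \<alpha> (n + k)) [0..<k]) (tail G (\<alpha> (n + k)))"
      by (rule awalk_appendI[OF p aw])
    moreover have vk: "tail G (\<alpha> (n + k)) \<in> verts G"
      using awalk_last_in_verts[OF aw] .
    then have "awalk (tail G (\<alpha> (n + k))) [] (tail G (\<alpha> (n + k)))" by (simp add: awalk_Nil_iff)
    then have "tail G (\<alpha> (n + k)) \<in> R"
      using R[OF vk] unfolding infinite_path_vert_part_iff[OF \<alpha>] by blast
    then obtain w q where "w \<in> cv" "awalk (tail G (\<alpha> (n + k))) q w" unfolding in_R_iff by blast
    ultimately show ?thesis using path_verts_in_cv[OF _ _ v] by blast
  qed
  have "\<alpha> (n + k) \<in> set c" for k
  proof -
    have "awalk (tail G (\<alpha> (n + k))) [\<alpha> (n + k)] (tail G (\<alpha> (n + Suc k)))"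
      using \<alpha> by (simp add: awalk_simps infinite_path_def)
    then have "set [\<alpha> (n + k)] \<subseteq> set c" by (rule path_in_cycle_edges[OF _ on on])
    then show ?thesis by simp
  qed
  then show ?thesis by blast
qed

text \<open>The Laurent monomial \<open>x\<^sup>i\<close> evaluated at \<open>d\<close>: the start
  of \<open>d\<close> serves as the identity, and negative exponents become ghost paths.\<close>

definition power_word :: "'e list \<Rightarrow> int \<Rightarrow> ('v, 'e) gen list" where
  "power_word d i = (if i = 0 then [Vert (tail G (hd d))]
     else if i > 0 then map Edge (concat (replicate (nat i) d))
     else map Ghost (rev (concat (replicate (nat (- i)) d))))"

end

text \<open>\<open>d\<close> is \<open>c\<close> read from a possibly different vertex. The starting
  point matters because the twist sits on the first edge of \<open>d\<close>.\<close>

locale rotated_cycle = graph_with_exclusive_cycle G c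
  for G :: "('v, 'e) pre_digraph" and c +
  fixes d :: "'e list"
  assumes d: "cycle d" "same_cycle c d"
begin

lemma set_d: "set d = set c"
  using d(2) by (auto simp: same_cycle_def)

abbreviation v0 :: 'v where "v0 \<equiv> tail G (hd d)"

lemma d_props: "d \<noteq> []" "awalk v0 d v0" "distinct d" "v0 \<in> cv"
proof -
  obtain u where u: "awalk u d u" "d \<noteq> []" "distinct d" using d(1) unfolding cycle_conv by blast
  then have "u = v0" by (cases d) (auto simp: awalk_Cons_iff)
  with u show "d \<noteq> []" "awalk v0 d v0" "distinct d" by auto
  show "v0 \<in> cv" using \<open>d \<noteq> []\<close> set_d tail_in_cv by (cases d) auto
qed

abbreviation rep :: "nat \<Rightarrow> 'e list" where "rep n \<equiv> concat (replicate n d)"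

lemma rep_awalk: "awalk v0 (rep n) v0"
proof (induction n)
  case 0
  then show ?case using d_props(4) cv_verts by (auto simp: awalk_Nil_iff)
next
  case (Suc n)
  then show ?case using awalk_appendI[OF d_props(2)] by (simp del: awalk_append_iff)
qed

lemma rep_nonempty: "n > 0 \<Longrightarrow> rep n \<noteq> []"
  using d_props(1) by (cases n) auto

lemma length_rep: "length (rep n) = n * length d"
  by (induction n) auto

lemma prepend_rep: "prepend_path (rep n) (cycle_path v0) = cycle_path v0"
  by (rule prepend_cycle_path[OF rep_awalk d_props(4,4)])

lemma power_word_gens: "set (power_word d i) \<subseteq> gens G" "power_word d i \<noteq> []"
proof -
  have v0: "v0 \<in> verts G" using d_props(4) cv_verts by blast
  have rep: "set (rep n) \<subseteq> arcs G" for n using rep_awalk[of n] unfolding awalk_def by blast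
  then have "Edge ` set (rep n) \<subseteq> gens G" "Ghost ` set (rep n) \<subseteq> gens G" for n
    by (meson gens_iff image_subsetI subsetD)+
  then have sub: "set (map Edge (rep n)) \<subseteq> gens G" "set (map Ghost (rev (rep n))) \<subseteq> gens G" for n
    unfolding set_map set_rev .
  consider "i = 0" | "i > 0" | "i < 0" by linarith
  then have "set (power_word d i) \<subseteq> gens G \<and> power_word d i \<noteq> []"
  proof cases
    case 1
    then show ?thesis using v0 by (simp add: power_word_def)
  next
    case 2
    then have "power_word d i = map Edge (rep (nat i))" by (simp add: power_word_def)
    then show ?thesis using sub(1) rep_nonempty[of "nat i"] 2 by (metis map_is_Nil_conv zero_less_nat_eq)
  next
    case 3
    then have "power_word d i = map Ghost (rev (rep (nat (- i))))" by (simp add: power_word_def)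
    then show ?thesis
      using sub(2) rep_nonempty[of "nat (- i)"] 3
      by (metis map_is_Nil_conv neg_0_less_iff_less rev_is_Nil_conv zero_less_nat_eq)
  qed
  then show "set (power_word d i) \<subseteq> gens G" "power_word d i \<noteq> []" by simp_all
qed

text \<open>The value \<open>f(d)\<close> of the Laurent polynomial at the cycle.\<close>

definition power_sum :: "(int \<Rightarrow>\<^sub>0 'k::field) \<Rightarrow> ('v, 'e, 'k) free_elem" where
  "power_sum f = (\<Sum>i\<in>Poly_Mapping.keys f. Poly_Mapping.single (NC_Word (power_word d i)) (Poly_Mapping.lookup f i))"

lemma power_sum_reps: "power_sum f \<in> lpa_reps K G"
  unfolding power_sum_def using power_word_gens by (intro lpa_reps_sum lpa_reps_single) auto

lemma power_word_degree:
  "(\<Sum>g\<leftarrow>power_word d i. case g of Vert _ \<Rightarrow> 0 | Edge _ \<Rightarrow> 1 | Ghost _ \<Rightarrow> -1) = i * int (length d)"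
proof -
  have "(\<Sum>g\<leftarrow>(map Edge p :: ('v, 'e) gen list). case g of Vert _ \<Rightarrow> 0 | Edge _ \<Rightarrow> 1 | Ghost _ \<Rightarrow> (-1::int)) =
      int (length p)" for p
    by (induction p) auto
  moreover have "(\<Sum>g\<leftarrow>(map Ghost q :: ('v, 'e) gen list). case g of Vert _ \<Rightarrow> 0 | Edge _ \<Rightarrow> 1 | Ghost _ \<Rightarrow> (-1::int)) =
      - int (length q)" for q
    by (induction q) auto
  ultimately show ?thesis
    by (simp add: power_word_def length_rep del: length_concat)
qed

end

text \<open>The powers of \<open>d\<close> move a point at \<open>v0\<close> to points of pairwise
  distinct degrees, so the terms of \<open>f(d)\<close> cannot cancel on it.\<close>

lemma (in cycle_module_system) power_sum_not_annihilating:
  assumes d: "rotated_cycle G c d" and f: "f \<noteq> (0 :: int \<Rightarrow>\<^sub>0 'k)"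
  shows "lpa_class K G (rotated_cycle.power_sum G d f) \<notin> annihilator (leavitt K G) the_module"
proof
  interpret rotated_cycle G c d by fact
  assume ann: "lpa_class K G (power_sum f) \<in> annihilator (leavitt K G) the_module"
  obtain x where x: "x \<in> vert_part N v0"
    using d_props(4) cv_subset_R vert_part_nonempty_iff by blast
  have xp: "x \<in> points N" using x by (simp add: vert_part_N)
  \<comment> \<open>A walk from \<open>v0\<close> to a vertex of \<open>c\<close> stays on
    \<open>c\<close>. So every point at \<open>v0\<close> follows \<open>c\<close>, and negative
    powers of \<open>d\<close> do not kill it.\<close>
  have xi: "infp x = cycle_path v0"
  proof -
    obtain w p q u where xx: "x = ((w, p), (v, q))" "u \<in> cv" "awalk w p u" "infp x = prepend_path p (cycle_path u)"
      using xp by (rule pointsE)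
    then have "w = v0" using x by (simp add: vert_part_N)
    then show ?thesis using prepend_cycle_path[of v0 p u] xx d_props(4) by simp
  qed
  have "\<exists>y. word_map (power_word d i) x = Some y" for i
  proof -
    consider "i = 0" | "i > 0" | "i < 0" by linarith
    then show ?thesis
    proof cases
      case 1
      then show ?thesis using x d_props(4) cv_verts by (auto simp: power_word_def)
    next
      case 2
      have sub: "set (rep (nat i)) \<subseteq> arcs G" using rep_awalk by (auto simp: awalk_def)
      obtain y where "y \<in> vert_part N v0" "infp y = prepend_path (rep (nat i)) (infp x)"
          "word_degree y = word_degree x + int (length (rep (nat i)))"
        using prepend_in_points[OF rep_awalk x] by blast
      then have "word_map (map Edge (rep (nat i))) x = Some y"
        unfolding word_map_Edges_iff[OF xp sub] by (simp add: vert_part_N)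
      then show ?thesis using 2 by (simp add: power_word_def)
    next
      case 3
      let ?p = "rep (nat (- i))"
      have sub: "set ?p \<subseteq> arcs G" using rep_awalk by (auto simp: awalk_def)
      obtain y where y: "y \<in> points N" "infp x = prepend_path (map (infp x) [0..<length ?p]) (infp y)"
          "word_degree x = word_degree y + int (length ?p)"
        using drop_edges[OF xp] by blast
      \<comment> \<open>\<open>?p\<close> and the first edges of \<open>x\<close> are prefixes of
        equal length of the same path, hence equal.\<close>
      have "prepend_path ?p (cycle_path v0) = prepend_path (map (infp x) [0..<length ?p]) (infp y)"
        using y(2) xi prepend_rep by simp
      then obtain r where "map (infp x) [0..<length ?p] = ?p @ r" "cycle_path v0 = prepend_path r (infp y)"
        using prepend_path_eqD by (metis diff_zero le_refl length_map length_upt)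
      moreover from this(1) have "length (map (infp x) [0..<length ?p]) = length ?p + length r"
        by (metis length_append)
      then have "r = []" by simp
      ultimately have "map (infp x) [0..<length ?p] = ?p" by simp
      then have "word_map (map Ghost (rev ?p)) x = Some y"
        unfolding word_map_Ghosts_iff[OF xp sub] using y by metis
      then show ?thesis using 3 by (simp add: power_word_def)
    qed
  qed
  then obtain y where y: "\<And>i. word_map (power_word d i) x = Some (y i)" by metis
  have deg: "word_degree (y i) = word_degree x + i * int (length d)" for i
    using word_map_degree[OF xp y[of i]] power_word_degree[of i] by simp
  have inj: "y i = y j \<longleftrightarrow> i = j" for i j
  proof
    assume "y i = y j"
    then have "word_degree x + i * int (length d) = word_degree x + j * int (length d)"
      using deg[of i] deg[of j] by metis
    then show "i = j" using d_props(1) by simp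
  qed simp
  obtain i0 where i0: "i0 \<in> Poly_Mapping.keys f" using f by (metis all_not_in_conv keys_eq_empty)
  have pv: "point_vec 1 x \<in> V" using xp by simp
  have eval: "((\<Sum>i\<in>A. Poly_Mapping.single (NC_Word (power_word d i)) (Poly_Mapping.lookup f i)) \<bullet> point_vec 1 x) z =
      (\<Sum>i\<in>A. (Poly_Mapping.single (NC_Word (power_word d i)) (Poly_Mapping.lookup f i) \<bullet> point_vec 1 x) z)"
    if "finite A" for A z
    using that
    by (induction A rule: finite_induct) (simp_all add: free_action_add[OF pv] add_vec_eq pv zero_vec_eq)
  have "(power_sum f \<bullet> point_vec 1 x) (y i0) =
      (\<Sum>i\<in>Poly_Mapping.keys f. if i = i0 then Poly_Mapping.lookup f i0 else 0)"
    unfolding power_sum_def eval[OF finite_keys]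
    unfolding single_apply_point[OF xp] y by (intro sum.cong refl) (auto simp: point_vec_def inj)
  also have "\<dots> \<noteq> 0" using i0 by (simp add: in_keys_iff)
  finally have "power_sum f \<bullet> point_vec 1 x \<noteq> zero_vec ring_of_type_algebra"
    by (auto simp: zero_vec_eq)
  moreover have "power_sum f \<bullet> basis_vec ring_of_type_algebra x = zero_vec ring_of_type_algebra"
    using ann xp lpa_class_in_annihilator_iff[OF power_sum_reps] by blast
  ultimately show False by (simp add: basis_vec_eq)
qed

locale chen_system = weighted_branching C \<iota> G "infinite_path_branching G \<alpha>" \<kappa> \<phi> + rotated_cycle G c d
  for C :: "'c ring" (structure) and \<iota> :: "'k::field \<Rightarrow> 'c"
    and G :: "('v, 'e) pre_digraph" and \<alpha> :: "nat \<Rightarrow> 'e" and \<kappa> \<phi> c d +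
  assumes \<alpha>: "infinite_path G \<alpha>" and eventually_c: "\<exists>n. \<forall>k. \<alpha> (n + k) \<in> set c"
begin

abbreviation P :: "('v, 'e, nat \<Rightarrow> 'e) branching" where "P \<equiv> infinite_path_branching G \<alpha>"

abbreviation rep_act :: "('v, 'e, 'k) free_elem \<Rightarrow> ((nat \<Rightarrow> 'e) \<Rightarrow> 'c) \<Rightarrow> (nat \<Rightarrow> 'e) \<Rightarrow> 'c" (infixr "\<bullet>" 70) where
  "a \<bullet> m \<equiv> free_action C \<iota> act a m"

lemma cycle_path_in_P: "cycle_path v0 \<in> vert_part P v0"
proof -
  obtain n where n: "\<And>k. \<alpha> (n + k) \<in> set c" using eventually_c by blast
  let ?\<beta> = "\<lambda>k. \<alpha> (n + k)"
  define u where "u = tail G (\<alpha> n)"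
  have u: "u \<in> cv" using n[of 0] tail_in_cv by (simp add: u_def)
  have \<beta>: "infinite_path G ?\<beta>" by (rule infinite_path_drop[OF \<alpha>])
  have "?\<beta> = cycle_path u"
    using cycle_path_unique[OF \<beta> n] by (simp add: u_def)
  moreover obtain p where p: "awalk v0 p u" by (rule cv_path[OF d_props(4) u])
  then have "prepend_path p (cycle_path u) = cycle_path v0"
    by (rule prepend_cycle_path[OF _ d_props(4) u])
  ultimately have eq: "cycle_path v0 = prepend_path p ?\<beta>" by simp
  have "awalk v0 p (tail G (?\<beta> 0))" using p by (simp add: u_def)
  then show ?thesis
    using infinite_path_prepend[OF _ \<beta>] unfolding eq
    by (simp add: infinite_path_branching_def tail_equivalent_prepend_iff tail_equivalent_drop)
qed

text \<open>This is the contrast to the module of \<open>c\<close>: the degree is forgotten, only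
  one point remains at \<open>v0\<close>, and every power of \<open>d\<close> acts on it as a
  scalar.\<close>

lemma vert_part_v0: "vert_part P v0 = {cycle_path v0}"
proof -
  obtain n where n: "\<And>k. \<alpha> (n + k) \<in> set c" using eventually_c by blast
  have "\<beta> = cycle_path v0" if "\<beta> \<in> vert_part P v0" for \<beta>
    using that tail_equivalent_cycle_path[of \<beta> \<alpha> n, OF _ _ n] d_props(4)
    by (auto simp: infinite_path_branching_def)
  then show ?thesis using cycle_path_in_P by blast
qed

lemma word_map_Edges:
  "awalk u p w \<Longrightarrow> \<beta> \<in> vert_part P w \<Longrightarrow>
    word_map (map Edge p) \<beta> = Some (prepend_path p \<beta>) \<and> prepend_path p \<beta> \<in> vert_part P u"
proof (induction p arbitrary: u)
  case Nil
  then show ?case by (simp add: awalk_Nil_iff)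
next
  case (Cons e p)
  then have e: "e \<in> arcs G" "u = tail G e" "awalk (head G e) p w" by (auto simp: awalk_Cons_iff)
  have IH: "word_map (map Edge p) \<beta> = Some (prepend_path p \<beta>)" "prepend_path p \<beta> \<in> vert_part P (head G e)"
    using Cons.IH[OF e(3) Cons.prems(2)] by auto
  have "edge_map P e (prepend_path p \<beta>) = prepend_path (e # p) \<beta>"
    by (simp add: infinite_path_branching_def)
  then show ?case
    using IH e edge_map_in[OF e(1) IH(2)] edge_part_subset[OF e(1)] by auto
qed

lemma word_map_Ghosts:
  "awalk u p w \<Longrightarrow> \<beta> \<in> vert_part P w \<Longrightarrow> word_map (map Ghost (rev p)) (prepend_path p \<beta>) = Some \<beta>"
proof (induction p arbitrary: u)
  case Nil
  then show ?case by simp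
next
  case (Cons e p)
  then have e: "e \<in> arcs G" "awalk (head G e) p w" by (auto simp: awalk_Cons_iff)
  have p: "prepend_path p \<beta> \<in> vert_part P (head G e)"
    using word_map_Edges[OF e(2) Cons.prems(2)] by simp
  have "edge_map P e (prepend_path p \<beta>) = prepend_path (e # p) \<beta>"
    by (simp add: infinite_path_branching_def)
  then have "partial_action (Ghost e) (prepend_path (e # p) \<beta>) = Some (prepend_path p \<beta>)"
    using edge_map_in[OF e(1) p] inv_edge_map[OF e(1) p] e(1) by simp
  then show ?case
    using Cons.IH[OF e(2) Cons.prems(2)] by (simp add: word_map_append del: partial_action.simps)
qed

lemma word_map_power_word: "word_map (power_word d i) (cycle_path v0) = Some (cycle_path v0)"
proof -
  have v0: "v0 \<in> verts G" using d_props(4) cv_verts by blast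
  have "word_map (map Edge (rep n)) (cycle_path v0) = Some (cycle_path v0)" for n
    using word_map_Edges[OF rep_awalk cycle_path_in_P, of n] prepend_rep[of n] by simp
  moreover have "word_map (map Ghost (rev (rep n))) (cycle_path v0) = Some (cycle_path v0)" for n
    using word_map_Ghosts[OF rep_awalk cycle_path_in_P, of n] prepend_rep[of n] by simp
  ultimately show ?thesis
    using v0 cycle_path_in_P by (simp add: power_word_def)
qed

text \<open>Whatever the sign of \<open>i\<close>, the letter that acts first kills every point
  whose source is not \<open>v0\<close>.\<close>

lemma word_map_power_word_None:
  assumes "\<beta> \<in> points P" "\<beta> \<noteq> cycle_path v0"
  shows "word_map (power_word d i) \<beta> = None"
proof -
  have \<beta>: "\<beta> \<notin> vert_part P v0" using assms(2) vert_part_v0 by simp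
  have last: "word_map gs \<beta> = None" if "gs \<noteq> []" "partial_action (last gs) \<beta> = None" for gs
  proof -
    have "gs = butlast gs @ [last gs]" using that(1) by simp
    moreover have "word_map (butlast gs @ [last gs]) \<beta> = None"
      using that(2) by (simp add: word_map_append)
    ultimately show ?thesis by metis
  qed
  consider "i = 0" | "i > 0" | "i < 0" by linarith
  then show ?thesis
  proof cases
    case 1
    then show ?thesis using \<beta> by (simp add: power_word_def)
  next
    case 2
    let ?p = "rep (nat i)"
    have ne: "?p \<noteq> []" using 2 by (intro rep_nonempty) simp
    have "awlast v0 ?p = v0" using rep_awalk by auto
    then have "head G (last ?p) = v0"
      using ne by (simp add: awalk_verts_conv del: concat_eq_Nil_conv)
    then have "partial_action (last (map Edge ?p)) \<beta> = None"
      using \<beta> ne by (simp add: last_map del: concat_eq_Nil_conv)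
    then have "word_map (map Edge ?p) \<beta> = None"
      using ne by (intro last) (simp_all del: concat_eq_Nil_conv partial_action.simps)
    then show ?thesis using 2 by (simp add: power_word_def)
  next
    case 3
    let ?p = "rep (nat (- i))"
    have ne: "?p \<noteq> []" using 3 by (intro rep_nonempty) simp
    have "hd ?p = hd d"
      using 3 d_props(1) by (cases "nat (- i)") auto
    then have "partial_action (last (map Ghost (rev ?p))) \<beta> = None"
      using \<beta> ne edge_part_subset[of "hd d"] by (auto simp: last_map last_rev simp del: concat_eq_Nil_conv)
    then have "word_map (map Ghost (rev ?p)) \<beta> = None"
      using ne by (intro last) (simp_all del: concat_eq_Nil_conv partial_action.simps)
    then show ?thesis using 3 by (simp add: power_word_def)
  qed
qed

text \<open>On the one basis vector that survives, \<open>f(d)\<close> acts as the scalar in the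
  hypothesis.\<close>

lemma power_sum_annihilates:
  assumes zero: "(\<Oplus>i\<in>Poly_Mapping.keys f. \<iota> (Poly_Mapping.lookup f i) \<otimes> word_weight (power_word d i)) = \<zero>"
  shows "lpa_class K G (power_sum f) \<in> annihilator (leavitt K G) the_module"
proof -
  have "power_sum f \<bullet> basis_vec C \<beta> = zero_vec C" if \<beta>: "\<beta> \<in> points P" for \<beta>
  proof (cases "\<beta> = cycle_path v0")
    case False
    then show ?thesis
      unfolding power_sum_def using \<beta>
      by (intro free_action_sum_zero) (simp_all add: single_apply_basis word_map_power_word_None)
  next
    case True
    have b: "basis_vec C \<beta> \<in> V" using \<beta> by simp
    have "(\<Sum>i\<in>A. Poly_Mapping.single (NC_Word (power_word d i)) (Poly_Mapping.lookup f i)) \<bullet> basis_vec C \<beta> =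
        scale_vec C (\<Oplus>i\<in>A. \<iota> (Poly_Mapping.lookup f i) \<otimes> word_weight (power_word d i)) (basis_vec C \<beta>)"
      if "finite A" for A
      using that
    proof (induction A rule: finite_induct)
      case empty
      then show ?case using scale_vec_simps(2)[OF b] b by simp
    next
      case (insert i A)
      let ?g = "\<lambda>i. \<iota> (Poly_Mapping.lookup f i) \<otimes> word_weight (power_word d i)"
      have "Poly_Mapping.single (NC_Word (power_word d i)) (Poly_Mapping.lookup f i) \<bullet> basis_vec C \<beta> =
          scale_vec C (?g i) (basis_vec C \<beta>)"
        using \<beta> True word_map_power_word by (simp add: single_apply_basis)
      moreover have "scale_vec C (?g i \<oplus> finsum C ?g A) (basis_vec C \<beta>) =
          add_vec (scale_vec C (?g i) (basis_vec C \<beta>)) (scale_vec C (finsum C ?g A) (basis_vec C \<beta>))"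
      proof
        fix y
        have "basis_vec C \<beta> y \<in> carrier C" by (rule free_carrierD[OF b])
        then show "scale_vec C (?g i \<oplus> finsum C ?g A) (basis_vec C \<beta>) y =
            add_vec (scale_vec C (?g i) (basis_vec C \<beta>)) (scale_vec C (finsum C ?g A) (basis_vec C \<beta>)) y"
          by (simp add: scale_vec_def add_vec_def l_distr)
      qed
      moreover have "finsum C ?g (insert i A) = ?g i \<oplus> finsum C ?g A"
        using insert by (intro finsum_insert) auto
      ultimately show ?case using insert b by (simp add: free_action_add)
    qed
    from this[OF finite_keys[of f]] show ?thesis
      unfolding zero power_sum_def using scale_vec_simps(2)[OF b] by simp
  qed
  then show ?thesis
    using lpa_class_in_annihilator_iff[OF power_sum_reps] by blast
qed

end

section \<open>Laurent polynomials modulo \<open>f\<close> and the weights of the twist\<close>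

lemma laurent_ideal: "ideal (PIdl\<^bsub>ring_of_type_algebra\<^esub> f) (ring_of_type_algebra :: 'k::field laurent ring)"
proof -
  interpret cring "ring_of_type_algebra :: 'k laurent ring" by (rule cring_from_type_algebra)
  show ?thesis by (rule cgenideal_ideal) simp
qed

lemma laurent_class_ops:
  "laurent_class f (a + b) = laurent_class f a \<oplus>\<^bsub>laurent_quotient f\<^esub> laurent_class f b"
  "laurent_class f (a * b) = laurent_class f a \<otimes>\<^bsub>laurent_quotient f\<^esub> laurent_class f b"
  "laurent_class f 1 = \<one>\<^bsub>laurent_quotient f\<^esub>"
  "laurent_class f a \<in> carrier (laurent_quotient f)"
proof -
  interpret ideal "PIdl\<^bsub>ring_of_type_algebra\<^esub> f" "ring_of_type_algebra :: 'a laurent ring"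
    by (rule laurent_ideal)
  note hom = rcos_ring_hom
  show "laurent_class f (a + b) = laurent_class f a \<oplus>\<^bsub>laurent_quotient f\<^esub> laurent_class f b"
    using ring_hom_add[OF hom, of a b] by (simp add: laurent_class_def laurent_quotient_def)
  show "laurent_class f (a * b) = laurent_class f a \<otimes>\<^bsub>laurent_quotient f\<^esub> laurent_class f b"
    using ring_hom_mult[OF hom, of a b] by (simp add: laurent_class_def laurent_quotient_def)
  show "laurent_class f 1 = \<one>\<^bsub>laurent_quotient f\<^esub>"
    using ring_hom_one[OF hom] by (simp add: laurent_class_def laurent_quotient_def)
  show "laurent_class f a \<in> carrier (laurent_quotient f)"
    using ring_hom_closed[OF hom, of a] by (simp add: laurent_class_def laurent_quotient_def)
qed

lemma cring_laurent_quotient: "cring (laurent_quotient f)"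
  unfolding laurent_quotient_def
  by (rule ideal.quotient_is_cring[OF laurent_ideal]) (rule cring_from_type_algebra)

lemma laurent_class_zero_iff: "laurent_class f a = \<zero>\<^bsub>laurent_quotient f\<^esub> \<longleftrightarrow> f dvd a"
proof -
  interpret ideal "PIdl\<^bsub>ring_of_type_algebra\<^esub> f" "ring_of_type_algebra :: 'a laurent ring"
    by (rule laurent_ideal)
  have "a \<in> PIdl\<^bsub>ring_of_type_algebra\<^esub> f \<longleftrightarrow> f dvd a"
    by (auto simp: cgenideal_def dvd_def mult.commute)
  moreover have "laurent_class f a = \<zero>\<^bsub>laurent_quotient f\<^esub> \<longleftrightarrow> a \<in> PIdl\<^bsub>ring_of_type_algebra\<^esub> f"
    unfolding laurent_class_def laurent_quotient_def FactRing_def ring.simps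
    using a_rcos_self[of a] a_rcos_const[of a] by auto
  ultimately show ?thesis by simp
qed

lemma laurent_class_sum:
  assumes "finite A"
  shows "laurent_class f (sum g A) = (\<Oplus>\<^bsub>laurent_quotient f\<^esub>i\<in>A. laurent_class f (g i))"
proof -
  interpret cring "laurent_quotient f" by (rule cring_laurent_quotient)
  show ?thesis
    using assms
  proof (induction A rule: finite_induct)
    case empty
    then show ?case by (simp add: laurent_class_zero_iff)
  next
    case (insert i A)
    then show ?case by (simp add: laurent_class_ops finsum_insert Pi_def)
  qed
qed

lemma twisted_weighted_branching:
  fixes f :: "'k::field laurent"
  assumes "wf_digraph G"
  shows "weighted_branching (laurent_quotient f) (\<lambda>k. laurent_class f (Poly_Mapping.single 0 k)) G
    (infinite_path_branching G \<alpha>)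
    (\<lambda>g. if g = Edge (hd d) then laurent_class f (Poly_Mapping.single 1 1)
         else if g = Ghost (hd d) then laurent_class f (Poly_Mapping.single (- 1) 1)
         else \<one>\<^bsub>laurent_quotient f\<^esub>)
    (twisted_action G \<alpha> d f)"
proof -
  interpret wf_digraph G by fact
  interpret B: branching_system G "infinite_path_branching G \<alpha>" by (rule branching_system_infinite_path)
  interpret C: cring "laurent_quotient f" by (rule cring_laurent_quotient)
  let ?Q = "laurent_quotient f" and ?\<iota> = "\<lambda>k. laurent_class f (Poly_Mapping.single 0 k)"
  let ?\<kappa> = "\<lambda>g. if g = Edge (hd d) then laurent_class f (Poly_Mapping.single 1 1)
      else if g = Ghost (hd d) then laurent_class f (Poly_Mapping.single (- 1) 1) else \<one>\<^bsub>?Q\<^esub>"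
  have "?\<iota> (a + b) = ?\<iota> a \<oplus>\<^bsub>?Q\<^esub> ?\<iota> b" for a b
    by (simp add: single_add laurent_class_ops(1))
  moreover have "?\<iota> (a * b) = ?\<iota> a \<otimes>\<^bsub>?Q\<^esub> ?\<iota> b" for a b
    by (simp add: mult_single laurent_class_ops(2)[symmetric])
  moreover have "?\<iota> 1 = \<one>\<^bsub>?Q\<^esub>" by (simp add: laurent_class_ops(3))
  moreover have "?\<iota> 0 = \<zero>\<^bsub>?Q\<^esub>" by (simp add: laurent_class_zero_iff)
  ultimately have \<iota>: "coefficient_ring ?Q ?\<iota>"
    by unfold_locales (simp_all add: laurent_class_ops(4))
  have T: "laurent_class f (Poly_Mapping.single 1 1) \<otimes>\<^bsub>?Q\<^esub>
      laurent_class f (Poly_Mapping.single (- 1) 1) = \<one>\<^bsub>?Q\<^esub>"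
    by (simp add: laurent_class_ops(2,3)[symmetric] mult_single)
  have act: "branching_action G (infinite_path_branching G \<alpha>) ?Q g x y \<in> carrier ?Q" for g x y
    by (cases g) (auto simp: basis_vec_def zero_vec_def)
  have \<phi>: "twisted_action G \<alpha> d f g x = scale_vec ?Q (?\<kappa> g)
      (branching_action G (infinite_path_branching G \<alpha>) ?Q g x)" for g x
    using act[of g x] by (simp add: twisted_action_def Let_def scale_vec_def)
  show ?thesis
  proof (intro weighted_branching.intro weighted_branching_axioms.intro)
    show "coefficient_ring ?Q ?\<iota>" by (rule \<iota>)
    show "branching_system G (infinite_path_branching G \<alpha>)" by (rule branching_system_infinite_path)
    show "?\<kappa> g \<in> carrier ?Q" for g by (simp add: laurent_class_ops(4))
    show "?\<kappa> (Edge e) \<otimes>\<^bsub>?Q\<^esub> ?\<kappa> (Ghost e) = \<one>\<^bsub>?Q\<^esub>" for e using T by simp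
    show "twisted_action G \<alpha> d f g x = scale_vec ?Q (?\<kappa> g)
      (branching_action G (infinite_path_branching G \<alpha>) ?Q g x)" for g x by (rule \<phi>)
  qed simp
qed

text \<open>The edges of \<open>d\<close> are distinct, so each turn passes the weighted first edge
  exactly once.\<close>

lemma twisted_word_weight:
  fixes f :: "'k::field laurent"
  assumes "wf_digraph G" "rotated_cycle G c d"
  defines "Q \<equiv> laurent_quotient f"
  defines "\<kappa> \<equiv> \<lambda>g. if g = Edge (hd d) then laurent_class f (Poly_Mapping.single 1 1)
      else if g = Ghost (hd d) then laurent_class f (Poly_Mapping.single (- 1) 1) else \<one>\<^bsub>Q\<^esub>"
  shows "weighted_branching.word_weight Q \<kappa> (graph_with_exclusive_cycle.power_word G d i) =
    laurent_class f (Poly_Mapping.single i 1)"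
proof -
  interpret rotated_cycle G c d by fact
  interpret W: weighted_branching Q "\<lambda>k. laurent_class f (Poly_Mapping.single 0 k)" G
      "infinite_path_branching G \<alpha>" \<kappa> "twisted_action G \<alpha> d f" for \<alpha>
    unfolding Q_def \<kappa>_def by (rule twisted_weighted_branching[OF assms(1)])
  obtain e t where et: "d = e # t" "e \<notin> set t"
    using d_props(1,3) by (cases d) auto
  have one: "laurent_class f 1 = \<one>\<^bsub>Q\<^esub>"
    by (simp add: Q_def laurent_class_ops(3))
  have mult: "laurent_class f (Poly_Mapping.single i 1) \<otimes>\<^bsub>Q\<^esub> laurent_class f (Poly_Mapping.single j 1) =
      laurent_class f (Poly_Mapping.single (i + j) 1)" for i j
    by (simp add: Q_def laurent_class_ops(2)[symmetric] mult_single)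
  have carr: "laurent_class f a \<in> carrier Q" for a by (simp add: Q_def laurent_class_ops(4))
  have \<kappa>: "\<kappa> (Edge a) = (if a = e then laurent_class f (Poly_Mapping.single 1 1) else \<one>\<^bsub>Q\<^esub>)"
    "\<kappa> (Ghost a) = (if a = e then laurent_class f (Poly_Mapping.single (- 1) 1) else \<one>\<^bsub>Q\<^esub>)"
    "\<kappa> (Vert w) = \<one>\<^bsub>Q\<^esub>" for a w
    by (simp_all add: \<kappa>_def et(1))
  have trivial: "W.word_weight (map Edge s) = \<one>\<^bsub>Q\<^esub>" "W.word_weight (map Ghost s) = \<one>\<^bsub>Q\<^esub>"
    if "e \<notin> set s" for s
    using that by (induction s) (auto simp: \<kappa>)
  have dE: "W.word_weight (map Edge d) = laurent_class f (Poly_Mapping.single 1 1)"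
    using trivial(1)[OF et(2)] carr by (simp add: et(1) \<kappa>)
  have dG: "W.word_weight (map Ghost (rev d)) = laurent_class f (Poly_Mapping.single (- 1) 1)"
    using trivial(2)[of "rev t"] et(2) carr by (simp add: et(1) \<kappa> W.word_weight_append)
  have E: "W.word_weight (map Edge (rep n)) = laurent_class f (Poly_Mapping.single (int n) 1)" for n
    by (induction n) (simp_all add: one W.word_weight_append dE mult)
  have G': "W.word_weight (map Ghost (rev (rep n))) = laurent_class f (Poly_Mapping.single (- int n) 1)" for n
    by (induction n) (simp_all add: one W.word_weight_append dG mult minus_diff_commute)
  have V: "W.word_weight [Vert v0] = laurent_class f (Poly_Mapping.single 0 1)"
    by (simp add: \<kappa> one)
  consider "i = 0" | "i > 0" | "i < 0" by linarith
  then show ?thesis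
  proof cases
    case 1
    then show ?thesis using V by (simp only: power_word_def refl if_True)
  next
    case 2
    then show ?thesis using E[of "nat i"] by (simp add: power_word_def)
  next
    case 3
    then show ?thesis using G'[of "nat (- i)"] by (simp add: power_word_def)
  qed
qed

section \<open>Comparison of annihilators\<close>

context cycle_module_system begin

lemma annihilator_eqD:
  assumes W: "weighted_branching C \<iota> G Y \<kappa> \<phi>" and one: "\<one>\<^bsub>C\<^esub> \<noteq> \<zero>\<^bsub>C\<^esub>"
    and eq: "annihilator (leavitt K G) (cycle_module K G c v) =
      annihilator (leavitt K G) (lpa_module C \<iota> (points Y) \<phi>)"
    and w: "w \<in> verts G"
  shows "vert_part Y w \<noteq> {} \<longleftrightarrow> w \<in> R"
proof -
  interpret W: weighted_branching C \<iota> G Y \<kappa> \<phi> by fact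
  show ?thesis
    using W.vertex_in_annihilator_iff[OF w one] vertex_annihilates_iff[OF w] eq
    by (simp add: W.the_module_def)
qed

text \<open>Common core of the twisted and untwisted cases. The assumptions on \<open>d\<close> and
  on the weights are conditional, because only the supposed equality of annihilators shows that
  \<alpha> ends on \<open>c\<close>.\<close>

lemma chen_annihilator_neq:
  assumes W: "weighted_branching C \<iota> G (infinite_path_branching G \<alpha>) \<kappa> \<phi>"
    and one: "\<one>\<^bsub>C\<^esub> \<noteq> \<zero>\<^bsub>C\<^esub>" and \<alpha>: "infinite_path G \<alpha>"
    and d: "\<And>n. \<forall>k. \<alpha> (n + k) \<in> set c \<Longrightarrow> rotated_cycle G c d"
    and f: "f \<noteq> (0 :: 'k laurent)"
    and zero: "rotated_cycle G c d \<Longrightarrow>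
      (\<Oplus>\<^bsub>C\<^esub>i\<in>Poly_Mapping.keys f. \<iota> (Poly_Mapping.lookup f i) \<otimes>\<^bsub>C\<^esub>
        weighted_branching.word_weight C \<kappa> (power_word d i)) = \<zero>\<^bsub>C\<^esub>"
  shows "annihilator (leavitt K G) (cycle_module K G c v) \<noteq>
    annihilator (leavitt K G) (lpa_module C \<iota> (points (infinite_path_branching G \<alpha>)) \<phi>)"
proof
  interpret W: weighted_branching C \<iota> G "infinite_path_branching G \<alpha>" \<kappa> \<phi> by fact
  assume eq: "annihilator (leavitt K G) (cycle_module K G c v) =
    annihilator (leavitt K G) (lpa_module C \<iota> (points (infinite_path_branching G \<alpha>)) \<phi>)"
  have ev: "\<exists>n. \<forall>k. \<alpha> (n + k) \<in> set c"
    by (rule eventually_on_cycle[OF \<alpha> annihilator_eqD[OF W one eq]])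
  then have rot: "rotated_cycle G c d" using d by blast
  interpret rotated_cycle G c d by (rule rot)
  interpret S: chen_system C \<iota> G \<alpha> \<kappa> \<phi> c d
    by unfold_locales (rule \<alpha>, rule ev)
  have "lpa_class K G (power_sum f) \<in> annihilator (leavitt K G) W.the_module"
    by (rule S.power_sum_annihilates[OF zero[OF rot]])
  then show False
    using power_sum_not_annihilating[OF rot f] eq by (simp add: W.the_module_def cycle_module_eq)
qed

lemma finite_path_annihilator_neq:
  assumes u: "sink G u \<or> infinite_emitter G u"
  shows "annihilator (leavitt K G) (cycle_module K G c v) \<noteq>
    annihilator (leavitt K G) (finite_path_module K G u)"
proof
  let ?Y = "finite_path_branching G u"
  have uv: "u \<in> verts G" using u by (auto simp: sink_def infinite_emitter_def)
  have "\<not> regular G u" using u by (auto simp: regular_def)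
  then interpret Y: branching_system G ?Y by (rule branching_system_finite_path)
  interpret Y: field_branching K G ?Y by unfold_locales
  assume eq: "annihilator (leavitt K G) (cycle_module K G c v) =
    annihilator (leavitt K G) (finite_path_module K G u)"
  have R: "vert_part ?Y w \<noteq> {} \<longleftrightarrow> w \<in> R" if "w \<in> verts G" for w
    using eq that
    by (intro annihilator_eqD[OF Y.weighted_branching_axioms])
      (simp_all add: finite_path_module_def branching_module_def)
  have trivial: "(u, []) \<in> vert_part ?Y u"
    using uv by (simp add: finite_path_branching_def awalk_Nil_iff)
  \<comment> \<open>\<open>u\<close> reaches \<open>c\<close>, since the trivial path makes
    \<open>u\<close> support its own module. Conversely \<open>v\<close> supports that module too,
    so \<open>c\<close> reaches \<open>u\<close>.\<close>
  then have "u \<in> R" using R[OF uv] by blast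
  then obtain w q where w: "w \<in> cv" "awalk u q w" unfolding in_R_iff by blast
  have "vert_part ?Y v \<noteq> {}" using R v_in_cv cv_verts cv_subset_R by blast
  then obtain p where "awalk v p u" by (auto simp: finite_path_branching_def)
  then have u_cv: "u \<in> cv" using path_verts_in_cv w v_in_cv by blast
  \<comment> \<open>Every point at \<open>u\<close> in the module of \<open>c\<close> begins with
    \<open>e\<close>, because a walk from \<open>u\<close> to \<open>c\<close> stays on
    \<open>c\<close>; the trivial path at \<open>u\<close> begins with no edge.\<close>
  define e where "e = next_edge u"
  have e: "e \<in> arcs G" "tail G e = u" using next_edge[OF u_cv] by (auto simp: e_def)
  \<comment> \<open>The sum over a singleton matches the form of
    \<open>cuntz_krieger_apply_basis\<close>.\<close>
  let ?a = "gn (Vert u) - (\<Sum>e\<in>{e}. gn (Edge e) * gn (Ghost e)) :: ('v, 'e, 'k) free_elem"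
  have a: "?a \<in> lpa_reps K G"
    using uv e by (intro lpa_reps_closed(3) lpa_reps_sum lpa_reps_closed(4) lpa_reps_gn
        lpa_reps_carrier) simp_all
  have "?a \<bullet> basis_vec ring_of_type_algebra x = zero_vec ring_of_type_algebra" if x: "x \<in> points N" for x
  proof (rule cuntz_krieger_apply_basis[OF x uv])
    assume xu: "x \<in> vert_part N u"
    obtain w p q t where xx: "x = ((w, p), (v, q))" "t \<in> cv" "awalk w p t" "infp x = prepend_path p (cycle_path t)"
      using x by (rule pointsE)
    then have "w = u" using xu by (simp add: vert_part_N)
    then have "infp x = cycle_path u" using prepend_cycle_path[of u p t] xx u_cv by simp
    then show "\<exists>e'\<in>{e}. x \<in> edge_part N e'"
      using x e by (simp add: edge_part_iff e_def)
  qed (use e in auto)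
  then have "lpa_class K G ?a \<in> annihilator (leavitt K G) the_module"
    using lpa_class_in_annihilator_iff[OF a] by blast
  then have "lpa_class K G ?a \<in> annihilator (leavitt K G) Y.the_module"
    using eq by (simp add: cycle_module_eq finite_path_module_def Y.the_module_eq)
  moreover have up: "(u, []) \<in> points ?Y" using trivial Y.vert_part_subset[OF uv] by blast
  ultimately have "free_action ring_of_type_algebra (\<lambda>k. k) Y.act ?a (basis_vec ring_of_type_algebra (u, [])) =
      zero_vec ring_of_type_algebra"
    using Y.lpa_class_in_annihilator_iff[OF a] by blast
  moreover have b: "basis_vec ring_of_type_algebra (u, []) \<in> Y.V" using up by (rule basis_vec_closed)
  ultimately have "free_action ring_of_type_algebra (\<lambda>k. k) Y.act (gn (Vert u)) (basis_vec ring_of_type_algebra (u, [])) =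
      free_action ring_of_type_algebra (\<lambda>k. k) Y.act (gn (Edge e) * gn (Ghost e)) (basis_vec ring_of_type_algebra (u, []))"
    using Y.free_action_diff_eq_zero_iff[OF b] by simp
  moreover have "(u, []) \<notin> edge_part ?Y e" by (simp add: finite_path_branching_def)
  ultimately have "point_vec (1::'k) (u, [] :: 'e list) = (\<lambda>_. 0)"
    using Y.gn_apply_basis[OF up, of "Vert u"] Y.edge_ghost_apply_basis[OF up e(1)] trivial uv
    by (simp add: Y.monomial_vec_eq Y.zero_vec_eq)
  then have "point_vec (1::'k) (u, [] :: 'e list) (u, []) = 0" by simp
  then show False by (simp add: point_vec_def)
qed

lemma left_module_branching:
  assumes "branching_system G Y"
  shows "left_module (leavitt K G) (branching_module K G Y)"
proof -
  interpret Y: branching_system G Y by fact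
  interpret Y: field_branching K G Y by unfold_locales
  show ?thesis unfolding Y.the_module_eq[symmetric] by (rule Y.left_module_the_module)
qed

lemma not_isomorphicI:
  assumes "left_module (leavitt K G) M"
    and "annihilator (leavitt K G) (cycle_module K G c v) \<noteq> annihilator (leavitt K G) M"
  shows "\<not> isomorphic (leavitt K G) (cycle_module K G c v) M"
  using isomorphic_annihilator_eq[OF left_module_cycle_module assms(1)] assms(2) by blast

lemma chen_module_case:
  assumes \<alpha>: "infinite_path G \<alpha>"
  shows "\<not> isomorphic (leavitt K G) (cycle_module K G c v) (chen_module K G \<alpha>)"
    "annihilator (leavitt K G) (cycle_module K G c v) \<noteq> annihilator (leavitt K G) (chen_module K G \<alpha>)"
proof -
  let ?Y = "infinite_path_branching G \<alpha>"
  have sys: "branching_system G ?Y" by (rule branching_system_infinite_path)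
  interpret Y: branching_system G ?Y by (rule sys)
  interpret Y: field_branching K G ?Y by unfold_locales
  \<comment> \<open>All weights are 1 here, so every power of \<open>c\<close> fixes the path around
    \<open>c\<close>, and any polynomial with root 1 would do; \<open>1 - x\<close> is the
    simplest.\<close>
  let ?f = "Poly_Mapping.single 0 1 - Poly_Mapping.single 1 1 :: 'k laurent"
  have f: "Poly_Mapping.lookup ?f i = (if i = 0 then 1 else if i = 1 then - 1 else 0)" for i
    by (simp add: lookup_minus lookup_single lookup_one when_def)
  have keys: "Poly_Mapping.keys ?f = {0, 1}"
    by (auto simp: in_keys_iff f simp del: single_one split: if_splits)
  have rot: "rotated_cycle G c c"
    using cycle_c by unfold_locales (auto simp: same_cycle_def intro: exI[of _ 0])
  show neq: "annihilator (leavitt K G) (cycle_module K G c v) \<noteq> annihilator (leavitt K G) (chen_module K G \<alpha>)"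
    unfolding chen_module_def branching_module_def
  proof (rule chen_annihilator_neq[OF Y.weighted_branching_axioms _ \<alpha> rot, where f = ?f])
    show "?f \<noteq> 0" using keys by (metis insert_not_empty keys_zero)
    show "(\<Oplus>\<^bsub>ring_of_type_algebra\<^esub>i\<in>Poly_Mapping.keys ?f. Poly_Mapping.lookup ?f i \<otimes>\<^bsub>ring_of_type_algebra\<^esub>
        Y.word_weight (power_word c i)) = \<zero>\<^bsub>ring_of_type_algebra\<^esub>"
      by (simp add: keys f del: single_one)
  qed simp
  show "\<not> isomorphic (leavitt K G) (cycle_module K G c v) (chen_module K G \<alpha>)"
    using neq left_module_branching[OF sys] unfolding chen_module_def by (intro not_isomorphicI)
qed

lemma twisted_chen_module_case:
  fixes f :: "'k laurent"
  assumes \<alpha>: "infinite_path G \<alpha>" and d: "cycle d" and eq: "tail_equivalent \<alpha> (repeat_path d)"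
    and f: "Factorial_Ring.irreducible f"
  shows "\<not> isomorphic (leavitt K G) (cycle_module K G c v) (twisted_chen_module G \<alpha> d f)"
    "annihilator (leavitt K G) (cycle_module K G c v) \<noteq> annihilator (leavitt K G) (twisted_chen_module G \<alpha> d f)"
proof -
  let ?Y = "infinite_path_branching G \<alpha>"
  note W = twisted_weighted_branching[OF wf_digraph_axioms, of f \<alpha> d]
  interpret W: weighted_branching "laurent_quotient f" "\<lambda>k. laurent_class f (Poly_Mapping.single 0 k)" G ?Y
    "\<lambda>g. if g = Edge (hd d) then laurent_class f (Poly_Mapping.single 1 1)
         else if g = Ghost (hd d) then laurent_class f (Poly_Mapping.single (- 1) 1)
         else \<one>\<^bsub>laurent_quotient f\<^esub>" "twisted_action G \<alpha> d f"
    by (rule W)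
  \<comment> \<open>An irreducible element is not a unit, so the quotient is not the zero
    ring.\<close>
  have one: "\<one>\<^bsub>laurent_quotient f\<^esub> \<noteq> \<zero>\<^bsub>laurent_quotient f\<^esub>"
    using f laurent_class_zero_iff[of f 1] by (simp add: laurent_class_ops(3) irreducible_def)
  \<comment> \<open>The path \<alpha> ends on \<open>c\<close> and also in repetitions of
    \<open>d\<close>, so the two cycles share an edge, and exclusivity of \<open>c\<close>
    identifies them.\<close>
  have rot: "rotated_cycle G c d" if n: "\<forall>k. \<alpha> (n + k) \<in> set c" for n
  proof -
    obtain i j where ij: "\<And>k. \<alpha> (i + k) = repeat_path d (j + k)"
      using eq unfolding tail_equivalent_def by blast
    have "d \<noteq> []" using d by (auto simp: cycle_def)
    then have "repeat_path d (j + n) \<in> set d" by (simp add: repeat_path_def)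
    moreover have "repeat_path d (j + n) \<in> set c"
      using ij[of n] n by (metis add.commute)
    ultimately have "cycle_verts G d \<inter> cv \<noteq> {}" by (auto simp: cycle_verts_def)
    then have "same_cycle c d" using exclusive d by (simp add: exclusive_cycle_def)
    then show ?thesis using d by unfold_locales
  qed
  have module: "twisted_chen_module G \<alpha> d f = W.the_module"
    by (simp add: twisted_chen_module_def W.the_module_def)
  show neq: "annihilator (leavitt K G) (cycle_module K G c v) \<noteq>
      annihilator (leavitt K G) (twisted_chen_module G \<alpha> d f)"
    unfolding twisted_chen_module_def
  proof (rule chen_annihilator_neq[OF W one \<alpha> rot, where f = f])
    show "f \<noteq> 0" using f by (auto simp: irreducible_def)
    \<comment> \<open>As \<open>d\<^sup>i\<close> has weight the class of \<open>x\<^sup>i\<close>,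
      the scalar by which \<open>f(d)\<close> acts is the class of \<open>f\<close> in its own
      quotient.\<close>
    assume rot: "rotated_cycle G c d"
    have "(\<Oplus>\<^bsub>laurent_quotient f\<^esub>i\<in>Poly_Mapping.keys f.
        laurent_class f (Poly_Mapping.single 0 (Poly_Mapping.lookup f i)) \<otimes>\<^bsub>laurent_quotient f\<^esub>
        W.word_weight (power_word d i)) =
      (\<Oplus>\<^bsub>laurent_quotient f\<^esub>i\<in>Poly_Mapping.keys f.
        laurent_class f (Poly_Mapping.single i (Poly_Mapping.lookup f i)))"
      unfolding twisted_word_weight[OF wf_digraph_axioms rot]
      by (simp add: laurent_class_ops(2)[symmetric] mult_single)
    also have "\<dots> = laurent_class f (\<Sum>i\<in>Poly_Mapping.keys f. Poly_Mapping.single i (Poly_Mapping.lookup f i))"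
      by (rule laurent_class_sum[symmetric]) simp
    also have "(\<Sum>i\<in>Poly_Mapping.keys f. Poly_Mapping.single i (Poly_Mapping.lookup f i)) = f"
      by (rule poly_mapping_eqI) (simp add: lookup_sum lookup_single when_def in_keys_iff)
    also have "laurent_class f f = \<zero>\<^bsub>laurent_quotient f\<^esub>"
      by (simp add: laurent_class_zero_iff)
    finally show "(\<Oplus>\<^bsub>laurent_quotient f\<^esub>i\<in>Poly_Mapping.keys f.
        laurent_class f (Poly_Mapping.single 0 (Poly_Mapping.lookup f i)) \<otimes>\<^bsub>laurent_quotient f\<^esub>
        W.word_weight (power_word d i)) = \<zero>\<^bsub>laurent_quotient f\<^esub>" .
  qed
  show "\<not> isomorphic (leavitt K G) (cycle_module K G c v) (twisted_chen_module G \<alpha> d f)"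
    using neq W.left_module_the_module unfolding module by (intro not_isomorphicI)
qed

lemma finite_path_module_case:
  assumes u: "sink G u \<or> infinite_emitter G u"
  shows "\<not> isomorphic (leavitt K G) (cycle_module K G c v) (finite_path_module K G u)"
proof -
  have "\<not> regular G u" using u by (auto simp: regular_def)
  then have "left_module (leavitt K G) (finite_path_module K G u)"
    unfolding finite_path_module_def by (intro left_module_branching branching_system_finite_path)
  then show ?thesis using finite_path_annihilator_neq[OF u] by (rule not_isomorphicI)
qed

lemma isomorphic_cycle_module_iff:
  assumes d: "exclusive_cycle G d" and w: "w \<in> cycle_verts G d"
  shows "isomorphic (leavitt K G) (cycle_module K G c v) (cycle_module K G d w) \<longleftrightarrow> same_cycle c d"
    "graded_isomorphic (leavitt K G) (cycle_module K G c v) (cycle_grading K G c v)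
      (cycle_module K G d w) (cycle_grading K G d w) \<longleftrightarrow> same_cycle c d \<and> v = w"
proof -
  interpret D: cycle_module_system K G d w by unfold_locales (rule d, rule w)
  have same: "same_cycle c d"
    if iso: "isomorphic (leavitt K G) (cycle_module K G c v) (cycle_module K G d w)"
  proof -
    have ann: "annihilator (leavitt K G) (cycle_module K G c v) = annihilator (leavitt K G) (cycle_module K G d w)"
      using isomorphic_annihilator_eq[OF left_module_cycle_module D.left_module_cycle_module iso] .
    have R_eq: "u \<in> R \<longleftrightarrow> u \<in> D.R" if "u \<in> verts G" for u
      using vertex_annihilates_iff[OF that] D.vertex_annihilates_iff[OF that] ann by simp
    \<comment> \<open>Equal supports mean that each cycle reaches the other. The vertex
      \<open>w'\<close> of \<open>d\<close> reached from \<open>c\<close> leads back to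
      \<open>c\<close>, hence lies on \<open>c\<close>, and exclusivity applies.\<close>
    have "v \<in> D.R" using R_eq v_in_cv cv_verts cv_subset_R by blast
    then obtain w' p where p: "w' \<in> D.cv" "awalk v p w'" unfolding D.in_R_iff by blast
    then have "w' \<in> R" using R_eq D.cv_verts D.cv_subset_R by blast
    then obtain v' q where q: "v' \<in> cv" "awalk w' q v'" unfolding in_R_iff by blast
    have "w' \<in> cv" by (rule path_verts_in_cv[OF p(2) q(2) v_in_cv q(1)])
    then show ?thesis using p(1) exclusive D.cycle_c by (auto simp: exclusive_cycle_def)
  qed
  have mod: "cycle_module K G d w = cycle_module K G c w" "cycle_grading K G d w = cycle_grading K G c w"
    and wc: "w \<in> cv" if "same_cycle c d"
    using cycle_module_cong[of G d c] same_cycle_verts[OF that, of G] w by auto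
  have gr_iso: "isomorphic A M M'" if "graded_isomorphic A M Mg M' Mg'"
    for A :: "('v, 'e, 'k) lpa_elem ring" and M Mg M' Mg'
    using that by (auto simp: graded_isomorphic_def isomorphic_def)
  have refl: "graded_isomorphic A M Mg M Mg" for A :: "('v, 'e, 'k) lpa_elem ring" and M Mg
    unfolding graded_isomorphic_def module_iso_def by (auto intro!: exI[of _ "\<lambda>x. x"] simp: bij_betw_def)
  show iso_iff: "isomorphic (leavitt K G) (cycle_module K G c v) (cycle_module K G d w) \<longleftrightarrow> same_cycle c d"
  proof
    assume sc: "same_cycle c d"
    obtain r where "awalk v r w" by (rule cv_path[OF v_in_cv wc[OF sc]])
    then show "isomorphic (leavitt K G) (cycle_module K G c v) (cycle_module K G d w)"
      unfolding mod[OF sc] using graded_isomorphic_shift[OF v_in_cv wc[OF sc]] by (blast intro: gr_iso)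
  qed (rule same)
  show "graded_isomorphic (leavitt K G) (cycle_module K G c v) (cycle_grading K G c v)
      (cycle_module K G d w) (cycle_grading K G d w) \<longleftrightarrow> same_cycle c d \<and> v = w"
  proof
    assume gi: "graded_isomorphic (leavitt K G) (cycle_module K G c v) (cycle_grading K G c v)
      (cycle_module K G d w) (cycle_grading K G d w)"
    then have sc: "same_cycle c d" using gr_iso iso_iff by blast
    then show "same_cycle c d \<and> v = w"
      using graded_isomorphic_same_base[OF wc[OF sc]] gi unfolding mod[OF sc] by blast
  next
    assume sc: "same_cycle c d \<and> v = w"
    then show "graded_isomorphic (leavitt K G) (cycle_module K G c v) (cycle_grading K G c v)
      (cycle_module K G d w) (cycle_grading K G d w)"
      using mod refl by simp
  qed
qed

end

theorem proposition4p6: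
  fixes K :: "'k::field itself"
    and G :: "('v, 'e) pre_digraph"
    and c :: "'e list"
    and v :: 'v
    and H :: "'v set"
  assumes "wf_digraph G"
    and "exclusive_cycle G c"
    and "v \<in> cycle_verts G c"
    and "H = verts G - root_set G (cycle_verts G c)"
  shows
    "(annihilator (leavitt K G) (cycle_module K G c v) =
       admissible_ideal K G H (breaking_vertices G H)) \<and>
     (graded_simple_module (leavitt K G) (leavitt_grading K G)
         (cycle_module K G c v) (cycle_grading K G c v) \<and>
       \<not> simple_module (leavitt K G) (cycle_module K G c v)) \<and>
     (\<forall>w. card (cycle_verts G c) > 1 \<and> w \<in> cycle_verts G c \<and> w \<noteq> v \<longrightarrow>
       graded_isomorphic (leavitt K G)
         (cycle_module K G c v) (cycle_grading K G c v)
         (cycle_module K G c w)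
         (shift_grading (int (length (path_in_cycle G c v w))) (cycle_grading K G c w))) \<and>
     (\<forall>d w. exclusive_cycle G d \<and> w \<in> cycle_verts G d \<longrightarrow>
       (graded_isomorphic (leavitt K G)
          (cycle_module K G c v) (cycle_grading K G c v)
          (cycle_module K G d w) (cycle_grading K G d w)
        \<longleftrightarrow> same_cycle c d \<and> v = w) \<and>
       (isomorphic (leavitt K G) (cycle_module K G c v) (cycle_module K G d w)
        \<longleftrightarrow> same_cycle c d)) \<and>
     ((\<forall>\<alpha>. infinite_path G \<alpha> \<longrightarrow>
        \<not> isomorphic (leavitt K G) (cycle_module K G c v) (chen_module K G \<alpha>) \<and>
        annihilator (leavitt K G) (cycle_module K G c v) \<noteq>
          annihilator (leavitt K G) (chen_module K G \<alpha>)) \<and>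
     (\<forall>\<alpha> d. \<forall>f :: 'k laurent.
        infinite_path G \<alpha> \<and> pre_digraph.cycle G d \<and> tail_equivalent \<alpha> (repeat_path d) \<and>
        Factorial_Ring.irreducible f \<longrightarrow>
        \<not> isomorphic (leavitt K G) (cycle_module K G c v) (twisted_chen_module G \<alpha> d f) \<and>
        annihilator (leavitt K G) (cycle_module K G c v) \<noteq>
          annihilator (leavitt K G) (twisted_chen_module G \<alpha> d f)) \<and>
     (\<forall>u. sink G u \<or> infinite_emitter G u \<longrightarrow>
        \<not> isomorphic (leavitt K G) (cycle_module K G c v) (finite_path_module K G u) \<and>
        annihilator (leavitt K G) (cycle_module K G c v) \<noteq>
          annihilator (leavitt K G) (finite_path_module K G u)))"
proof -
  interpret wf_digraph G by fact
  interpret cycle_module_system K G c v by unfold_locales fact+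
  show ?thesis
    unfolding assms(4)
  proof (intro conjI allI impI)
    show "annihilator (leavitt K G) (cycle_module K G c v) =
        admissible_ideal K G (verts G - R) (breaking_vertices G (verts G - R))"
      by (rule annihilator_cycle_module)
    show "graded_simple_module (leavitt K G) (leavitt_grading K G) (cycle_module K G c v) (cycle_grading K G c v)"
      unfolding cycle_module_eq by (rule graded_simple)
    show "\<not> simple_module (leavitt K G) (cycle_module K G c v)"
      unfolding cycle_module_eq by (rule not_simple)
    show "graded_isomorphic (leavitt K G) (cycle_module K G c v) (cycle_grading K G c v)
        (cycle_module K G c w) (shift_grading (int (length (path_in_cycle G c v w))) (cycle_grading K G c w))"
      if "1 < card cv \<and> w \<in> cv \<and> w \<noteq> v" for w
      using that by (intro graded_isomorphic_shift path_in_cycle v_in_cv) simp_all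
  qed (use isomorphic_cycle_module_iff chen_module_case twisted_chen_module_case
      finite_path_module_case finite_path_annihilator_neq in blast)+
qed

end
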